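(* Let $T\in\mathcal L(\mathcal H_n)$ be an unbounded normal operator, $\mathfrak I\in\mathbb S$, $\Omega_{\mathfrak I}^+=\sigma_S(T)\cap\mathbb C_{\mathfrak I}^+$, let $J$ be an imaginary operator such that the bounded transform $Z_T$ of $T$ has the form $Z_T=A_{Z_T}+JB_{Z_T}$ with $A_{Z_T}\in\mathcal B(\mathcal H_n)$ self-adjoint, $B_{Z_T}\in\mathcal B(\mathcal H_n)$ positive and $A_{Z_T},B_{Z_T},J$ mutually commuting, and let $E$ be the spectral measure of $T$ on $\mathscr B(\Omega_{\mathfrak I}^+)$ (with which $J$ is associated), so that $T=\int_{\Omega_{\mathfrak I}^+}\mathrm{Re}(\lambda)\,dE(\lambda)+\int_{\Omega_{\mathfrak I}^+}\mathrm{Im}(\lambda)\,dE(\lambda)\,J$. For any Borel measurable, $E$-a.e. finite $f,g:\Omega_{\mathfrak I}^+\to\mathbb C_{\mathfrak I}\cup\{\infty\}$ and $c\in\mathbb C_{\mathfrak I}$, the spectral integrals $\mathbb I(f),\mathbb I(g)\in\mathcal L(\mathcal H_n)$ have the following properties: (i) $\mathbb I(\bar f)=\mathbb I(f)^*$. (ii) $\mathbb I(fg)=\overline{\mathbb I(f)\mathbb I(g)}$. (iii) $\mathbb I(fc+g)=\overline{\mathbb I(f)(\mathrm{Re}(c)I+\mathrm{Im}(c)J)+\mathbb I(g)}$ for all $c\in\mathbb C_{\mathfrak I}$. (iv) $\mathbb I(f)$ is a closed normal operator belonging to $\mathcal L(\mathcal H_n)$. (v) $\mathcal D(\mathbb I(f)\mathbb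 I(g))=\mathcal D(\mathbb I(fg))\cap\mathcal D(\mathbb I(g))$. (vi) If $\Pi_\pm(J,\mathfrak I)$ denotes the projection onto the right complex subspace $\mathcal H_\pm(J,\mathfrak I)$, respectively, then $$\langle\mathbb I(f)x,y\rangle=\int_{\Omega_{\mathfrak I}^+}d\langle E(\lambda)\Pi_+(J,\mathfrak I)x,y\rangle\,f(\lambda)+\int_{\Omega_{\mathfrak I}^+}d\langle E(\lambda)\Pi_-(J,\mathfrak I)x,y\rangle\,\overline{f(\lambda)}\qquad\text{for }x\in\mathcal D(\mathbb I(f)),\ y\in\mathcal H_n.$$ (vii) If $f$ is nonnegative $E$-a.e., then $\mathbb I(f)$ is positive. (viii) $\mathbb I(f)^{-1}\in\mathcal L(\mathcal H_n)$ exists if and only if $f(\lambda)\neq0$ $E$-a.e. In this case, $\mathbb I(f)^{-1}=\mathbb I(1/f)$. (ix) The spectral measure $E_{\mathbb I(f)}$ of $\mathbb I(f)$ satisfies $E_{\mathbb I(f)}(M)=E(f^{-1}(M\cap f(\Omega_{\mathfrak I}^+)))$ for Borel $M$.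
   Context: Let $n\ge1$. $\mathbb R_n$ is the real Clifford algebra (of real dimension $2^n$) generated by $e_1,\dots,e_n$ with $e_i^2=-1$ and $e_ie_j=-e_je_i$ for $i\ne j$; it has basis $e_\alpha=e_{i_1}\cdots e_{i_r}$ for $\alpha=\{i_1<\cdots<i_r\}\subseteq\{1,\dots,n\}$, $e_\emptyset=1$. For $a=\sum_\alpha a_\alpha e_\alpha$ ($a_\alpha\in\mathbb R$): $\mathrm{Re}(a)=a_\emptyset$, $|a|=(\sum_\alpha a_\alpha^2)^{1/2}$, and $a\mapsto\bar a$ is the real-linear map with $\overline{ab}=\bar b\,\bar a$, $\bar 1=1$, $\bar e_j=-e_j$. $a\succeq 0$ means $a=b\bar b$ for some $b\in\mathbb R_n$. $\mathcal H$ is a real Hilbert space and $\mathcal H_n=\mathcal H\otimes\mathbb R_n$ is the two-sided Clifford module of elements $x=\sum_\alpha x_\alpha e_\alpha$ ($x_\alpha\in\mathcal H$), with $\langle x,y\rangle=\sum_{\alpha,\beta}\bar e_\beta e_\alpha\langle x_\alpha,y_\beta\rangle_{\mathcal H}\in\mathbb R_n$ (so $\langle xa,y\rangle=\langle x,y\rangle a$) and norm $\|x\|=(\sum_\alpha\|x_\alpha\|^2)^{1/2}=(\mathrm{Re}\langle x,x\rangle)^{1/2}$. $\mathcal L(\mathcal H_n)$ is the set of right $\mathbb R_n$-linear operators $T:\mathcal D(T)\to\mathcal H_n$, $\mathcal D(T)$ a right submodule; $\mathcal B(\mathcal H_n)$ is the set of everywhere defined bounded ones. For densely defined $T$, $\mathcal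 D(T^* )$ is the set of $y$ for which there is $z$ with $\langle Tx,y\rangle=\langle x,z\rangle$ for all $x\in\mathcal D(T)$, and $T^*y=z$. $T$ is normal if it is densely defined and closed, $\mathcal D(T)=\mathcal D(T^* )$ and $TT^*=T^*T$; self-adjoint if $T=T^*$; positive if $\langle Tx,x\rangle\succeq0$ for all $x\in\mathcal D(T)$. $\overline S$ is the closure of a closable operator $S$. A bounded positive operator has a unique bounded positive square root. The bounded transform of a densely defined closed $T$ is $Z_T=T((I+T^*T)^{-1})^{1/2}$ (bounded, and normal when $T$ is). An imaginary operator is a unitary $J\in\mathcal B(\mathcal H_n)$ with $J^*=-J$. An orthogonal projection is a self-adjoint $P\in\mathcal B(\mathcal H_n)$ with $P^2=P$. $\mathbb R^{n+1}$ is identified with the paravectors $s=s_0+\sum_{j=1}^n s_je_j$. $\mathbb S=\{\sum_{j=1}^n\mathfrak I_je_j:\sum\mathfrak I_j^2=1\}$ (so $\mathfrak I^2=-1$). For $\mathfrak I\in\mathbb S$, $\mathbb C_{\mathfrak I}=\{\lambda_0+\lambda_1\mathfrak I:\lambda_0,\lambda_1\in\mathbb R\}$, $\mathbb C_{\mathfrak I}^+=\{\lambda_0+\lambda_1\mathfrak I:\lambda_1\ge0\}$, $\mathrm{Re}(\lambda)=\lambda_0$, $\mathrm{Im}(\lambda)=\lambda_1\in\mathbb R$. With $\mathcal Q_s(T)=T^2-2\mathrm{Re}(s)T+|s|^2I$ on $\mathcal D(T^2)$, $\rho_S(T)$ is the set of $s\in\mathbb R^{n+1}$ such that $\mathcal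 Q_s(T)$ has trivial kernel, dense range, and bounded inverse $\mathrm{Ran}\,\mathcal Q_s(T)\to\mathcal D(T^2)$; $\sigma_S(T)=\mathbb R^{n+1}\setminus\rho_S(T)$. A spectral measure on a $\sigma$-algebra $\mathscr A$ of subsets of $\Omega$ is a map $E$ from $\mathscr A$ to orthogonal projections on $\mathcal H_n$ that is countably additive (in the strong operator topology) with $E(\Omega)=I$. $J$ is associated with $E$ if $JE(M)=E(M)J$ for all $M\in\mathscr A$. For a simple function $f=\sum_jc_j\chi_{M_j}$ (disjoint $M_j$, $c_j\in\mathbb C_{\mathfrak I}$), $\mathbb I(f)=\sum_j\{\mathrm{Re}(c_j)E(M_j)+\mathrm{Im}(c_j)E(M_j)J\}$; for bounded measurable $f$, $\mathbb I(f)$ is the operator norm limit of $\mathbb I(f_j)$ for simple $f_j\to f$ uniformly; for measurable $E$-a.e. finite $f:\Omega\to\mathbb C_{\mathfrak I}\cup\{\infty\}$, $\mathcal D(\mathbb I(f))=\{x:\int_\Omega|f|^2\,d(\mathrm{Re}\langle E(\lambda)x,x\rangle)<\infty\}$ and $\mathbb I(f)x=\lim_j\mathbb I(f\chi_{M_j})x$, for any sequence $M_j\subseteq M_{j+1}$ in $\mathscr A$ with $f$ bounded on each $M_j$ and $E(\cup_jM_j)=I$. One writes $\mathbb I(f)=\int\mathrm{Re}(f)\,dE+\int\mathrm{Im}(f)\,dE\,J$. Conventions: $1/\infty=0$, $1/0=\infty$. The spectral measure of a normal operator $N$ is the spectral measure on $\mathscr B(\sigma_S(N)\cap\mathbb C_{\mathfrak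 I}^+)$ (extended to $\mathscr B(\mathbb C_{\mathfrak I}^+)$ by $M\mapsto M\cap\sigma_S(N)$) representing $N$ as $\int\mathrm{Re}(\lambda)dE(\lambda)+\int\mathrm{Im}(\lambda)dE(\lambda)J$. For an $\mathbb R_n$-valued measure $\mu$ and real $h$, $\int h\,d\mu$ is defined componentwise in the basis $e_\alpha$; for $f$ with values in $\mathbb C_{\mathfrak I}$, $\int d\mu\,f=\int\mathrm{Re}(f)\,d\mu+(\int\mathrm{Im}(f)\,d\mu)\,\mathfrak I$. Also $\mathcal H_\pm(J,\mathfrak I)=\{x\in\mathcal H_n:Jx=x(\pm\mathfrak I)\}$, $\mathcal H_n=\mathcal H_+(J,\mathfrak I)\oplus\mathcal H_-(J,\mathfrak I)$, and $\Pi_\pm(J,\mathfrak I)$ are the projections of this decomposition, $\Pi_\pm x=\tfrac12(x\mp Jx\,\mathfrak I)$.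
   Formalization: In (ix), existence of the spectral measure, and the formula for any imaginary operator, are claimed only if f is E-a.e. in the closed upper half plane or ∞; otherwise only for measures formed with the given J. For f = −𝔍 the printed claim fails, since 𝕀(f) = −J. *)

theory Defs
  imports "HOL-Analysis.Analysis"
begin

section \<open>The real Clifford algebra and Clifford modules\<close>

text \<open>
  The generators are indexed by a finite linearly ordered type \<open>'n\<close>, so that the basis elements
  are indexed by \<open>'n set\<close>.  The library makes \<open>real ^ 'n set\<close> and \<open>'h ^ 'n set\<close> inner product
  spaces; \<^term>\<open>norm\<close> is the norm of the Clifford algebra respectively of the Clifford module, and
  \<open>x \<bullet> y\<close> is the real part of the Clifford valued inner product.  The library operations
  \<open>(*)\<close> and \<open>1\<close> on vectors are componentwise and are never used here.
\<close>

type_synonym 'n clifford = "real ^ ('n set)"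
type_synonym ('h, 'n) cmodule = "'h ^ ('n set)"

definition ebasis :: "'n::{finite,linorder} set \<Rightarrow> 'n clifford" where
  "ebasis \<alpha> = axis \<alpha> 1"

text \<open>
  Sorting the word \<open>e\<^sub>\<alpha> e\<^sub>\<beta>\<close> swaps every \<open>i \<in> \<alpha>\<close> with every smaller \<open>j \<in> \<beta>\<close>, and every common
  index contributes \<open>e\<^sub>i\<^sup>2 = -1\<close>; hence \<open>e\<^sub>\<alpha> e\<^sub>\<beta> = clifford_sign \<alpha> \<beta> e\<^sub>\<gamma>\<close> for the symmetric
  difference \<open>\<gamma>\<close> of \<open>\<alpha>\<close> and \<open>\<beta>\<close>.
\<close>
definition clifford_sign :: "'n::{finite,linorder} set \<Rightarrow> 'n set \<Rightarrow> real" where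
  "clifford_sign \<alpha> \<beta> = (-1) ^ card {(i, j). i \<in> \<alpha> \<and> j \<in> \<beta> \<and> j \<le> i}"

text \<open>
  Right multiplication of a module element by a Clifford number.  For \<open>'h = real\<close> this is the
  product of the Clifford algebra.
\<close>
definition cmult :: "('h::real_vector, 'n::{finite,linorder}) cmodule \<Rightarrow> 'n clifford \<Rightarrow> ('h, 'n) cmodule"
    (infixl "\<odot>" 75) where
  "x \<odot> a = (\<Sum>\<alpha>\<in>UNIV. \<Sum>\<beta>\<in>UNIV.
      axis (sym_diff \<alpha> \<beta>) ((clifford_sign \<alpha> \<beta> * a $ \<beta>) *\<^sub>R x $ \<alpha>))"

text \<open>The sign arises from reversing a word of length \<open>r\<close> and negating each of its \<open>r\<close> letters.\<close>
definition cconj :: "'n::{finite,linorder} clifford \<Rightarrow> 'n clifford" where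
  "cconj a = (\<chi> \<alpha>. (-1) ^ (card \<alpha> * (card \<alpha> + 1) div 2) * a $ \<alpha>)"

definition cRe :: "'n::{finite,linorder} clifford \<Rightarrow> real" where
  "cRe a = a $ {}"

definition cnonneg :: "'n::{finite,linorder} clifford \<Rightarrow> bool" where
  "cnonneg a \<longleftrightarrow> (\<exists>b. a = b \<odot> cconj b)"

definition cinner ::
    "('h::real_inner, 'n::{finite,linorder}) cmodule \<Rightarrow> ('h, 'n) cmodule \<Rightarrow> 'n clifford" where
  "cinner x y = (\<Sum>\<alpha>\<in>UNIV. \<Sum>\<beta>\<in>UNIV. (x $ \<alpha> \<bullet> y $ \<beta>) *\<^sub>R (cconj (ebasis \<beta>) \<odot> ebasis \<alpha>))"

subsection \<open>Basic laws\<close>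

lemma minus_one_power_card_sym_diff:
  assumes "finite A" "finite B"
  shows "(-1::real) ^ card (sym_diff A B) = (-1) ^ card A * (-1) ^ card B"
proof -
  have 1: "card (A \<inter> B) + card (A - B) = card A" "card (A \<inter> B) + card (B - A) = card B"
    using assms by (metis add.commute card_Int_Diff, metis Int_commute add.commute card_Int_Diff)
  have "card (sym_diff A B) = card (A - B) + card (B - A)"
    using assms by (intro card_Un_disjoint) auto
  moreover have "card A + card B = card (A - B) + card (B - A) + 2 * card (A \<inter> B)"
    using 1 by simp
  ultimately show ?thesis
    by (simp flip: power_add) (simp add: power_add power_mult)
qed

lemma clifford_sign_sym_diff_left:
  "clifford_sign (sym_diff \<alpha> \<beta>) \<gamma> = clifford_sign \<alpha> \<gamma> * clifford_sign \<beta> \<gamma>"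
proof -
  have "{(i, j). i \<in> sym_diff \<alpha> \<beta> \<and> j \<in> \<gamma> \<and> j \<le> i} =
      sym_diff {(i, j). i \<in> \<alpha> \<and> j \<in> \<gamma> \<and> j \<le> i} {(i, j). i \<in> \<beta> \<and> j \<in> \<gamma> \<and> j \<le> i}"
    by auto
  then show ?thesis
    unfolding clifford_sign_def by (simp only: minus_one_power_card_sym_diff finite)
qed

lemma clifford_sign_sym_diff_right:
  "clifford_sign \<gamma> (sym_diff \<alpha> \<beta>) = clifford_sign \<gamma> \<alpha> * clifford_sign \<gamma> \<beta>"
proof -
  have "{(i, j). i \<in> \<gamma> \<and> j \<in> sym_diff \<alpha> \<beta> \<and> j \<le> i} =
      sym_diff {(i, j). i \<in> \<gamma> \<and> j \<in> \<alpha> \<and> j \<le> i} {(i, j). i \<in> \<gamma> \<and> j \<in> \<beta> \<and> j \<le> i}"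
    by auto
  then show ?thesis
    unfolding clifford_sign_def by (simp only: minus_one_power_card_sym_diff finite)
qed

lemma clifford_sign_self:
  "clifford_sign \<alpha> \<alpha> = (-1) ^ (card \<alpha> * (card \<alpha> + 1) div 2)"
proof -
  define L where "L = {(i, j). i \<in> \<alpha> \<and> j \<in> \<alpha> \<and> j \<le> i}"
  have c: "card (L\<inverse>) = card L" by (rule card_inverse)
  have u: "L \<union> L\<inverse> = \<alpha> \<times> \<alpha>" unfolding L_def by auto
  have i: "L \<inter> L\<inverse> = (\<lambda>k. (k, k)) ` \<alpha>" unfolding L_def by auto
  have "card L + card (L\<inverse>) = card (L \<union> L\<inverse>) + card (L \<inter> L\<inverse>)"
    by (rule card_Un_Int) auto
  also have "\<dots> = card \<alpha> * card \<alpha> + card \<alpha>"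
    unfolding u i by (simp add: card_cartesian_product card_image inj_on_def)
  finally have "card L = card \<alpha> * (card \<alpha> + 1) div 2" using c by simp
  then show ?thesis unfolding clifford_sign_def L_def by simp
qed

lemma axis_scaleR: "axis k (r *\<^sub>R v) = r *\<^sub>R axis k v"
  by (simp add: axis_def vec_eq_iff)

lemma axis_plus: "axis k (v + w :: 'a::real_vector) = axis k v + axis k w"
  by (simp add: axis_def vec_eq_iff)

lemma cmodule_expand: "(x :: ('h::real_vector) ^ 'k) = (\<Sum>\<alpha>\<in>UNIV. axis \<alpha> (x $ \<alpha>))"
  by (simp add: vec_eq_iff axis_def if_distrib cong: if_cong)

lemma cmult_add_left: "(x + y) \<odot> a = x \<odot> a + y \<odot> a"
  by (simp add: cmult_def scaleR_right_distrib axis_plus sum.distrib)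

lemma cmult_add_right: "x \<odot> (a + b) = x \<odot> a + x \<odot> b"
  by (simp add: cmult_def algebra_simps axis_plus sum.distrib)

lemma cmult_scaleR_left: "(r *\<^sub>R x) \<odot> a = r *\<^sub>R (x \<odot> a)"
  by (simp add: cmult_def axis_scaleR scaleR_sum_right mult.commute flip: scaleR_scaleR)
     (simp add: algebra_simps)

lemma cmult_scaleR_right: "x \<odot> (r *\<^sub>R a) = r *\<^sub>R (x \<odot> a)"
  by (simp add: cmult_def axis_scaleR scaleR_sum_right algebra_simps)

lemma cmult_zero [simp]: "0 \<odot> a = 0" "x \<odot> 0 = 0"
  using cmult_scaleR_left[of 0 0 a] cmult_scaleR_right[of x 0 0] by auto

lemma cmult_sum_left: "(\<Sum>i\<in>I. x i) \<odot> a = (\<Sum>i\<in>I. x i \<odot> a)"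
  by (induction I rule: infinite_finite_induct) (simp_all add: cmult_add_left)

lemma cmult_sum_right: "x \<odot> (\<Sum>i\<in>I. a i) = (\<Sum>i\<in>I. x \<odot> a i)"
  by (induction I rule: infinite_finite_induct) (simp_all add: cmult_add_right)

lemma cmult_axis: "axis \<alpha> v \<odot> axis \<beta> r = axis (sym_diff \<alpha> \<beta>) ((clifford_sign \<alpha> \<beta> * r) *\<^sub>R v)"
proof -
  have "axis \<alpha> v \<odot> axis \<beta> r = (\<Sum>\<alpha>'\<in>UNIV. \<Sum>\<beta>'\<in>UNIV.
     if \<beta>' = \<beta> then (if \<alpha>' = \<alpha> then axis (sym_diff \<alpha> \<beta>) ((clifford_sign \<alpha> \<beta> * r) *\<^sub>R v) else 0) else 0)"
    unfolding cmult_def by (intro sum.cong refl) (auto simp: axis_def vec_eq_iff)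
  then show ?thesis by simp
qed

lemma ebasis_mult: "ebasis \<alpha> \<odot> ebasis \<beta> = clifford_sign \<alpha> \<beta> *\<^sub>R ebasis (sym_diff \<alpha> \<beta>)"
  by (simp add: ebasis_def cmult_axis flip: axis_scaleR)

lemma ebasis_square: "ebasis {j} \<odot> ebasis {j} = - ebasis {}"
proof -
  have "{(i, k). i \<in> {j} \<and> k \<in> {j} \<and> k \<le> i} = {(j, j)}" by auto
  then show ?thesis unfolding ebasis_mult clifford_sign_def by simp
qed

lemma ebasis_anticommute:
  assumes "i \<noteq> j"
  shows "ebasis {i} \<odot> ebasis {j} = - (ebasis {j} \<odot> ebasis {i})"
proof -
  have *: "{(a, b). a \<in> {i} \<and> b \<in> {j} \<and> b \<le> a} = (if j \<le> i then {(i, j)} else {})" for i j :: 'a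
    by auto
  have "sym_diff {i} {j} = {i, j}" "sym_diff {j} {i} = {i, j}" using assms by auto
  with assms show ?thesis unfolding ebasis_mult clifford_sign_def * by auto
qed

lemma ebasis_insert:
  assumes "\<And>j. j \<in> \<alpha> \<Longrightarrow> i < j"
  shows "ebasis (insert i \<alpha>) = ebasis {i} \<odot> ebasis \<alpha>"
proof -
  have "sym_diff {i} \<alpha> = insert i \<alpha>" using assms by auto
  moreover have "{(a, b). a \<in> {i} \<and> b \<in> \<alpha> \<and> b \<le> a} = {}" using assms by fastforce
  ultimately show ?thesis unfolding ebasis_mult clifford_sign_def
    by (simp only: card.empty power_0 scaleR_one)
qed

lemma cmult_one [simp]: "x \<odot> ebasis {} = x"
proof -
  have "x \<odot> ebasis {} = (\<Sum>\<alpha>\<in>UNIV. axis \<alpha> (x $ \<alpha>)) \<odot> ebasis {}"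
    by (simp flip: cmodule_expand)
  also have "\<dots> = (\<Sum>\<alpha>\<in>UNIV. axis \<alpha> (x $ \<alpha>))"
    by (simp add: cmult_sum_left ebasis_def cmult_axis clifford_sign_def)
  finally show ?thesis by (simp flip: cmodule_expand)
qed

lemma one_cmult [simp]: "ebasis {} \<odot> a = a"
proof -
  have "ebasis {} \<odot> a = ebasis {} \<odot> (\<Sum>\<alpha>\<in>UNIV. axis \<alpha> (a $ \<alpha>))"
    by (simp flip: cmodule_expand)
  also have "\<dots> = (\<Sum>\<alpha>\<in>UNIV. axis \<alpha> (a $ \<alpha>))"
    by (simp add: cmult_sum_right ebasis_def cmult_axis clifford_sign_def)
  finally show ?thesis by (simp flip: cmodule_expand)
qed

lemma cmult_assoc: "(x \<odot> a) \<odot> b = x \<odot> (a \<odot> b)"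
proof -
  have *: "(axis \<alpha> v \<odot> axis \<beta> r) \<odot> axis \<gamma> s = axis \<alpha> v \<odot> (axis \<beta> r \<odot> axis \<gamma> s)"
    for \<alpha> \<beta> \<gamma> :: "'b set" and v :: 'a and r s :: real
  proof -
    have "sym_diff (sym_diff \<alpha> \<beta>) \<gamma> = sym_diff \<alpha> (sym_diff \<beta> \<gamma>)" by auto
    then show ?thesis
      by (simp only: cmult_axis clifford_sign_sym_diff_left clifford_sign_sym_diff_right)
        (simp add: mult_ac)
  qed
  have "((\<Sum>\<alpha>\<in>UNIV. axis \<alpha> (x $ \<alpha>)) \<odot> (\<Sum>\<beta>\<in>UNIV. axis \<beta> (a $ \<beta>))) \<odot> (\<Sum>\<gamma>\<in>UNIV. axis \<gamma> (b $ \<gamma>))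
      = (\<Sum>\<alpha>\<in>UNIV. axis \<alpha> (x $ \<alpha>)) \<odot> ((\<Sum>\<beta>\<in>UNIV. axis \<beta> (a $ \<beta>)) \<odot> (\<Sum>\<gamma>\<in>UNIV. axis \<gamma> (b $ \<gamma>)))"
    by (simp add: cmult_sum_left cmult_sum_right *)
  then show ?thesis by (simp flip: cmodule_expand)
qed

lemma cconj_linear: "cconj (a + b) = cconj a + cconj b" "cconj (r *\<^sub>R a) = r *\<^sub>R cconj a"
  by (simp_all add: cconj_def vec_eq_iff algebra_simps)

lemma cconj_sum: "cconj (\<Sum>i\<in>I. a i) = (\<Sum>i\<in>I. cconj (a i))"
  using cconj_linear(2)[of 0 0]
  by (induction I rule: infinite_finite_induct) (simp_all add: cconj_linear(1))

lemma cconj_axis: "cconj (axis \<alpha> r) = axis \<alpha> (clifford_sign \<alpha> \<alpha> * r)"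
  by (simp add: cconj_def clifford_sign_self axis_def vec_eq_iff)

lemma cconj_generators: "cconj (ebasis {}) = ebasis {}" "cconj (ebasis {j}) = - ebasis {j}"
  by (simp_all add: ebasis_def cconj_axis clifford_sign_self) (simp add: axis_def vec_eq_iff)

lemma cconj_cmult: "cconj (a \<odot> b) = cconj b \<odot> cconj a"
proof -
  have *: "cconj (axis \<alpha> r \<odot> axis \<beta> s) = cconj (axis \<beta> s) \<odot> cconj (axis \<alpha> r)"
    for \<alpha> \<beta> :: "'a set" and r s :: real
  proof -
    have sq: "clifford_sign \<alpha> \<beta> * clifford_sign \<alpha> \<beta> = 1"
      by (simp add: clifford_sign_def flip: power_mult_distrib)
    have "sym_diff \<alpha> \<beta> = sym_diff \<beta> \<alpha>" by auto
    then have "cconj (axis \<alpha> r \<odot> axis \<beta> s) = axis (sym_diff \<beta> \<alpha>)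
        ((clifford_sign \<alpha> \<beta> * clifford_sign \<alpha> \<beta>) *
          (clifford_sign \<beta> \<alpha> * clifford_sign \<alpha> \<alpha> * clifford_sign \<beta> \<beta> * r * s))"
      by (simp only: cmult_axis cconj_axis clifford_sign_sym_diff_left clifford_sign_sym_diff_right
          real_scaleR_def) (simp add: mult_ac)
    then show ?thesis unfolding sq by (simp add: cmult_axis cconj_axis mult_ac)
  qed
  have "cconj ((\<Sum>\<alpha>\<in>UNIV. axis \<alpha> (a $ \<alpha>)) \<odot> (\<Sum>\<beta>\<in>UNIV. axis \<beta> (b $ \<beta>)))
      = cconj (\<Sum>\<beta>\<in>UNIV. axis \<beta> (b $ \<beta>)) \<odot> cconj (\<Sum>\<alpha>\<in>UNIV. axis \<alpha> (a $ \<alpha>))"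
    by (simp add: cmult_sum_left cmult_sum_right cconj_sum *) (rule sum.swap)
  then show ?thesis by (simp flip: cmodule_expand)
qed

lemma cRe_cinner: "cRe (cinner x y) = x \<bullet> y"
proof -
  have *: "cconj (ebasis \<beta>) \<odot> ebasis \<alpha> =
      (clifford_sign \<beta> \<beta> * clifford_sign \<beta> \<alpha>) *\<^sub>R ebasis (sym_diff \<beta> \<alpha>)" for \<alpha> \<beta> :: "'a set"
    unfolding ebasis_def cconj_axis cmult_axis by (simp add: axis_scaleR[symmetric] mult_ac)
  have sq: "clifford_sign \<alpha> \<alpha> * clifford_sign \<alpha> \<alpha> = 1" for \<alpha> :: "'a set"
    by (simp add: clifford_sign_def flip: power_mult_distrib)
  have "cRe (cinner x y) = (\<Sum>\<alpha>\<in>UNIV. \<Sum>\<beta>\<in>UNIV. if \<beta> = \<alpha> then x $ \<alpha> \<bullet> y $ \<alpha> else 0)"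
    unfolding cRe_def cinner_def * sum_component
    by (intro sum.cong refl) (auto simp: ebasis_def axis_def sq)
  then show ?thesis by (simp add: inner_vec_def)
qed

lemma cinner_cmult_left:
  fixes x y :: "('h::real_inner, 'n::{finite,linorder}) cmodule"
  shows "cinner (x \<odot> a) y = cinner x y \<odot> a"
proof -
  have add: "cinner (x + x') y = cinner x y + cinner x' y" for x x' :: "('h, 'n) cmodule"
    by (simp add: cinner_def inner_add_left scaleR_left_distrib sum.distrib)
  have sum: "cinner (\<Sum>i\<in>I. x i) y = (\<Sum>i\<in>I. cinner (x i) y)" for I and x :: "'n set \<Rightarrow> ('h, 'n) cmodule"
    using add[of 0 0]
    by (induction I rule: infinite_finite_induct) (simp_all add: add)
  have ax: "cinner (axis \<alpha> v) y = (\<Sum>\<beta>\<in>UNIV. (v \<bullet> y $ \<beta>) *\<^sub>R (cconj (ebasis \<beta>) \<odot> ebasis \<alpha>))"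
    for \<alpha> :: "'n set" and v :: 'h
  proof -
    have "cinner (axis \<alpha> v) y = (\<Sum>\<alpha>'\<in>UNIV. if \<alpha>' = \<alpha> then
        (\<Sum>\<beta>\<in>UNIV. (v \<bullet> y $ \<beta>) *\<^sub>R (cconj (ebasis \<beta>) \<odot> ebasis \<alpha>)) else 0)"
      unfolding cinner_def by (intro sum.cong refl) (auto simp: axis_def)
    then show ?thesis by simp
  qed
  have e: "axis \<gamma> r = r *\<^sub>R ebasis \<gamma>" for \<gamma> :: "'n set" and r :: real
    by (simp add: ebasis_def flip: axis_scaleR)
  have *: "cinner (axis \<alpha> v \<odot> axis \<gamma> r) y = cinner (axis \<alpha> v) y \<odot> axis \<gamma> r"
    for \<alpha> \<gamma> :: "'n set" and v :: 'h and r :: real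
    unfolding cmult_axis ax
    by (simp add: e cmult_sum_left cmult_scaleR_left cmult_scaleR_right cmult_assoc ebasis_mult
        scaleR_sum_right mult_ac)
  have "cinner ((\<Sum>\<alpha>\<in>UNIV. axis \<alpha> (x $ \<alpha>)) \<odot> (\<Sum>\<gamma>\<in>UNIV. axis \<gamma> (a $ \<gamma>))) y
      = cinner (\<Sum>\<alpha>\<in>UNIV. axis \<alpha> (x $ \<alpha>)) y \<odot> (\<Sum>\<gamma>\<in>UNIV. axis \<gamma> (a $ \<gamma>))"
    by (simp add: cmult_sum_left cmult_sum_right sum *)
  then show ?thesis by (simp flip: cmodule_expand)
qed

subsection \<open>Paravectors, imaginary units and complex planes\<close>

definition paravectors :: "'n::{finite,linorder} clifford set" where
  "paravectors = {s0 *\<^sub>R ebasis {} + (\<Sum>j\<in>UNIV. s j *\<^sub>R ebasis {j}) | s0 s. True}"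

definition imag_sphere :: "'n::{finite,linorder} clifford set" where
  "imag_sphere = {\<Sum>j\<in>UNIV. c j *\<^sub>R ebasis {j} | c. (\<Sum>j\<in>UNIV. (c j)\<^sup>2) = 1}"

definition cplane :: "'n::{finite,linorder} clifford \<Rightarrow> 'n clifford set" where
  "cplane \<II> = {u *\<^sub>R ebasis {} + v *\<^sub>R \<II> | u v. True}"

definition cplane_up :: "'n::{finite,linorder} clifford \<Rightarrow> 'n clifford set" where
  "cplane_up \<II> = {u *\<^sub>R ebasis {} + v *\<^sub>R \<II> | u v. v \<ge> 0}"

text \<open>For \<open>\<II>\<close> in the sphere, \<open>ebasis {}\<close> and \<open>\<II>\<close> are orthonormal, so this reads off \<open>v\<close> above.\<close>
definition cIm :: "'n::{finite,linorder} clifford \<Rightarrow> 'n clifford \<Rightarrow> real" where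
  "cIm \<II> z = z \<bullet> \<II>"

subsection \<open>Adjoining infinity\<close>

text \<open>
  Functions with values in \<open>cplane \<II> \<union> {\<infinity>}\<close>; \<^const>\<open>None\<close> is \<open>\<infinity>\<close>.  Sums and products with \<open>\<infinity>\<close>
  are \<open>\<infinity>\<close>; the convention is immaterial, as they are formed only for functions that are finite
  almost everywhere.
\<close>
type_synonym 'n xclifford = "'n clifford option"

definition xconj :: "'n::{finite,linorder} xclifford \<Rightarrow> 'n xclifford" where
  "xconj = map_option cconj"

definition xplus :: "'n::{finite,linorder} xclifford \<Rightarrow> 'n xclifford \<Rightarrow> 'n xclifford" where
  "xplus z w = (case (z, w) of (Some a, Some b) \<Rightarrow> Some (a + b) | _ \<Rightarrow> None)"

definition xmult :: "'n::{finite,linorder} xclifford \<Rightarrow> 'n xclifford \<Rightarrow> 'n xclifford" where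
  "xmult z w = (case (z, w) of (Some a, Some b) \<Rightarrow> Some (a \<odot> b) | _ \<Rightarrow> None)"

definition xinverse :: "'n::{finite,linorder} xclifford \<Rightarrow> 'n xclifford" where
  "xinverse z = (case z of None \<Rightarrow> Some 0
     | Some a \<Rightarrow> if a = 0 then None else Some (inverse ((norm a)\<^sup>2) *\<^sub>R cconj a))"

definition xnorm_sq :: "'n::{finite,linorder} xclifford \<Rightarrow> ennreal" where
  "xnorm_sq z = (case z of None \<Rightarrow> \<infinity> | Some a \<Rightarrow> ennreal ((norm a)\<^sup>2))"

text \<open>The value at infinity is a dummy; it is used only where infinite values do not matter.\<close>
definition finite_part :: "'n::{finite,linorder} xclifford \<Rightarrow> 'n clifford" where
  "finite_part z = (case z of None \<Rightarrow> 0 | Some a \<Rightarrow> a)"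

definition xmeasurable ::
    "'n::{finite,linorder} clifford \<Rightarrow> 'a measure \<Rightarrow> ('a \<Rightarrow> 'n xclifford) \<Rightarrow> bool" where
  "xmeasurable \<II> M f \<longleftrightarrow>
     (\<forall>\<omega>\<in>space M. f \<omega> \<in> insert None (Some ` cplane \<II>)) \<and>
     {\<omega>\<in>space M. f \<omega> = None} \<in> sets M \<and>
     (\<forall>B\<in>sets borel. {\<omega>\<in>space M. f \<omega> \<in> Some ` B} \<in> sets M)"

section \<open>Operators in a Clifford module\<close>

text \<open>
  A possibly unbounded operator \<open>T\<close> is identified with its graph \<open>{(x, T x) | x \<in> D(T)}\<close>.  Thus
  equality of operators includes equality of domains, the domain is \<^const>\<open>Domain\<close>, the inverse
  is \<^const>\<open>converse\<close>, and the closure of an operator is the topological \<^const>\<open>closure\<close>; an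
  equation between \<open>closure S\<close> and (the graph of) an operator includes that \<open>S\<close> is closable.
\<close>
type_synonym ('h, 'n) opgraph = "(('h, 'n) cmodule \<times> ('h, 'n) cmodule) set"
type_synonym ('h, 'n) bop = "('h, 'n) cmodule \<Rightarrow>\<^sub>L ('h, 'n) cmodule"

text \<open>The right linear operators whose domain is a right submodule.\<close>
definition right_linear :: "('h::real_inner, 'n::{finite,linorder}) opgraph \<Rightarrow> bool" where
  "right_linear T \<longleftrightarrow> single_valued T \<and> (0, 0) \<in> T \<and>
     (\<forall>(x, u)\<in>T. \<forall>(y, v)\<in>T. (x + y, u + v) \<in> T) \<and>
     (\<forall>(x, u)\<in>T. \<forall>a. (x \<odot> a, u \<odot> a) \<in> T)"

definition bounded_ops :: "('h::real_inner, 'n::{finite,linorder}) bop set" where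
  "bounded_ops = {A. \<forall>x a. blinfun_apply A (x \<odot> a) = blinfun_apply A x \<odot> a}"

definition gr :: "('h::real_inner, 'n::{finite,linorder}) bop \<Rightarrow> ('h, 'n) opgraph" where
  "gr A = {(x, blinfun_apply A x) | x. True}"

definition op_comp :: "('h::real_inner, 'n::{finite,linorder}) opgraph \<Rightarrow> ('h, 'n) opgraph \<Rightarrow> ('h, 'n) opgraph" where
  "op_comp S T = T O S"

definition op_plus :: "('h::real_inner, 'n::{finite,linorder}) opgraph \<Rightarrow> ('h, 'n) opgraph \<Rightarrow> ('h, 'n) opgraph" where
  "op_plus S T = {(x, u + v) | x u v. (x, u) \<in> S \<and> (x, v) \<in> T}"

definition densely_defined :: "('h::real_inner, 'n::{finite,linorder}) opgraph \<Rightarrow> bool" where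
  "densely_defined T \<longleftrightarrow> closure (Domain T) = UNIV"

definition op_adjoint :: "('h::real_inner, 'n::{finite,linorder}) opgraph \<Rightarrow> ('h, 'n) opgraph" where
  "op_adjoint T = {(y, z). \<forall>(x, w)\<in>T. cinner w y = cinner x z}"

definition self_adjoint :: "('h::real_inner, 'n::{finite,linorder}) opgraph \<Rightarrow> bool" where
  "self_adjoint T \<longleftrightarrow> densely_defined T \<and> T = op_adjoint T"

definition normal_op :: "('h::real_inner, 'n::{finite,linorder}) opgraph \<Rightarrow> bool" where
  "normal_op T \<longleftrightarrow> densely_defined T \<and> closed T \<and> Domain T = Domain (op_adjoint T) \<and>
     op_comp T (op_adjoint T) = op_comp (op_adjoint T) T"

definition positive_op :: "('h::real_inner, 'n::{finite,linorder}) opgraph \<Rightarrow> bool" where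
  "positive_op T \<longleftrightarrow> (\<forall>(x, u)\<in>T. cnonneg (cinner u x))"

definition unitary_op :: "('h::real_inner, 'n::{finite,linorder}) bop \<Rightarrow> bool" where
  "unitary_op U \<longleftrightarrow> U \<in> bounded_ops \<and>
     op_comp (op_adjoint (gr U)) (gr U) = Id \<and> op_comp (gr U) (op_adjoint (gr U)) = Id"

definition imaginary_op :: "('h::real_inner, 'n::{finite,linorder}) bop \<Rightarrow> bool" where
  "imaginary_op J \<longleftrightarrow> unitary_op J \<and> op_adjoint (gr J) = gr (- J)"

definition orth_projection :: "('h::real_inner, 'n::{finite,linorder}) bop \<Rightarrow> bool" where
  "orth_projection P \<longleftrightarrow> P \<in> bounded_ops \<and> self_adjoint (gr P) \<and> P o\<^sub>L P = P"

definition op_sqrt :: "('h::real_inner, 'n::{finite,linorder}) bop \<Rightarrow> ('h, 'n) bop" where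
  "op_sqrt A = (THE R. R \<in> bounded_ops \<and> positive_op (gr R) \<and> R o\<^sub>L R = A)"

definition bounded_transform :: "('h::real_inner, 'n::{finite,linorder}) opgraph \<Rightarrow> ('h, 'n) opgraph" where
  "bounded_transform T = op_comp T (gr (op_sqrt
     (THE C. gr C = converse (op_plus Id (op_comp (op_adjoint T) T)))))"

subsection \<open>The S-spectrum\<close>

definition Q_op :: "'n::{finite,linorder} clifford \<Rightarrow> ('h::real_inner, 'n) opgraph \<Rightarrow> ('h, 'n) opgraph" where
  "Q_op s T = {(x, w - (2 * cRe s) *\<^sub>R v + (norm s)\<^sup>2 *\<^sub>R x) | x v w. (x, v) \<in> T \<and> (v, w) \<in> T}"

definition S_resolvent_set :: "('h::real_inner, 'n::{finite,linorder}) opgraph \<Rightarrow> 'n clifford set" where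
  "S_resolvent_set T = {s \<in> paravectors.
     (\<forall>x. (x, 0) \<in> Q_op s T \<longrightarrow> x = 0) \<and>
     closure (Range (Q_op s T)) = UNIV \<and>
     (\<exists>C. \<forall>(x, y)\<in>Q_op s T. norm x \<le> C * norm y)}"

definition S_spectrum :: "('h::real_inner, 'n::{finite,linorder}) opgraph \<Rightarrow> 'n clifford set" where
  "S_spectrum T = paravectors - S_resolvent_set T"

section \<open>Spectral measures and spectral integrals\<close>

text \<open>The measure \<open>M\<close> only serves to carry the underlying \<open>\<sigma>\<close>-algebra.\<close>
definition spectral_measure ::
    "'a measure \<Rightarrow> ('a set \<Rightarrow> ('h::real_inner, 'n::{finite,linorder}) bop) \<Rightarrow> bool" where
  "spectral_measure M E \<longleftrightarrow>
     (\<forall>A\<in>sets M. orth_projection (E A)) \<and>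
     (\<forall>A. range A \<subseteq> sets M \<longrightarrow> disjoint_family A \<longrightarrow>
        (\<forall>x. (\<lambda>i::nat. blinfun_apply (E (A i)) x) sums blinfun_apply (E (\<Union>i. A i)) x)) \<and>
     E (space M) = id_blinfun"

definition associated ::
    "('h::real_inner, 'n::{finite,linorder}) bop \<Rightarrow> 'a measure \<Rightarrow> ('a set \<Rightarrow> ('h, 'n) bop) \<Rightarrow> bool" where
  "associated J M E \<longleftrightarrow> (\<forall>A\<in>sets M. J o\<^sub>L E A = E A o\<^sub>L J)"

definition E_ae ::
    "'a measure \<Rightarrow> ('a set \<Rightarrow> ('h::real_inner, 'n::{finite,linorder}) bop) \<Rightarrow> ('a \<Rightarrow> bool) \<Rightarrow> bool" where
  "E_ae M E P \<longleftrightarrow> (\<exists>N\<in>sets M. E N = 0 \<and> {\<omega>\<in>space M. \<not> P \<omega>} \<subseteq> N)"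

definition simple_spectral_integral ::
    "'n::{finite,linorder} clifford \<Rightarrow> ('h::real_inner, 'n) bop \<Rightarrow> 'a measure \<Rightarrow>
     ('a set \<Rightarrow> ('h, 'n) bop) \<Rightarrow> ('a \<Rightarrow> 'n clifford) \<Rightarrow> ('h, 'n) bop" where
  "simple_spectral_integral \<II> J M E s = (\<Sum>c\<in>s ` space M.
     cRe c *\<^sub>R E (s -` {c} \<inter> space M) + cIm \<II> c *\<^sub>R (E (s -` {c} \<inter> space M) o\<^sub>L J))"

text \<open>The limit is with respect to the operator norm, which is the norm of \<^typ>\<open>('h, 'n) bop\<close>.\<close>
definition bounded_spectral_integral ::
    "'n::{finite,linorder} clifford \<Rightarrow> ('h::real_inner, 'n) bop \<Rightarrow> 'a measure \<Rightarrow>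
     ('a set \<Rightarrow> ('h, 'n) bop) \<Rightarrow> ('a \<Rightarrow> 'n clifford) \<Rightarrow> ('h, 'n) bop" where
  "bounded_spectral_integral \<II> J M E f = (THE A. \<forall>s::nat \<Rightarrow> 'a \<Rightarrow> 'n clifford.
     (\<forall>j. simple_function M (s j) \<and> s j ` space M \<subseteq> cplane \<II>) \<longrightarrow>
     uniform_limit (space M) s f sequentially \<longrightarrow>
     (\<lambda>j. simple_spectral_integral \<II> J M E (s j)) \<longlonglongrightarrow> A)"

definition scalar_measure ::
    "'a measure \<Rightarrow> ('a set \<Rightarrow> ('h::real_inner, 'n::{finite,linorder}) bop) \<Rightarrow> ('h, 'n) cmodule \<Rightarrow> 'a measure" where
  "scalar_measure M E x = measure_of (space M) (sets M)
     (\<lambda>A. ennreal (cRe (cinner (blinfun_apply (E A) x) x)))"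

definition bounding_sequence ::
    "'a measure \<Rightarrow> ('a set \<Rightarrow> ('h::real_inner, 'n::{finite,linorder}) bop) \<Rightarrow>
     ('a \<Rightarrow> 'n xclifford) \<Rightarrow> (nat \<Rightarrow> 'a set) \<Rightarrow> bool" where
  "bounding_sequence M E f A \<longleftrightarrow> range A \<subseteq> sets M \<and> incseq A \<and>
     (\<forall>j. \<exists>K. \<forall>\<omega>\<in>A j. \<exists>z. f \<omega> = Some z \<and> norm z \<le> K) \<and> E (\<Union>j. A j) = id_blinfun"

text \<open>\<open>\<I>(f) = \<integral> Re f dE + \<integral> Im f dE J\<close>, for \<open>f\<close> that are finite almost everywhere.\<close>
definition spectral_integral ::
    "'n::{finite,linorder} clifford \<Rightarrow> ('h::real_inner, 'n) bop \<Rightarrow> 'a measure \<Rightarrow>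
     ('a set \<Rightarrow> ('h, 'n) bop) \<Rightarrow> ('a \<Rightarrow> 'n xclifford) \<Rightarrow> ('h, 'n) opgraph" where
  "spectral_integral \<II> J M E f = {(x, y).
     (\<integral>\<^sup>+ \<omega>. xnorm_sq (f \<omega>) \<partial>scalar_measure M E x) < \<infinity> \<and>
     (\<forall>A. bounding_sequence M E f A \<longrightarrow>
       (\<lambda>j. blinfun_apply (bounded_spectral_integral \<II> J M E
              (\<lambda>\<omega>. if \<omega> \<in> A j then finite_part (f \<omega>) else 0)) x) \<longlonglongrightarrow> y)}"

text \<open>The Borel \<open>\<sigma>\<close>-algebra of \<open>\<sigma>\<^sub>S(T) \<inter> \<complex>\<^sub>\<II>\<^sup>+\<close>.\<close>
definition spectrum_space ::
    "'n::{finite,linorder} clifford \<Rightarrow> ('h::real_inner, 'n) opgraph \<Rightarrow> 'n clifford measure" where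
  "spectrum_space \<II> T = restrict_space borel (S_spectrum T \<inter> cplane_up \<II>)"

text \<open>\<open>E\<close> is the spectral measure of \<open>T\<close>, where \<open>T = \<integral> Re \<lambda> dE + \<integral> Im \<lambda> dE J\<close>.\<close>
definition is_spectral_measure_of ::
    "'n::{finite,linorder} clifford \<Rightarrow> ('h::real_inner, 'n) bop \<Rightarrow> ('h, 'n) opgraph \<Rightarrow>
     ('n clifford set \<Rightarrow> ('h, 'n) bop) \<Rightarrow> bool" where
  "is_spectral_measure_of \<II> J T E \<longleftrightarrow>
     spectral_measure (spectrum_space \<II> T) E \<and>
     associated J (spectrum_space \<II> T) E \<and>
     T = spectral_integral \<II> J (spectrum_space \<II> T) E Some"

section \<open>Integrals with respect to Clifford valued measures\<close>

text \<open>
  \<open>\<nu>\<close> is a finite signed measure on the \<open>\<sigma>\<close>-algebra of \<open>M\<close>; integrals with respect to \<open>\<nu>\<close> are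
  formed by means of its Jordan decomposition.  Note that \<^const>\<open>ennreal\<close> maps negative numbers to
  \<open>0\<close>.
\<close>
definition positive_variation :: "'a measure \<Rightarrow> ('a set \<Rightarrow> real) \<Rightarrow> 'a measure" where
  "positive_variation M \<nu> = measure_of (space M) (sets M)
     (\<lambda>A. SUP B\<in>{B \<in> sets M. B \<subseteq> A}. ennreal (\<nu> B))"

definition signed_integrable :: "'a measure \<Rightarrow> ('a set \<Rightarrow> real) \<Rightarrow> ('a \<Rightarrow> real) \<Rightarrow> bool" where
  "signed_integrable M \<nu> h \<longleftrightarrow>
     integrable (positive_variation M \<nu>) h \<and> integrable (positive_variation M (\<lambda>A. - \<nu> A)) h"

definition signed_integral :: "'a measure \<Rightarrow> ('a set \<Rightarrow> real) \<Rightarrow> ('a \<Rightarrow> real) \<Rightarrow> real" where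
  "signed_integral M \<nu> h =
     (\<integral>\<omega>. h \<omega> \<partial>positive_variation M \<nu>) - (\<integral>\<omega>. h \<omega> \<partial>positive_variation M (\<lambda>A. - \<nu> A))"

definition real_cintegral ::
    "'a measure \<Rightarrow> ('a set \<Rightarrow> 'n::{finite,linorder} clifford) \<Rightarrow> ('a \<Rightarrow> real) \<Rightarrow> 'n clifford" where
  "real_cintegral M \<mu> h = (\<chi> \<alpha>. signed_integral M (\<lambda>A. \<mu> A $ \<alpha>) h)"

definition cintegrable ::
    "'n::{finite,linorder} clifford \<Rightarrow> 'a measure \<Rightarrow> ('a set \<Rightarrow> 'n clifford) \<Rightarrow> ('a \<Rightarrow> 'n xclifford) \<Rightarrow> bool" where
  "cintegrable \<II> M \<mu> f \<longleftrightarrow> (\<forall>\<alpha>.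
     signed_integrable M (\<lambda>A. \<mu> A $ \<alpha>) (\<lambda>\<omega>. cRe (finite_part (f \<omega>))) \<and>
     signed_integrable M (\<lambda>A. \<mu> A $ \<alpha>) (\<lambda>\<omega>. cIm \<II> (finite_part (f \<omega>))))"

text \<open>\<open>\<integral> d\<mu> f\<close>\<close>
definition cintegral ::
    "'n::{finite,linorder} clifford \<Rightarrow> 'a measure \<Rightarrow> ('a set \<Rightarrow> 'n clifford) \<Rightarrow> ('a \<Rightarrow> 'n xclifford) \<Rightarrow> 'n clifford" where
  "cintegral \<II> M \<mu> f = real_cintegral M \<mu> (\<lambda>\<omega>. cRe (finite_part (f \<omega>)))
     + real_cintegral M \<mu> (\<lambda>\<omega>. cIm \<II> (finite_part (f \<omega>))) \<odot> \<II>"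

text \<open>
  The projections onto \<open>{x. J x = x \<odot> \<II>}\<close> and \<open>{x. J x = - (x \<odot> \<II>)}\<close> along each other.
\<close>
definition Pi_plus ::
    "('h::real_inner, 'n::{finite,linorder}) bop \<Rightarrow> 'n clifford \<Rightarrow> ('h, 'n) cmodule \<Rightarrow> ('h, 'n) cmodule" where
  "Pi_plus J \<II> x = (1/2) *\<^sub>R (x - blinfun_apply J x \<odot> \<II>)"

definition Pi_minus ::
    "('h::real_inner, 'n::{finite,linorder}) bop \<Rightarrow> 'n clifford \<Rightarrow> ('h, 'n) cmodule \<Rightarrow> ('h, 'n) cmodule" where
  "Pi_minus J \<II> x = (1/2) *\<^sub>R (x + blinfun_apply J x \<odot> \<II>)"

end

theory Submission
  imports Defs
begin

text \<open>
  Since \<open>J\<close> commutes with \<open>E\<close> and \<open>J\<^sup>2 = -1\<close>, the Clifford module is a complex Hilbert space in which \<open>J\<close> acts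
  as the imaginary unit, and \<open>\<I>(f)\<close> is the usual functional calculus of a complex spectral measure.
  The bounded calculus is a \<open>*\<close>-homomorphism.  If \<open>f\<close> is bounded on each set of an exhausting sequence
  \<open>A\<^sub>j\<close>, then \<open>(x, y)\<close> lies in the graph of \<open>\<I>(f)\<close> if and only if \<open>E(A\<^sub>j) y = \<I>(f \<chi>\<^sub>A\<^sub>j) x\<close> for all
  \<open>j\<close>; this reduces (i)-(v) and (viii) to the bounded calculus.  In (vi) the Hahn decomposition turns
  every signed measure \<open>\<langle>E(\<cdot>)x, y\<rangle>\<close> into a difference of two positive measures of the same form.
  Positivity in (vii) needs that a Clifford number \<open>\<langle>v, v\<rangle>\<close> has a square root.  For (ix), the spectral
  projection of a disc with real centre \<open>a\<close> is determined by the growth of \<open>(T - a)\<^sup>k x\<close>, and the discs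
  about \<open>0\<close> and \<open>1\<close> generate the Borel sets of the half plane.
\<close>

section \<open>The Clifford algebra\<close>

text \<open>The adjoint, positivity and (vi) speak of the Clifford valued inner product, while
  estimates and limits belong to a real Hilbert space. Right linearity is the bridge: an identity of
  real inner products that holds for all right multiples of a vector is an identity of Clifford
  valued ones. So nearly all of the work is done with \<open>\<bullet>\<close>.

  In (ix) the obstacle is that \<open>f\<close> may leave the upper half plane, on which every
  spectral measure of an operator has to live. Where \<open>f\<close> lies below the real axis,
  \<open>J\<close> has the wrong sign. If a spectral measure with the same \<open>J\<close> exists,
  the sign of \<open>u \<bullet> J x\<close> on the graph forces \<open>f\<close> into the half
  plane almost everywhere. If \<open>f\<close> lies there, a spectral measure is built by pushing
  \<open>E\<close> forward, and the formula is proved against every imaginary operator. This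
  explains the real centres of the discs: subtracting a real number from an operator involves no
  \<open>J\<close>. The price is that distances to real points do not separate a number from its
  conjugate, which is harmless only within one half plane.\<close>

lemma cRe_linear [simp]: "cRe 0 = 0" "cRe (a + b) = cRe a + cRe b" "cRe (a - b) = cRe a - cRe b"
  "cRe (- a) = - cRe a" "cRe (r *\<^sub>R a) = r * cRe a" "cRe (ebasis {}) = 1"
  by (simp_all add: cRe_def ebasis_def)

lemma cRe_eq_inner: "cRe a = a \<bullet> ebasis {}"
  by (simp add: cRe_def ebasis_def inner_axis)

lemma cconj_cconj [simp]: "cconj (cconj a) = a"
  by (simp add: cconj_def vec_eq_iff flip: mult.assoc power_mult_distrib)

lemma linear_cconj: "linear cconj"
  by (rule linearI) (simp_all add: cconj_linear)

lemma cconj_simps [simp]: "cconj 0 = 0" "cconj (a - b) = cconj a - cconj b" "cconj (- a) = - cconj a"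
  by (simp_all add: linear_0[OF linear_cconj] linear_diff[OF linear_cconj] linear_neg[OF linear_cconj])

lemma cRe_cconj [simp]: "cRe (cconj a) = cRe a"
  by (simp add: cRe_def cconj_def)

lemma norm_cconj [simp]: "norm (cconj a) = norm a"
  by (simp add: norm_vec_def cconj_def abs_mult)

lemma cmult_minus_left [simp]: "(- x) \<odot> a = - (x \<odot> a)"
  using cmult_scaleR_left[of "-1" x a] by simp

lemma cmult_minus_right [simp]: "x \<odot> (- a) = - (x \<odot> a)"
  using cmult_scaleR_right[of x "-1" a] by simp

lemma cmult_diff_left: "(x - y) \<odot> a = x \<odot> a - y \<odot> a"
  using cmult_add_left[of x "- y" a] by simp

lemma cmult_diff_right: "x \<odot> (a - b) = x \<odot> a - x \<odot> b"
  using cmult_add_right[of x a "- b"] by simp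

text \<open>The algebra is itself a Clifford module, over the real line, so facts about
  \<open>cinner\<close> such as \<open>cRe_cinner\<close> become facts about products.\<close>

lemma cinner_clifford: "cinner (x :: 'n::{finite,linorder} clifford) y = cconj y \<odot> x"
proof -
  have e: "a = (\<Sum>\<alpha>\<in>UNIV. (a $ \<alpha>) *\<^sub>R ebasis \<alpha>)" for a :: "'n clifford"
    by (subst cmodule_expand) (simp add: ebasis_def flip: axis_scaleR)
  have "cconj y \<odot> x = cconj (\<Sum>\<beta>\<in>UNIV. (y $ \<beta>) *\<^sub>R ebasis \<beta>) \<odot> (\<Sum>\<alpha>\<in>UNIV. (x $ \<alpha>) *\<^sub>R ebasis \<alpha>)"
    by (simp flip: e)
  also have "\<dots> = cinner x y"
    by (simp add: cinner_def cconj_sum cconj_linear cmult_sum_left cmult_sum_right cmult_scaleR_left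
        cmult_scaleR_right scaleR_sum_right)
  finally show ?thesis ..
qed

lemma cRe_cmult: "cRe (a \<odot> b) = cconj a \<bullet> b"
  using cRe_cinner[of b "cconj a"] by (simp add: cinner_clifford inner_commute)

lemma cRe_cmult_cconj: "cRe (a \<odot> cconj a) = (norm a)\<^sup>2"
  by (simp add: cRe_cmult dot_square_norm)

section \<open>The Clifford valued inner product\<close>

lemma cinner_add_left: "cinner (x + x') y = cinner x y + cinner x' y"
  by (simp add: cinner_def inner_add_left scaleR_left_distrib sum.distrib)

lemma cconj_cinner: "cconj (cinner x y) = cinner y x"
  unfolding cinner_def
  by (subst sum.swap)
    (simp add: cconj_sum cconj_linear cconj_cmult inner_commute)

lemma cinner_cmult_right: "cinner x (y \<odot> b) = cconj b \<odot> cinner x y"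
  by (metis cconj_cconj cconj_cinner cconj_cmult cinner_cmult_left)

text \<open>The numbers \<open>cRe (c \<odot> a)\<close>, for all \<open>a\<close>, are the real
  inner products of \<open>cconj c\<close> with all of the algebra and hence determine
  \<open>c\<close>. This lets real Hilbert space arguments produce Clifford valued adjoints.\<close>

lemma cinner_eqI:
  assumes "\<And>a. (w \<odot> a) \<bullet> y = (x \<odot> a) \<bullet> z"
  shows "cinner w y = cinner x z"
proof -
  define c where "c = cinner w y - cinner x z"
  have "cRe (c \<odot> a) = 0" for a
    unfolding c_def using assms[of a]
    by (simp add: cmult_diff_left cRe_cinner flip: cinner_cmult_left)
  then have "cconj c \<bullet> cconj c = 0"
    unfolding cRe_cmult by blast
  then have "cconj c = 0" by simp
  then have "c = 0" by (metis cconj_cconj cconj_simps(1))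
  then show ?thesis by (simp add: c_def)
qed

text \<open>Each component is a real inner product with a shifted second vector, so a Clifford
  valued measure splits into signed measures of one and the same form.\<close>

lemma cinner_component: "cinner x y $ \<alpha> = x \<bullet> (y \<odot> ebasis \<alpha>)"
proof -
  have "cinner x y $ \<alpha> = ebasis \<alpha> \<bullet> cinner x y"
    by (simp add: ebasis_def inner_axis inner_commute)
  also have "\<dots> = cRe (cconj (ebasis \<alpha>) \<odot> cinner x y)"
    by (simp add: cRe_cmult)
  finally show ?thesis by (simp add: cRe_cinner flip: cinner_cmult_right)
qed

lemma tendsto_cinner:
  assumes "(f \<longlongrightarrow> x) F" "(g \<longlongrightarrow> y) F"
  shows "((\<lambda>t. cinner (f t) (g t)) \<longlongrightarrow> cinner x y) F"
  unfolding cinner_def using assms by (intro tendsto_intros)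

lemma tendsto_cmult [tendsto_intros]:
  fixes x :: "('h::real_normed_vector, 'n::{finite,linorder}) cmodule"
  assumes "(f \<longlongrightarrow> x) F" "(g \<longlongrightarrow> a) F"
  shows "((\<lambda>t. f t \<odot> g t) \<longlongrightarrow> x \<odot> a) F"
proof (rule vec_tendstoI)
  have *: "axis k v $ i = (if i = k then 1 else 0) *\<^sub>R v" for k i and v :: 'h
    by (simp add: axis_def)
  show "((\<lambda>t. (f t \<odot> g t) $ i) \<longlongrightarrow> (x \<odot> a) $ i) F" for i
    unfolding cmult_def sum_component *
    by (intro tendsto_sum tendsto_scaleR tendsto_mult tendsto_const tendsto_vec_nth assms)
qed

lemma tendsto_cconj [tendsto_intros]:
  assumes "(f \<longlongrightarrow> a) F"
  shows "((\<lambda>t. cconj (f t)) \<longlongrightarrow> cconj a) F"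
  unfolding cconj_def using assms by (intro vec_tendstoI) (simp, intro tendsto_intros)

lemma continuous_on_cmult [continuous_intros]:
  fixes f :: "_ \<Rightarrow> ('h::real_normed_vector, 'n::{finite,linorder}) cmodule"
  assumes "continuous_on S f" "continuous_on S g"
  shows "continuous_on S (\<lambda>t. f t \<odot> g t)"
  using assms unfolding continuous_on_def by (auto intro: tendsto_cmult)

lemma continuous_on_cconj [continuous_intros]:
  assumes "continuous_on S f"
  shows "continuous_on S (\<lambda>t. cconj (f t))"
  using assms unfolding continuous_on_def by (auto intro: tendsto_cconj)

lemma continuous_on_cRe [continuous_intros]:
  assumes "continuous_on S f"
  shows "continuous_on S (\<lambda>t. cRe (f t))"
  unfolding cRe_eq_inner using assms by (intro continuous_intros)

text \<open>The real part of \<open>b \<odot> cconj b\<close> is the squared norm of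
  \<open>b\<close>. Square roots of a convergent sequence are therefore bounded, and compactness in
  finite dimension gives a limit root.\<close>

lemma cnonneg_limit:
  assumes "\<And>k::nat. cnonneg (a k)" "a \<longlonglongrightarrow> l"
  shows "cnonneg l"
proof -
  obtain b where b: "\<And>k. a k = b k \<odot> cconj (b k)"
    using assms(1) unfolding cnonneg_def by metis
  have "Bseq a" using assms(2) by (simp add: convergent_imp_Bseq convergentI)
  then obtain C where C: "C > 0" "\<And>k. norm (a k) \<le> C" by (auto elim: BseqE)
  have "(norm (b k))\<^sup>2 \<le> C" for k
  proof -
    have "(norm (b k))\<^sup>2 = cRe (a k)" by (simp add: b cRe_cmult_cconj)
    also have "\<dots> \<le> norm (a k)"
      unfolding cRe_def using component_le_norm_cart[of "a k" "{}"] by simp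
    finally show ?thesis using C(2)[of k] by simp
  qed
  then have "norm (b k) \<le> sqrt C" for k using real_le_rsqrt by blast
  then have "bounded (range b)" unfolding bounded_iff by blast
  then obtain c r where r: "strict_mono (r :: nat \<Rightarrow> nat)" "(b \<circ> r) \<longlonglongrightarrow> c"
    using bounded_imp_convergent_subsequence by blast
  have "(\<lambda>k. b (r k) \<odot> cconj (b (r k))) \<longlonglongrightarrow> c \<odot> cconj c"
    using r(2) unfolding comp_def by (intro tendsto_intros)
  moreover have "(\<lambda>k. b (r k) \<odot> cconj (b (r k))) \<longlonglongrightarrow> l"
    using LIMSEQ_subseq_LIMSEQ[OF assms(2) r(1)] by (simp add: comp_def b)
  ultimately have "l = c \<odot> cconj c" by (rule LIMSEQ_unique[symmetric])
  then show ?thesis unfolding cnonneg_def by blast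
qed

text \<open>
  For small \<open>\<delta> > 0\<close> left multiplication by \<open>1 - \<delta>a\<close> has norm less than \<open>1\<close>, so the map
  \<open>s \<mapsto> (1 - \<delta>a + s\<^sup>2)/2\<close> is a contraction; its fixed point satisfies \<open>(1 - s)\<^sup>2 = \<delta>a\<close>.
\<close>
lemma cnonneg_of_positive_definite:
  fixes a :: "'n::{finite,linorder} clifford"
  assumes a: "cconj a = a" and \<epsilon>: "\<epsilon> > 0" "\<And>x. \<epsilon> * (norm x)\<^sup>2 \<le> x \<bullet> (a \<odot> x)"
  shows "cnonneg a"
proof -
  have "bounded_linear ((\<odot>) a)"
    by (rule linear_conv_bounded_linear[THEN iffD1], rule linearI)
      (simp_all add: cmult_add_right cmult_scaleR_right)
  then obtain La where La: "\<And>x. blinfun_apply La x = a \<odot> x"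
    by (metis bounded_linear_Blinfun_apply)
  define K where "K = norm La"
  \<comment> \<open>With this choice \<open>\<delta> * K\<^sup>2 \<le> \<epsilon>\<close>, so in the
    expansion of \<open>(norm (x - \<delta> *\<^sub>R (a \<odot> x)))\<^sup>2\<close> the quadratic
    term costs at most half of the gain from the linear term. What remains is the factor
    \<open>1 - \<delta> * \<epsilon>\<close>, nonnegative because
    \<open>\<delta> * \<epsilon> \<le> 1\<close>; \<open>q\<close> is its root.\<close>
  define \<delta> where "\<delta> = \<epsilon> / (K\<^sup>2 + \<epsilon>\<^sup>2 + 1)"
  have pos: "K\<^sup>2 + \<epsilon>\<^sup>2 + 1 > 0" by (smt (verit) zero_le_power2)
  have \<delta>: "\<delta> > 0" using \<epsilon>(1) pos by (simp add: \<delta>_def)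
  have \<delta>1: "\<delta> * K\<^sup>2 \<le> \<epsilon>" "\<delta> * \<epsilon> \<le> 1"
    using pos \<epsilon>(1) by (simp_all add: \<delta>_def field_simps power2_eq_square add_increasing2)
  define q where "q = sqrt (1 - \<delta> * \<epsilon>)"
  have q: "0 \<le> q" "q < 1" using \<delta> \<delta>1 \<epsilon>(1) by (auto simp: q_def)
  define t where "t = id_blinfun - \<delta> *\<^sub>R La"
  have t: "blinfun_apply t x = x - \<delta> *\<^sub>R (a \<odot> x)" for x
    by (simp add: t_def blinfun.bilinear_simps La)
  have "norm t \<le> q"
  proof (rule norm_blinfun_bound)
    fix x
    have "(norm (blinfun_apply t x))\<^sup>2 = (norm x)\<^sup>2 - 2 * \<delta> * (x \<bullet> (a \<odot> x)) + \<delta>\<^sup>2 * (norm (a \<odot> x))\<^sup>2"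
      unfolding t power2_norm_eq_inner
      by (simp add: inner_diff_left inner_diff_right inner_commute algebra_simps power2_eq_square)
    also have "\<dots> \<le> (norm x)\<^sup>2 - 2 * \<delta> * (\<epsilon> * (norm x)\<^sup>2) + \<delta> * (\<epsilon> * (norm x)\<^sup>2)"
    proof -
      have "norm (a \<odot> x) \<le> K * norm x" unfolding K_def La[symmetric] by (rule norm_blinfun)
      then have "(norm (a \<odot> x))\<^sup>2 \<le> K\<^sup>2 * (norm x)\<^sup>2"
        by (metis norm_ge_zero power_mono power_mult_distrib)
      then have "\<delta> * (norm (a \<odot> x))\<^sup>2 \<le> \<delta> * (K\<^sup>2 * (norm x)\<^sup>2)"
        using \<delta> by (intro mult_left_mono) auto
      also have "\<dots> \<le> \<epsilon> * (norm x)\<^sup>2"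
        unfolding mult.assoc[symmetric] by (intro mult_right_mono \<delta>1) simp
      finally have "\<delta> * (\<delta> * (norm (a \<odot> x))\<^sup>2) \<le> \<delta> * (\<epsilon> * (norm x)\<^sup>2)"
        using \<delta> by (intro mult_left_mono) auto
      moreover have "2 * \<delta> * (\<epsilon> * (norm x)\<^sup>2) \<le> 2 * \<delta> * (x \<bullet> (a \<odot> x))"
        using \<delta> \<epsilon>(2) by (intro mult_left_mono) auto
      ultimately show ?thesis by (simp add: power2_eq_square mult.assoc)
    qed
    also have "\<dots> = (q * norm x)\<^sup>2"
      using \<delta>1 by (simp add: q_def power_mult_distrib algebra_simps)
    finally show "norm (blinfun_apply t x) \<le> q * norm x"
      using q by (simp add: power2_le_iff_abs_le)
  qed (rule q)
  \<comment> \<open>The iteration runs among operators because the operator norm is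
    submultiplicative, which the Euclidean norm of the algebra need not be. The first two conditions
    single out left multiplications by self-conjugate elements.\<close>
  define S where "S = {L :: 'n clifford \<Rightarrow>\<^sub>L 'n clifford.
    (\<forall>x. blinfun_apply L x = blinfun_apply L (ebasis {}) \<odot> x) \<and>
    cconj (blinfun_apply L (ebasis {})) = blinfun_apply L (ebasis {}) \<and> norm L \<le> q}"
  define \<phi> where "\<phi> L = (1/2) *\<^sub>R (t + (L o\<^sub>L L))" for L
  have "closed S"
    unfolding S_def
    by (intro closed_Collect_conj closed_Collect_all closed_Collect_eq closed_Collect_le
        continuous_intros)
  then have "complete S" by (simp add: complete_eq_closed)
  moreover have "0 \<in> S" unfolding S_def using q by simp
  then have "S \<noteq> {}" by auto
  moreover have "\<phi> ` S \<subseteq> S"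
  proof safe
    fix L assume L: "L \<in> S"
    let ?s = "blinfun_apply L (ebasis {})"
    have 1: "blinfun_apply L x = ?s \<odot> x" for x using L unfolding S_def by blast
    have s: "cconj ?s = ?s" and nL: "norm L \<le> q" using L unfolding S_def by blast+
    have 2: "blinfun_apply (\<phi> L) x = (1/2) *\<^sub>R (x - \<delta> *\<^sub>R (a \<odot> x) + ?s \<odot> (?s \<odot> x))" for x
      unfolding \<phi>_def
      by (simp add: blinfun.bilinear_simps t 1[of x] 1[of "?s \<odot> x"])
    have "norm (\<phi> L) \<le> (1/2) * (norm t + norm L * norm L)"
      unfolding \<phi>_def
      using norm_triangle_ineq[of t "L o\<^sub>L L"] norm_blinfun_compose[of L L] by simp
    also have "\<dots> \<le> (1/2) * (q + q * 1)"
      using \<open>norm t \<le> q\<close> nL q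
      by (intro mult_left_mono add_mono mult_mono) auto
    finally have "norm (\<phi> L) \<le> q" by simp
    then show "\<phi> L \<in> S"
      unfolding S_def
      by (simp add: 2 cconj_linear cconj_cmult s a cmult_scaleR_left cmult_add_left cmult_diff_left
          cmult_assoc cconj_generators)
  qed
  moreover have "\<forall>L\<in>S. \<forall>L'\<in>S. dist (\<phi> L) (\<phi> L') \<le> q * dist L L'"
  proof safe
    fix L L' assume "L \<in> S" "L' \<in> S"
    then have n: "norm L \<le> q" "norm L' \<le> q" unfolding S_def by blast+
    have "\<phi> L - \<phi> L' = (1/2) *\<^sub>R ((L o\<^sub>L (L - L')) + ((L - L') o\<^sub>L L'))"
      unfolding \<phi>_def by (intro blinfun_eqI) (simp add: blinfun.bilinear_simps algebra_simps)
    then have "norm (\<phi> L - \<phi> L') \<le> (1/2) * (norm L * norm (L - L') + norm (L - L') * norm L')"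
      using norm_triangle_ineq[of "L o\<^sub>L (L - L')" "(L - L') o\<^sub>L L'"]
        norm_blinfun_compose[of L "L - L'"] norm_blinfun_compose[of "L - L'" L'] by simp
    also have "\<dots> \<le> (1/2) * (q * norm (L - L') + norm (L - L') * q)"
      using n q by (intro mult_left_mono add_mono mult_mono) auto
    finally show "dist (\<phi> L) (\<phi> L') \<le> q * dist L L'" by (simp add: dist_norm)
  qed
  ultimately have "\<exists>!L. L \<in> S \<and> \<phi> L = L"
    using q by (intro Banach_fix) auto
  then obtain L where L: "L \<in> S" "\<phi> L = L" by blast
  define s where "s = blinfun_apply L (ebasis {})"
  have s: "blinfun_apply L x = s \<odot> x" "cconj s = s" for x
    using L(1) unfolding S_def s_def by blast+
  have "s = (1/2) *\<^sub>R (ebasis {} - \<delta> *\<^sub>R a + s \<odot> s)"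
  proof -
    have "s = blinfun_apply (\<phi> L) (ebasis {})" unfolding L(2) s_def ..
    then show ?thesis unfolding \<phi>_def by (simp add: blinfun.bilinear_simps t s(1))
  qed
  then have "2 *\<^sub>R s = 2 *\<^sub>R (1/2) *\<^sub>R (ebasis {} - \<delta> *\<^sub>R a + s \<odot> s)"
    by (rule arg_cong)
  moreover have "2 *\<^sub>R (1/2) *\<^sub>R y = y" for y :: "'n clifford" by simp
  ultimately have "2 *\<^sub>R s = ebasis {} - \<delta> *\<^sub>R a + s \<odot> s" by (rule trans)
  then have "\<delta> *\<^sub>R a = (ebasis {} - s) \<odot> (ebasis {} - s)"
    by (simp add: cmult_diff_left cmult_diff_right scaleR_2 algebra_simps)
  moreover have "a = (1 / sqrt \<delta>) *\<^sub>R (1 / sqrt \<delta>) *\<^sub>R (\<delta> *\<^sub>R a)"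
    using \<delta> by simp
  \<comment> \<open>As \<open>s\<close> is self-conjugate, so is \<open>ebasis {} - s\<close>, and
    its square is a product with its own conjugate.\<close>
  ultimately have "a = ((1 / sqrt \<delta>) *\<^sub>R (ebasis {} - s)) \<odot> cconj ((1 / sqrt \<delta>) *\<^sub>R (ebasis {} - s))"
    by (simp add: cconj_linear cconj_generators s cmult_scaleR_left cmult_scaleR_right)
  then show ?thesis unfolding cnonneg_def by blast
qed

text \<open>Left multiplication by \<open>cinner v v\<close> has the quadratic form
  \<open>(norm (v \<odot> x))\<^sup>2\<close>, which is only semidefinite. Adding a small multiple
  of the unit makes it definite, and \<open>cnonneg_limit\<close> removes the perturbation.\<close>

lemma cnonneg_cinner_self: "cnonneg (cinner v v)"
proof (rule cnonneg_limit)
  show "(\<lambda>k. cinner v v + inverse (real (Suc k)) *\<^sub>R ebasis {}) \<longlonglongrightarrow> cinner v v"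
    using tendsto_add[OF tendsto_const[of "cinner v v"]
        tendsto_scaleR[OF LIMSEQ_inverse_real_of_nat tendsto_const[of "ebasis {}"]]] by simp
  show "cnonneg (cinner v v + inverse (real (Suc k)) *\<^sub>R ebasis {})" for k
  proof (rule cnonneg_of_positive_definite)
    fix x
    have "x \<bullet> (cinner v v \<odot> x) = cRe (cconj x \<odot> (cinner v v \<odot> x))"
      by (simp add: cRe_cmult)
    also have "\<dots> = cRe (cinner (v \<odot> x) (v \<odot> x))"
      by (simp add: cinner_cmult_left cinner_cmult_right)
    also have "\<dots> \<ge> 0" by (simp add: cRe_cinner)
    finally show "inverse (real (Suc k)) * (norm x)\<^sup>2
        \<le> x \<bullet> ((cinner v v + inverse (real (Suc k)) *\<^sub>R ebasis {}) \<odot> x)"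
      by (simp add: cmult_add_left cmult_scaleR_left inner_add_right power2_norm_eq_inner)
  qed (simp_all add: cconj_linear cconj_cinner cconj_generators)
qed

section \<open>The complex plane of an imaginary unit\<close>

lemma cconj_sphere: "\<II> \<in> imag_sphere \<Longrightarrow> cconj \<II> = - \<II>"
  unfolding imag_sphere_def
  by (auto simp: cconj_sum cconj_linear cconj_generators sum_negf)

text \<open>Adding the double sum to its transpose cancels all products of distinct generators, so
  only the diagonal survives.\<close>

lemma sphere_square:
  assumes "\<II> \<in> imag_sphere"
  shows "\<II> \<odot> \<II> = - ebasis {}"
proof -
  obtain c where c: "\<II> = (\<Sum>j\<in>UNIV. c j *\<^sub>R ebasis {j})" "(\<Sum>j\<in>UNIV. (c j)\<^sup>2) = 1"
    using assms unfolding imag_sphere_def by blast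
  have 1: "\<II> \<odot> \<II> = (\<Sum>i\<in>UNIV. \<Sum>j\<in>UNIV. (c i * c j) *\<^sub>R (ebasis {i} \<odot> ebasis {j}))"
    unfolding c by (subst sum.swap)
      (simp add: cmult_sum_left cmult_sum_right cmult_scaleR_left cmult_scaleR_right scaleR_sum_right
        mult.commute)
  have 2: "\<II> \<odot> \<II> = (\<Sum>i\<in>UNIV. \<Sum>j\<in>UNIV. (c i * c j) *\<^sub>R (ebasis {j} \<odot> ebasis {i}))"
    unfolding 1 by (subst sum.swap) (simp add: mult.commute)
  have "\<II> \<odot> \<II> + \<II> \<odot> \<II> = (\<Sum>i\<in>UNIV. \<Sum>j\<in>UNIV. (c i * c j) *\<^sub>R
      (ebasis {i} \<odot> ebasis {j} + ebasis {j} \<odot> ebasis {i}))"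
    by (subst 1, subst 2) (simp add: sum.distrib scaleR_add_right)
  also have "\<dots> = (\<Sum>i\<in>UNIV. \<Sum>j\<in>UNIV. if i = j then - (2 * (c i)\<^sup>2) *\<^sub>R ebasis {} else 0)"
  proof (intro sum.cong refl)
    fix i j
    show "(c i * c j) *\<^sub>R (ebasis {i} \<odot> ebasis {j} + ebasis {j} \<odot> ebasis {i}) =
        (if i = j then - (2 * (c i)\<^sup>2) *\<^sub>R ebasis {} else 0)"
      using ebasis_anticommute[of i j]
      by (simp add: ebasis_square power2_eq_square flip: scaleR_2)
  qed
  also have "\<dots> = - (2 * (\<Sum>i\<in>UNIV. (c i)\<^sup>2)) *\<^sub>R ebasis {}"
    by (simp add: sum_distrib_left scaleR_sum_left sum_negf)
  finally show ?thesis
    unfolding c(2) by (simp flip: scaleR_2 add: scaleR_minus_right[symmetric] del: scaleR_minus_right)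
qed

lemma sphere_orthonormal:
  assumes "\<II> \<in> imag_sphere"
  shows "cRe \<II> = 0" "\<II> \<bullet> ebasis {} = 0" "ebasis {} \<bullet> \<II> = 0" "\<II> \<bullet> \<II> = 1"
proof -
  have "cRe \<II> = - cRe \<II>" using cconj_sphere[OF assms] by (metis cRe_cconj cRe_linear(4))
  then show 1: "cRe \<II> = 0" by simp
  then show "\<II> \<bullet> ebasis {} = 0" "ebasis {} \<bullet> \<II> = 0" by (simp_all add: cRe_eq_inner inner_commute)
  have "\<II> \<bullet> \<II> = cRe (cconj \<II> \<odot> \<II>)" by (simp add: cRe_cmult)
  then show "\<II> \<bullet> \<II> = 1" by (simp add: cconj_sphere[OF assms] sphere_square[OF assms])
qed

lemma norm_ebasis [simp]: "ebasis {} \<bullet> ebasis {} = 1"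
  by (simp add: cRe_eq_inner[symmetric])

lemma cIm_linear [simp]: "cIm \<II> 0 = 0" "cIm \<II> (a + b) = cIm \<II> a + cIm \<II> b"
  "cIm \<II> (a - b) = cIm \<II> a - cIm \<II> b" "cIm \<II> (- a) = - cIm \<II> a" "cIm \<II> (r *\<^sub>R a) = r * cIm \<II> a"
  by (simp_all add: cIm_def inner_add_left inner_diff_left)

lemma continuous_on_cIm [continuous_intros]:
  assumes "continuous_on S f"
  shows "continuous_on S (\<lambda>t. cIm \<II> (f t))"
  unfolding cIm_def using assms by (intro continuous_intros)

lemma cIm_sphere [simp]: "\<II> \<in> imag_sphere \<Longrightarrow> cIm \<II> (ebasis {}) = 0" "\<II> \<in> imag_sphere \<Longrightarrow> cIm \<II> \<II> = 1"
  by (simp_all add: cIm_def sphere_orthonormal)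

lemma cplane_iff:
  assumes "\<II> \<in> imag_sphere"
  shows "z \<in> cplane \<II> \<longleftrightarrow> z = cRe z *\<^sub>R ebasis {} + cIm \<II> z *\<^sub>R \<II>"
  using assms unfolding cplane_def by (auto simp: sphere_orthonormal)

lemma cplane_up_iff:
  assumes "\<II> \<in> imag_sphere"
  shows "z \<in> cplane_up \<II> \<longleftrightarrow> z \<in> cplane \<II> \<and> cIm \<II> z \<ge> 0"
  using assms unfolding cplane_up_def cplane_def by (fastforce simp: sphere_orthonormal)

lemma cplane_up_paravectors:
  assumes "\<II> \<in> imag_sphere"
  shows "cplane_up \<II> \<subseteq> paravectors"
proof
  fix z assume "z \<in> cplane_up \<II>"
  then obtain u v where z: "z = u *\<^sub>R ebasis {} + v *\<^sub>R \<II>" unfolding cplane_up_def by blast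
  obtain c where "\<II> = (\<Sum>j\<in>UNIV. c j *\<^sub>R ebasis {j})" using assms unfolding imag_sphere_def by blast
  then have "z = u *\<^sub>R ebasis {} + (\<Sum>j\<in>UNIV. (v * c j) *\<^sub>R ebasis {j})"
    unfolding z by (simp add: scaleR_sum_right)
  then show "z \<in> paravectors"
    unfolding paravectors_def mem_Collect_eq by (intro exI conjI TrueI)
qed

lemma cplane_closed [intro, simp]:
  assumes "\<II> \<in> imag_sphere"
  shows "0 \<in> cplane \<II>" "ebasis {} \<in> cplane \<II>"
    "a \<in> cplane \<II> \<Longrightarrow> b \<in> cplane \<II> \<Longrightarrow> a + b \<in> cplane \<II>"
    "a \<in> cplane \<II> \<Longrightarrow> b \<in> cplane \<II> \<Longrightarrow> a - b \<in> cplane \<II>"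
    "a \<in> cplane \<II> \<Longrightarrow> r *\<^sub>R a \<in> cplane \<II>"
    "a \<in> cplane \<II> \<Longrightarrow> cconj a \<in> cplane \<II>"
    "a \<in> cplane \<II> \<Longrightarrow> b \<in> cplane \<II> \<Longrightarrow> a \<odot> b \<in> cplane \<II>"
proof -
  let ?z = "\<lambda>u v. u *\<^sub>R ebasis {} + v *\<^sub>R \<II>"
  have I: "?z u v \<in> cplane \<II>" for u v unfolding cplane_def by blast
  have D: "a \<in> cplane \<II> \<Longrightarrow> \<exists>u v. a = ?z u v" for a unfolding cplane_def by blast
  show "0 \<in> cplane \<II>" using I[of 0 0] by simp
  show "ebasis {} \<in> cplane \<II>" using I[of 1 0] by simp
  have "?z u v + ?z u' v' = ?z (u + u') (v + v')" for u v u' v' by (simp add: algebra_simps)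
  then show "a \<in> cplane \<II> \<Longrightarrow> b \<in> cplane \<II> \<Longrightarrow> a + b \<in> cplane \<II>" using D I by metis
  have "?z u v - ?z u' v' = ?z (u - u') (v - v')" for u v u' v' by (simp add: algebra_simps)
  then show "a \<in> cplane \<II> \<Longrightarrow> b \<in> cplane \<II> \<Longrightarrow> a - b \<in> cplane \<II>" using D I by metis
  have "r *\<^sub>R ?z u v = ?z (r * u) (r * v)" for u v by (simp add: algebra_simps)
  then show "a \<in> cplane \<II> \<Longrightarrow> r *\<^sub>R a \<in> cplane \<II>" using D I by metis
  have "cconj (?z u v) = ?z u (- v)" for u v
    by (simp add: cconj_linear cconj_sphere[OF assms] cconj_generators)
  then show "a \<in> cplane \<II> \<Longrightarrow> cconj a \<in> cplane \<II>" using D I by metis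
  have "?z u v \<odot> ?z u' v' = ?z (u * u' - v * v') (u * v' + v * u')" for u v u' v'
    by (simp add: cmult_add_left cmult_add_right cmult_scaleR_left cmult_scaleR_right
        sphere_square[OF assms] algebra_simps)
  then show "a \<in> cplane \<II> \<Longrightarrow> b \<in> cplane \<II> \<Longrightarrow> a \<odot> b \<in> cplane \<II>" using D I by metis
qed

lemma cplane_arith:
  assumes "\<II> \<in> imag_sphere" "a \<in> cplane \<II>" "b \<in> cplane \<II>"
  shows "cRe (a \<odot> b) = cRe a * cRe b - cIm \<II> a * cIm \<II> b"
    "cIm \<II> (a \<odot> b) = cRe a * cIm \<II> b + cIm \<II> a * cRe b"
    "cIm \<II> (cconj a) = - cIm \<II> a"
    "(norm a)\<^sup>2 = (cRe a)\<^sup>2 + (cIm \<II> a)\<^sup>2"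
    "a \<odot> b = b \<odot> a"
    "a \<odot> cconj a = (norm a)\<^sup>2 *\<^sub>R ebasis {}"
    "norm (a \<odot> b) = norm a * norm b"
proof -
  obtain u v where a: "a = u *\<^sub>R ebasis {} + v *\<^sub>R \<II>" using assms(2) unfolding cplane_def by blast
  obtain u' v' where b: "b = u' *\<^sub>R ebasis {} + v' *\<^sub>R \<II>" using assms(3) unfolding cplane_def by blast
  note [simp] = assms(1) sphere_orthonormal[OF assms(1)]
  have ab: "a \<odot> b = (u * u' - v * v') *\<^sub>R ebasis {} + (u * v' + v * u') *\<^sub>R \<II>"
    unfolding a b by (simp add: cmult_add_left cmult_add_right cmult_scaleR_left cmult_scaleR_right
        sphere_square[OF assms(1)] algebra_simps)
  have ca: "cconj a = u *\<^sub>R ebasis {} - v *\<^sub>R \<II>"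
    unfolding a by (simp add: cconj_linear cconj_sphere[OF assms(1)] cconj_generators)
  have n: "(norm (u *\<^sub>R ebasis {} + v *\<^sub>R \<II>))\<^sup>2 = u\<^sup>2 + v\<^sup>2" for u v
    by (simp add: power2_norm_eq_inner inner_add_left inner_add_right) (simp add: power2_eq_square)
  show "cRe (a \<odot> b) = cRe a * cRe b - cIm \<II> a * cIm \<II> b"
    "cIm \<II> (a \<odot> b) = cRe a * cIm \<II> b + cIm \<II> a * cRe b"
    unfolding ab unfolding a b by simp_all
  show "cIm \<II> (cconj a) = - cIm \<II> a" unfolding ca unfolding a by simp
  show "(norm a)\<^sup>2 = (cRe a)\<^sup>2 + (cIm \<II> a)\<^sup>2"
    unfolding a n by simp
  show "a \<odot> b = b \<odot> a"
    unfolding ab unfolding a b by (simp add: cmult_add_left cmult_add_right cmult_scaleR_left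
        cmult_scaleR_right sphere_square[OF assms(1)] algebra_simps)
  show "a \<odot> cconj a = (norm a)\<^sup>2 *\<^sub>R ebasis {}"
    unfolding ca unfolding a n
    by (simp add: cmult_add_left cmult_diff_right cmult_scaleR_left cmult_scaleR_right
        sphere_square[OF assms(1)] algebra_simps power2_eq_square)
  have "(norm (a \<odot> b))\<^sup>2 = (norm a * norm b)\<^sup>2"
    unfolding ab n power_mult_distrib unfolding a b n
    by (simp add: power2_eq_square algebra_simps)
  then show "norm (a \<odot> b) = norm a * norm b" by (simp add: power2_eq_iff_nonneg)
qed

section \<open>Bounded operators\<close>

lemma op_adjoint_gr_inner:
  assumes "op_adjoint (gr P) = gr Q"
  shows "blinfun_apply P x \<bullet> y = x \<bullet> blinfun_apply Q y"
proof -
  have "(y, blinfun_apply Q y) \<in> op_adjoint (gr P)" unfolding assms by (simp add: gr_def)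
  then have "cinner (blinfun_apply P x) y = cinner x (blinfun_apply Q y)"
    unfolding op_adjoint_def gr_def by blast
  then show ?thesis by (simp flip: cRe_cinner)
qed

lemma imaginary_op_inner: "imaginary_op J \<Longrightarrow> blinfun_apply J x \<bullet> y = - (x \<bullet> blinfun_apply J y)"
  unfolding imaginary_op_def using op_adjoint_gr_inner[of J "- J"]
  by (simp add: blinfun.bilinear_simps)

lemma imaginary_op_square: "imaginary_op J \<Longrightarrow> blinfun_apply J (blinfun_apply J x) = - x"
proof -
  assume J: "imaginary_op J"
  have "(x, x) \<in> op_comp (op_adjoint (gr J)) (gr J)"
    using J unfolding imaginary_op_def unitary_op_def by auto
  moreover have "op_adjoint (gr J) = gr (- J)" using J unfolding imaginary_op_def by auto
  ultimately have "x = blinfun_apply (- J) (blinfun_apply J x)"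
    unfolding op_comp_def gr_def by auto
  then have "x = - J (J x)" by (simp add: blinfun.bilinear_simps)
  then show ?thesis by (metis minus_minus)
qed

lemma imaginary_op_cmult: "imaginary_op J \<Longrightarrow> blinfun_apply J (x \<odot> a) = blinfun_apply J x \<odot> a"
  unfolding imaginary_op_def unitary_op_def bounded_ops_def by blast

text \<open>The library has this only for codomains of class \<open>banach\<close>.\<close>
lemma blinfun_Cauchy_convergent:
  fixes X :: "nat \<Rightarrow> ('a::real_normed_vector \<Rightarrow>\<^sub>L 'b::{real_normed_vector, complete_space})"
  assumes "Cauchy X"
  shows "convergent X"
proof -
  have cau: "Cauchy (\<lambda>n. blinfun_apply (X n) x)" for x
  proof (rule metric_CauchyI)
    fix e :: real assume e: "e > 0"
    have "e / (norm x + 1) > 0" using e by (simp add: add_nonneg_pos)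
    then obtain N where N: "\<And>m n. m \<ge> N \<Longrightarrow> n \<ge> N \<Longrightarrow> norm (X m - X n) < e / (norm x + 1)"
      using CauchyD[OF assms] by blast
    have "dist (blinfun_apply (X m) x) (blinfun_apply (X n) x) < e" if "m \<ge> N" "n \<ge> N" for m n
    proof -
      have "norm (blinfun_apply (X m - X n) x) \<le> norm (X m - X n) * norm x" by (rule norm_blinfun)
      also have "\<dots> \<le> norm (X m - X n) * (norm x + 1)" by (intro mult_left_mono) auto
      also have "\<dots> < e / (norm x + 1) * (norm x + 1)"
        using N[OF that] by (intro mult_strict_right_mono) (auto simp: add_nonneg_pos)
      also have "\<dots> = e" by (simp add: add_nonneg_eq_0_iff)
      finally show ?thesis by (simp add: dist_norm blinfun.bilinear_simps)
    qed
    then show "\<exists>N. \<forall>m\<ge>N. \<forall>n\<ge>N. dist (blinfun_apply (X m) x) (blinfun_apply (X n) x) < e"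
      by blast
  qed
  define L where "L x = lim (\<lambda>n. blinfun_apply (X n) x)" for x
  have L: "(\<lambda>n. blinfun_apply (X n) x) \<longlonglongrightarrow> L x" for x
    unfolding L_def using cau[of x] by (simp add: Cauchy_convergent_iff convergent_LIMSEQ_iff)
  have "Bseq X" using assms by (rule Cauchy_Bseq)
  then obtain C where C: "\<And>n. norm (X n) \<le> C" unfolding Bseq_def by blast
  have "bounded_linear L"
  proof (rule bounded_linear_intro[where K = C])
    show "L (x + y) = L x + L y" for x y
      by (rule LIMSEQ_unique[OF L]) (simp add: blinfun.bilinear_simps tendsto_add L)
    show "L (r *\<^sub>R x) = r *\<^sub>R L x" for r x
      by (rule LIMSEQ_unique[OF L]) (simp add: blinfun.bilinear_simps tendsto_scaleR L)
    show "norm (L x) \<le> norm x * C" for x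
    proof (rule LIMSEQ_le_const2[OF tendsto_norm[OF L]])
      have "norm (blinfun_apply (X n) x) \<le> norm x * C" for n
        using norm_blinfun[of "X n" x] mult_right_mono[OF C[of n], of "norm x"]
        by (simp add: mult.commute)
      then show "\<exists>N. \<forall>n\<ge>N. norm (blinfun_apply (X n) x) \<le> norm x * C" by blast
    qed
  qed
  then obtain Y where Y: "\<And>x. blinfun_apply Y x = L x" by (metis bounded_linear_Blinfun_apply)
  have "X \<longlonglongrightarrow> Y"
  proof (rule LIMSEQ_I)
    fix e :: real assume e: "e > 0"
    obtain N where N: "\<And>m n. m \<ge> N \<Longrightarrow> n \<ge> N \<Longrightarrow> norm (X m - X n) < e / 2"
      using CauchyD[OF assms, of "e / 2"] e by auto
    have "norm (X m - Y) \<le> e / 2" if m: "m \<ge> N" for m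
    proof (rule norm_blinfun_bound)
      fix x
      have "norm (blinfun_apply (X m) x - blinfun_apply (X n) x) \<le> e / 2 * norm x" if "n \<ge> N" for n
        using norm_blinfun[of "X m - X n" x] mult_right_mono[of "norm (X m - X n)" "e / 2" "norm x"]
          N[OF m that] by (simp add: blinfun.bilinear_simps)
      then have "norm (blinfun_apply (X m) x - L x) \<le> e / 2 * norm x"
        by (intro LIMSEQ_le_const2[OF tendsto_norm[OF tendsto_diff[OF tendsto_const L]]]) blast
      then show "norm (blinfun_apply (X m - Y) x) \<le> e / 2 * norm x"
        by (simp add: blinfun.bilinear_simps Y)
    qed (use e in auto)
    then show "\<exists>N. \<forall>n\<ge>N. norm (X n - Y) < e" using e by (intro exI[of _ N]) fastforce
  qed
  then show ?thesis by (rule convergentI)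
qed

section \<open>Spectral measures\<close>

text \<open>The operator \<open>T\<close> is left out: the same theory is applied to
  \<open>E\<close> on the spectrum of \<open>T\<close> and to a spectral measure of an integral on
  the spectrum of that integral, possibly with another imaginary operator.\<close>

locale spectral_calculus =
  fixes M :: "'a measure"
    and E :: "'a set \<Rightarrow> ('h::{real_inner,complete_space}, 'n::{finite,linorder}) bop"
    and J :: "('h, 'n) bop"
    and \<II> :: "'n clifford"
  assumes spectral: "spectral_measure M E"
    and assoc: "associated J M E"
    and J: "imaginary_op J"
    and \<II>: "\<II> \<in> imag_sphere"
begin

lemmas J_inner = imaginary_op_inner[OF J]
lemmas J_square = imaginary_op_square[OF J]
lemmas J_cmult = imaginary_op_cmult[OF J]
lemmas cplane [simp, intro] = cplane_closed[OF \<II>]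

lemma E_cmult: "A \<in> sets M \<Longrightarrow> E A (x \<odot> a) = E A x \<odot> a"
  using spectral unfolding spectral_measure_def orth_projection_def bounded_ops_def by blast

lemma E_inner: "A \<in> sets M \<Longrightarrow> E A x \<bullet> y = x \<bullet> E A y"
  using spectral op_adjoint_gr_inner[of "E A" "E A" x y]
  unfolding spectral_measure_def orth_projection_def self_adjoint_def by auto

lemma E_idem: "A \<in> sets M \<Longrightarrow> E A (E A x) = E A x"
  using spectral unfolding spectral_measure_def orth_projection_def
  by (metis blinfun_apply_blinfun_compose)

lemma E_J: "A \<in> sets M \<Longrightarrow> E A (J x) = J (E A x)"
  using assoc unfolding associated_def by (metis blinfun_apply_blinfun_compose)

lemma E_sums:
  "range A \<subseteq> sets M \<Longrightarrow> disjoint_family A \<Longrightarrow> (\<lambda>i::nat. E (A i) x) sums E (\<Union>i. A i) x"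
  using spectral unfolding spectral_measure_def by blast

lemma E_space [simp]: "E (space M) = id_blinfun"
  using spectral unfolding spectral_measure_def by blast

lemma E_inner_self: "A \<in> sets M \<Longrightarrow> E A x \<bullet> x = (norm (E A x))\<^sup>2"
  by (metis E_inner E_idem power2_norm_eq_inner)

lemma norm_E_le: "A \<in> sets M \<Longrightarrow> norm (E A x) \<le> norm x"
proof -
  assume A: "A \<in> sets M"
  have "norm (E A x) * norm (E A x) \<le> norm (E A x) * norm x"
    using norm_cauchy_schwarz[of "E A x" x] by (simp add: E_inner_self[OF A] power2_eq_square)
  then show ?thesis by (cases "norm (E A x) = 0") (auto simp: mult_le_cancel_left)
qed

text \<open>Countable additivity for the constant sequence \<open>{}\<close> makes a series with
  constant terms converge.\<close>

lemma E_empty [simp]: "E {} = 0"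
proof (rule blinfun_eqI)
  fix x
  have "(\<lambda>i::nat. E {} x) sums E {} x" using E_sums[of "\<lambda>_. {}" x] by (simp add: disjoint_family_on_def)
  then have "summable (\<lambda>i::nat. E {} x)" by (rule sums_summable)
  then have "(\<lambda>i::nat. E {} x) \<longlonglongrightarrow> 0" by (rule summable_LIMSEQ_zero)
  then show "E {} x = blinfun_apply 0 x" by (simp add: LIMSEQ_const_iff)
qed

lemma E_Un: "A \<in> sets M \<Longrightarrow> B \<in> sets M \<Longrightarrow> A \<inter> B = {} \<Longrightarrow> E (A \<union> B) x = E A x + E B x"
proof -
  assume AB: "A \<in> sets M" "B \<in> sets M" "A \<inter> B = {}"
  have "disjoint_family (binaryset A B)"
    using AB(3) by (auto simp: disjoint_family_on_def binaryset_def)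
  then have "(\<lambda>i. E (binaryset A B i) x) sums E (A \<union> B) x"
    using E_sums[of "binaryset A B" x] AB by (auto simp: range_binaryset_eq UN_binaryset_eq)
  moreover have "(\<lambda>i. E (binaryset A B i) x) sums (E A x + E B x)"
    by (rule binaryset_sums) simp
  ultimately show ?thesis by (rule sums_unique2)
qed

text \<open>Additivity alone forces orthogonality: for \<open>y\<close> in the range of
  \<open>E B\<close>, the squared norm of \<open>E (A \<union> B) y\<close> is that of
  \<open>E A y\<close> plus that of \<open>y\<close>, and a projection cannot increase the
  norm.\<close>

lemma E_disjoint:
  assumes AB: "A \<in> sets M" "B \<in> sets M" "A \<inter> B = {}"
  shows "E A (E B x) = 0"
proof -
  let ?y = "E B x"
  have "(norm (E (A \<union> B) ?y))\<^sup>2 = E A ?y \<bullet> ?y + E B ?y \<bullet> ?y"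
    using AB E_inner_self[of "A \<union> B" ?y] by (simp add: E_Un[OF AB] inner_add_left)
  also have "\<dots> = (norm (E A ?y))\<^sup>2 + (norm ?y)\<^sup>2"
    using AB by (simp add: E_inner_self E_idem power2_norm_eq_inner)
  finally have "(norm (E A ?y))\<^sup>2 + (norm ?y)\<^sup>2 \<le> (norm ?y)\<^sup>2"
    using norm_E_le[of "A \<union> B" ?y] AB by (metis norm_ge_zero power_mono sets.Un)
  then show ?thesis by simp
qed

lemma E_Int: "A \<in> sets M \<Longrightarrow> B \<in> sets M \<Longrightarrow> E A (E B x) = E (A \<inter> B) x"
proof -
  assume A: "A \<in> sets M" and B: "B \<in> sets M"
  have "A \<inter> B \<inter> (B - A) = {}" "A \<inter> B \<union> (B - A) = B" "A \<inter> B \<inter> (A - B) = {}" "A \<inter> B \<union> (A - B) = A"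
    by auto
  then have "E B x = E (A \<inter> B) x + E (B - A) x" "E A y = E (A \<inter> B) y + E (A - B) y" for y
    using E_Un[of "A \<inter> B" "B - A" x] E_Un[of "A \<inter> B" "A - B" y] A B by (metis sets.Int sets.Diff)+
  moreover have "(A - B) \<inter> (A \<inter> B) = {}" "(A - B) \<inter> (B - A) = {}" "A \<inter> B \<inter> (B - A) = {}" by auto
  ultimately show ?thesis
    using A B E_disjoint[of "A \<inter> B" "B - A"] E_disjoint[of "A - B" "A \<inter> B"] E_disjoint[of "A - B" "B - A"]
    by (auto simp: blinfun.bilinear_simps E_idem)
qed

lemma E_Diff: "A \<in> sets M \<Longrightarrow> B \<in> sets M \<Longrightarrow> B \<subseteq> A \<Longrightarrow> E (A - B) x = E A x - E B x"
proof -
  assume *: "A \<in> sets M" "B \<in> sets M" "B \<subseteq> A"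
  have "A - B \<union> B = A" using *(3) by auto
  then have "E A x = E (A - B) x + E B x" using * E_Un[of "A - B" B x] by auto
  then show ?thesis by (metis add_diff_cancel_right')
qed

lemma E_UNION:
  assumes "finite V" "\<And>v. v \<in> V \<Longrightarrow> A v \<in> sets M" "disjoint_family_on A V"
  shows "E (\<Union>v\<in>V. A v) x = (\<Sum>v\<in>V. E (A v) x)"
  using assms
proof (induction V)
  case (insert v V)
  have disj: "A v \<inter> A w = {}" if "w \<in> V" for w
    using insert.hyps(2) insert.prems(2) that unfolding disjoint_family_on_def
    by (metis insert_iff)
  have "disjoint_family_on A V"
    using insert.prems(2) by (rule disjoint_family_on_mono[rotated]) (rule subset_insertI)
  then have IH: "E (\<Union>v\<in>V. A v) x = (\<Sum>v\<in>V. E (A v) x)"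
    using insert.prems(1) by (intro insert.IH) simp_all
  have "E (\<Union>v\<in>insert v V. A v) x = E (A v) x + E (\<Union>v\<in>V. A v) x"
    unfolding UN_insert
  proof (rule E_Un)
    show "A v \<in> sets M" by (rule insert.prems(1)) simp
    show "(\<Union>v\<in>V. A v) \<in> sets M"
      using insert.hyps(1) insert.prems(1) by (intro sets.finite_UN) simp_all
    show "A v \<inter> (\<Union>v\<in>V. A v) = {}" using disj by blast
  qed
  then show ?case unfolding IH by (simp only: sum.insert[OF insert.hyps])
qed (simp only: UN_empty image_empty Union_empty E_empty sum.empty blinfun.zero_left)

lemma E_incseq:
  assumes "range A \<subseteq> sets M" "incseq A"
  shows "(\<lambda>j. E (A j) x) \<longlonglongrightarrow> E (\<Union>j. A j) x"
proof -
  have d: "range (disjointed A) \<subseteq> sets M" using assms(1) by (rule sets.range_disjointed_sets)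
  have "(\<Sum>i<Suc n. E (disjointed A i) x) = E (A n) x" for n
  proof -
    have "(\<Sum>i<Suc n. E (disjointed A i) x) = E (\<Union>i<Suc n. disjointed A i) x"
      using d by (intro E_UNION[symmetric])
        (auto intro: disjoint_family_on_mono[OF subset_UNIV disjoint_family_disjointed])
    also have "(\<Union>i<Suc n. disjointed A i) = A n"
    proof -
      have "A i \<subseteq> A n" if "i < Suc n" for i
        using incseqD[OF assms(2)] that by (simp add: less_Suc_eq_le)
      then have "(\<Union>i<Suc n. A i) = A n" by blast
      then show ?thesis
        using finite_UN_disjointed_eq[of A "Suc n"] by (simp only: atLeast0LessThan)
    qed
    finally show ?thesis .
  qed
  moreover have "(\<lambda>n. \<Sum>i<n. E (disjointed A i) x) \<longlonglongrightarrow> E (\<Union>j. A j) x"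
    using E_sums[OF d disjoint_family_disjointed, of x] by (simp add: sums_def UN_disjointed_eq)
  ultimately show ?thesis
    using LIMSEQ_Suc[of "\<lambda>n. \<Sum>i<n. E (disjointed A i) x" "E (\<Union>j. A j) x"] by simp
qed

section \<open>The bounded functional calculus\<close>

text \<open>Scalar multiplication for the complex structure \<open>J\<close>. Unlike right
  multiplication by \<open>c\<close> it is right linear; the two agree where
  \<open>J x = x \<odot> \<II>\<close>.\<close>

definition cmplx :: "'n clifford \<Rightarrow> ('h, 'n) bop" where
  "cmplx c = cRe c *\<^sub>R id_blinfun + cIm \<II> c *\<^sub>R J"

lemma cmplx_apply: "cmplx c x = cRe c *\<^sub>R x + cIm \<II> c *\<^sub>R J x"
  by (simp add: cmplx_def blinfun.bilinear_simps)

lemma cmplx_linear [simp]: "cmplx 0 = 0" "cmplx (a + b) = cmplx a + cmplx b"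
  "cmplx (ebasis {}) = id_blinfun"
  by (auto intro!: blinfun_eqI simp: cmplx_apply blinfun.bilinear_simps algebra_simps \<II>)

lemma cmplx_real: "cmplx (r *\<^sub>R ebasis {}) x = r *\<^sub>R x"
  by (simp add: cmplx_apply \<II>)

lemma cmplx_mult:
  "c \<in> cplane \<II> \<Longrightarrow> d \<in> cplane \<II> \<Longrightarrow> cmplx (c \<odot> d) x = cmplx c (cmplx d x)"
  by (simp add: cmplx_apply cplane_arith[OF \<II>] blinfun.bilinear_simps J_square algebra_simps)

lemma cmplx_inner: "c \<in> cplane \<II> \<Longrightarrow> cmplx c x \<bullet> y = x \<bullet> cmplx (cconj c) y"
  by (simp add: cmplx_apply cplane_arith[OF \<II>] J_inner inner_add_left inner_add_right inner_diff_right)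

lemma norm_cmplx: "c \<in> cplane \<II> \<Longrightarrow> norm (cmplx c x) = norm c * norm x"
proof -
  assume c: "c \<in> cplane \<II>"
  have "(norm (cmplx c x))\<^sup>2 = x \<bullet> cmplx (cconj c \<odot> c) x"
    using c by (simp add: power2_norm_eq_inner cmplx_inner cmplx_mult)
  also have "cconj c \<odot> c = (norm c)\<^sup>2 *\<^sub>R ebasis {}"
    using c cplane_arith(5,6)[OF \<II>, of c "cconj c"] by simp
  finally have "(norm (cmplx c x))\<^sup>2 = (norm c * norm x)\<^sup>2"
    by (simp add: cmplx_real power_mult_distrib power2_norm_eq_inner)
  then show ?thesis by (simp add: power2_eq_iff_nonneg)
qed

lemma E_cmplx: "A \<in> sets M \<Longrightarrow> E A (cmplx c x) = cmplx c (E A x)"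
  by (simp add: cmplx_apply E_J blinfun.bilinear_simps)

lemma cmplx_cmult: "cmplx c (x \<odot> a) = cmplx c x \<odot> a"
  by (simp add: cmplx_apply J_cmult cmult_add_left cmult_scaleR_left)

section \<open>Simple functions\<close>

abbreviation SI :: "('a \<Rightarrow> 'n clifford) \<Rightarrow> ('h, 'n) bop" where
  "SI \<equiv> simple_spectral_integral \<II> J M E"

definition scfun :: "('a \<Rightarrow> 'n clifford) \<Rightarrow> bool" where
  "scfun s \<longleftrightarrow> simple_function M s \<and> s ` space M \<subseteq> cplane \<II>"

text \<open>The definition sums over the level sets of \<open>s\<close> itself. Summing over any
  finer finite partition, possibly with empty pieces, allows several functions to be expanded over
  common level sets.\<close>

lemma SI_partition:
  assumes p: "finite C" "p ` space M \<subseteq> C" "\<And>v. v \<in> C \<Longrightarrow> p -` {v} \<inter> space M \<in> sets M"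
    and s: "\<And>\<omega>. \<omega> \<in> space M \<Longrightarrow> s \<omega> = \<phi> (p \<omega>)"
  shows "SI s x = (\<Sum>v\<in>C. E (p -` {v} \<inter> space M) (cmplx (\<phi> v) x))"
proof -
  let ?E = "\<lambda>v. E (p -` {v} \<inter> space M)"
  have sub: "s ` space M \<subseteq> \<phi> ` C" using p(2) s by auto
  have pre: "s -` {c} \<inter> space M = (\<Union>v\<in>{v \<in> C. \<phi> v = c}. p -` {v} \<inter> space M)" for c
    using p(2) s by auto
  have un: "E (s -` {c} \<inter> space M) y = (\<Sum>v\<in>{v \<in> C. \<phi> v = c}. ?E v y)" for c y
    unfolding pre using p by (intro E_UNION) (auto simp: disjoint_family_on_def)
  have "SI s x = (\<Sum>c\<in>s ` space M. E (s -` {c} \<inter> space M) (cmplx c x))"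
    unfolding simple_spectral_integral_def
    by (simp add: blinfun.sum_left blinfun.bilinear_simps cmplx_apply)
  also have "\<dots> = (\<Sum>c\<in>\<phi> ` C. E (s -` {c} \<inter> space M) (cmplx c x))"
  proof (rule sum.mono_neutral_left)
    show "\<forall>c\<in>\<phi> ` C - s ` space M. E (s -` {c} \<inter> space M) (cmplx c x) = 0"
    proof
      fix c assume "c \<in> \<phi> ` C - s ` space M"
      then have "s -` {c} \<inter> space M = {}" by (auto simp: image_iff)
      then show "E (s -` {c} \<inter> space M) (cmplx c x) = 0" by (simp only: E_empty blinfun.zero_left)
    qed
  qed (use p sub in auto)
  also have "\<dots> = (\<Sum>c\<in>\<phi> ` C. \<Sum>v\<in>{v \<in> C. \<phi> v = c}. ?E v (cmplx (\<phi> v) x))"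
    unfolding un by (intro sum.cong refl) auto
  also have "\<dots> = (\<Sum>v\<in>C. ?E v (cmplx (\<phi> v) x))"
    using p(1) by (intro sum.group) auto
  finally show ?thesis .
qed

lemma SI_eq:
  assumes p: "simple_function M p" and s: "\<And>\<omega>. \<omega> \<in> space M \<Longrightarrow> s \<omega> = \<phi> (p \<omega>)"
  shows "SI s x = (\<Sum>v\<in>p ` space M. E (p -` {v} \<inter> space M) (cmplx (\<phi> v) x))"
  by (rule SI_partition[where \<phi> = \<phi>]) (use p s in \<open>auto simp: simple_function_def\<close>)

lemma simple_sets: "simple_function M p \<Longrightarrow> v \<in> p ` space M \<Longrightarrow> p -` {v} \<inter> space M \<in> sets M"
  by (auto simp: simple_function_def)

lemma E_simple_orthogonal:
  assumes "simple_function M p" "v \<in> p ` space M" "w \<in> p ` space M"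
  shows "E (p -` {v} \<inter> space M) (E (p -` {w} \<inter> space M) x) = (if v = w then E (p -` {v} \<inter> space M) x else 0)"
proof (cases "v = w")
  case False
  then have "(p -` {v} \<inter> space M) \<inter> (p -` {w} \<inter> space M) = {}" by auto
  then show ?thesis using False assms by (simp add: E_disjoint simple_sets)
qed (use assms in \<open>simp add: E_idem simple_sets\<close>)

lemma SI_add:
  assumes "scfun s" "scfun t"
  shows "SI (\<lambda>\<omega>. s \<omega> + t \<omega>) x = SI s x + SI t x"
proof -
  have p: "simple_function M (\<lambda>\<omega>. (s \<omega>, t \<omega>))"
    using assms unfolding scfun_def by (auto intro: simple_function_Pair)
  show ?thesis
    by (simp add: SI_eq[OF p, of s fst] SI_eq[OF p, of t snd]
        SI_eq[OF p, of "\<lambda>\<omega>. s \<omega> + t \<omega>" "\<lambda>v. fst v + snd v"] blinfun.bilinear_simps sum.distrib)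
qed

text \<open>Over the joint level sets of \<open>s\<close> and \<open>t\<close> the product is a
  double sum, and orthogonality of distinct pieces leaves its diagonal.\<close>

lemma SI_mult:
  assumes "scfun s" "scfun t"
  shows "SI (\<lambda>\<omega>. s \<omega> \<odot> t \<omega>) x = SI s (SI t x)"
proof -
  let ?p = "\<lambda>\<omega>. (s \<omega>, t \<omega>)"
  let ?E = "\<lambda>v. E (?p -` {v} \<inter> space M)"
  have p: "simple_function M ?p"
    using assms unfolding scfun_def by (auto intro: simple_function_Pair)
  have c: "fst v \<in> cplane \<II>" "snd v \<in> cplane \<II>" if "v \<in> ?p ` space M" for v
    using assms that unfolding scfun_def by auto
  have "SI s (SI t x) = (\<Sum>v\<in>?p ` space M. \<Sum>w\<in>?p ` space M. ?E v (cmplx (fst v) (?E w (cmplx (snd w) x))))"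
    by (simp add: SI_eq[OF p, of s fst] SI_eq[OF p, of t snd] blinfun.sum_right) (rule sum.swap)
  also have "\<dots> = (\<Sum>v\<in>?p ` space M. \<Sum>w\<in>?p ` space M. if v = w then ?E v (cmplx (fst v \<odot> snd v) x) else 0)"
  proof (intro sum.cong refl)
    fix v w assume vw: "v \<in> ?p ` space M" "w \<in> ?p ` space M"
    have "?E v (cmplx (fst v) (?E w (cmplx (snd w) x))) = ?E v (?E w (cmplx (fst v) (cmplx (snd w) x)))"
      using vw p by (simp add: E_cmplx simple_sets)
    also have "\<dots> = (if v = w then ?E v (cmplx (fst v) (cmplx (snd w) x)) else 0)"
      by (rule E_simple_orthogonal[OF p vw])
    finally show "?E v (cmplx (fst v) (?E w (cmplx (snd w) x))) =
        (if v = w then ?E v (cmplx (fst v \<odot> snd v) x) else 0)"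
      using c[OF vw(1)] by (auto simp: cmplx_mult)
  qed
  also have "\<dots> = (\<Sum>v\<in>?p ` space M. ?E v (cmplx (fst v \<odot> snd v) x))"
    using p by (simp add: simple_function_def)
  finally show ?thesis
    by (simp add: SI_eq[OF p, of "\<lambda>\<omega>. s \<omega> \<odot> t \<omega>" "\<lambda>v. fst v \<odot> snd v"])
qed

lemma SI_inner:
  assumes "scfun s"
  shows "SI s x \<bullet> y = x \<bullet> SI (\<lambda>\<omega>. cconj (s \<omega>)) y"
proof -
  have p: "simple_function M s" using assms unfolding scfun_def by blast
  have c: "v \<in> cplane \<II>" if "v \<in> s ` space M" for v using assms that unfolding scfun_def by auto
  show ?thesis
    unfolding SI_eq[OF p, of s "\<lambda>v. v", OF refl] SI_eq[OF p, of "\<lambda>\<omega>. cconj (s \<omega>)" cconj, OF refl]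
      inner_sum_left inner_sum_right
  proof (intro sum.cong refl)
    fix v assume v: "v \<in> s ` space M"
    then show "E (s -` {v} \<inter> space M) (cmplx v x) \<bullet> y = x \<bullet> E (s -` {v} \<inter> space M) (cmplx (cconj v) y)"
      using c[OF v] p by (simp add: E_inner cmplx_inner E_cmplx simple_sets)
  qed
qed

text \<open>The pieces of the sum lie in orthogonal subspaces, so Pythagoras bounds the operator
  norm by the supremum norm. This estimate carries the integral from simple to bounded
  functions.\<close>

lemma norm_SI_le:
  assumes "scfun s" "\<And>\<omega>. \<omega> \<in> space M \<Longrightarrow> norm (s \<omega>) \<le> b" "0 \<le> b"
  shows "norm (SI s) \<le> b"
proof (rule norm_blinfun_bound)
  fix x
  have p: "simple_function M s" and fin: "finite (s ` space M)"
    using assms unfolding scfun_def simple_function_def by auto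
  have c: "v \<in> cplane \<II>" if "v \<in> s ` space M" for v using assms that unfolding scfun_def by auto
  let ?E = "\<lambda>v. E (s -` {v} \<inter> space M)"
  have pyth: "(norm (\<Sum>v\<in>s ` space M. ?E v (y v)))\<^sup>2 = (\<Sum>v\<in>s ` space M. (norm (?E v (y v)))\<^sup>2)" for y
  proof (rule norm_sum_Pythagorean[OF fin])
    show "pairwise (\<lambda>i j. orthogonal (?E i (y i)) (?E j (y j))) (s ` space M)"
      unfolding pairwise_def orthogonal_def
      using E_simple_orthogonal[OF p] E_inner simple_sets[OF p] by simp
  qed
  have "x = (\<Sum>v\<in>s ` space M. ?E v x)"
  proof -
    have "(\<Sum>v\<in>s ` space M. ?E v x) = E (\<Union>v\<in>s ` space M. s -` {v} \<inter> space M) x"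
      using fin simple_sets[OF p] by (intro E_UNION[symmetric]) (auto simp: disjoint_family_on_def)
    also have "(\<Union>v\<in>s ` space M. s -` {v} \<inter> space M) = space M" by auto
    finally show ?thesis by simp
  qed
  then have x: "(norm x)\<^sup>2 = (\<Sum>v\<in>s ` space M. (norm (?E v x))\<^sup>2)" using pyth[of "\<lambda>_. x"] by simp
  have "(norm (SI s x))\<^sup>2 = (\<Sum>v\<in>s ` space M. (norm (?E v (cmplx v x)))\<^sup>2)"
    unfolding SI_eq[OF p, of s "\<lambda>v. v", OF refl] by (rule pyth)
  also have "\<dots> \<le> (\<Sum>v\<in>s ` space M. b\<^sup>2 * (norm (?E v x))\<^sup>2)"
  proof (rule sum_mono)
    fix v assume v: "v \<in> s ` space M"
    then have "norm v \<le> b" using assms(2) by auto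
    then have "norm v * norm (?E v x) \<le> b * norm (?E v x)" by (rule mult_right_mono) simp
    then show "(norm (?E v (cmplx v x)))\<^sup>2 \<le> b\<^sup>2 * (norm (?E v x))\<^sup>2"
      using v p c by (simp add: E_cmplx simple_sets norm_cmplx power_mono flip: power_mult_distrib)
  qed
  also have "\<dots> = (b * norm x)\<^sup>2" by (simp add: x power_mult_distrib flip: sum_distrib_left)
  finally show "norm (SI s x) \<le> b * norm x"
    using assms(3) by (simp add: power2_le_iff_abs_le)
qed (rule assms)

lemma SI_cmult:
  assumes "scfun s"
  shows "SI s (x \<odot> a) = SI s x \<odot> a"
proof -
  have p: "simple_function M s" using assms unfolding scfun_def by blast
  show ?thesis
    unfolding SI_eq[OF p, of s "\<lambda>v. v", OF refl] cmult_sum_left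
    by (intro sum.cong refl) (simp add: cmplx_cmult E_cmult simple_sets[OF p])
qed

lemma scfun_intros:
  "scfun s \<Longrightarrow> scfun t \<Longrightarrow> scfun (\<lambda>\<omega>. s \<omega> + t \<omega>)"
  "scfun s \<Longrightarrow> scfun t \<Longrightarrow> scfun (\<lambda>\<omega>. s \<omega> - t \<omega>)"
  "scfun s \<Longrightarrow> scfun t \<Longrightarrow> scfun (\<lambda>\<omega>. s \<omega> \<odot> t \<omega>)"
  "scfun s \<Longrightarrow> scfun (\<lambda>\<omega>. cconj (s \<omega>))"
  unfolding scfun_def
  by (auto simp: image_subset_iff intro: simple_function_compose1[of _ s]
      simple_function_compose2[of _ s t "(+)"] simple_function_compose2[of _ s t "(-)"]
      simple_function_compose2[of _ s t "(\<odot>)"])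

section \<open>Bounded measurable functions and their simple approximations\<close>

definition bcfun :: "('a \<Rightarrow> 'n clifford) \<Rightarrow> bool" where
  "bcfun f \<longleftrightarrow> f \<in> borel_measurable M \<and> f ` space M \<subseteq> cplane \<II> \<and> bounded (f ` space M)"

text \<open>Rounding down to multiples of \<open>1 / real (Suc j)\<close> errs by at most that much,
  and boundedness of \<open>h\<close> leaves finitely many values.\<close>

lemma real_simple_approx:
  assumes "h \<in> borel_measurable M" "bounded (h ` space M)"
  shows "\<exists>r. (\<forall>j. simple_function M (r j)) \<and> uniform_limit (space M) r (h :: 'a \<Rightarrow> real) sequentially"
proof -
  obtain k where k: "\<And>\<omega>. \<omega> \<in> space M \<Longrightarrow> \<bar>h \<omega>\<bar> \<le> k" using assms(2) unfolding bounded_iff by auto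
  define r where "r j \<omega> = real_of_int \<lfloor>real (Suc j) * h \<omega>\<rfloor> / real (Suc j)" for j \<omega>
  have "simple_function M (r j)" for j
  proof (rule simple_function_borel_measurable)
    show "r j \<in> borel_measurable M" unfolding r_def
      by (intro borel_measurable_divide borel_measurable_times borel_measurable_const assms
          measurable_compose[OF _ borel_measurable_real_floor])
    let ?m = "\<lceil>real (Suc j) * k\<rceil>"
    have "r j \<omega> \<in> (\<lambda>i. real_of_int i / real (Suc j)) ` {-?m..?m}" if "\<omega> \<in> space M" for \<omega>
    proof -
      have "\<bar>real (Suc j) * h \<omega>\<bar> \<le> real (Suc j) * k"
        unfolding abs_mult using k[OF that] by (intro mult_mono) auto
      then have "\<lfloor>real (Suc j) * h \<omega>\<rfloor> \<in> {-?m..?m}"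
        unfolding abs_le_iff atLeastAtMost_iff by (intro conjI) linarith+
      then show ?thesis unfolding r_def by blast
    qed
    then have "r j ` space M \<subseteq> (\<lambda>i. real_of_int i / real (Suc j)) ` {-?m..?m}" by blast
    then show "finite (r j ` space M)" by (rule finite_subset) simp
  qed
  moreover have "uniform_limit (space M) r h sequentially"
  proof (rule uniform_limitI)
    fix e :: real assume "e > 0"
    then obtain N where N: "inverse (real (Suc N)) < e" using reals_Archimedean by blast
    have "dist (r j \<omega>) (h \<omega>) < e" if "j \<ge> N" for j \<omega>
    proof -
      have "\<bar>real_of_int \<lfloor>real (Suc j) * h \<omega>\<rfloor> - real (Suc j) * h \<omega>\<bar> \<le> 1" by linarith
      then have "\<bar>(real_of_int \<lfloor>real (Suc j) * h \<omega>\<rfloor> - real (Suc j) * h \<omega>) / real (Suc j)\<bar> \<le> 1 / real (Suc j)"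
        unfolding abs_divide by (intro divide_mono) auto
      also have "(real_of_int \<lfloor>real (Suc j) * h \<omega>\<rfloor> - real (Suc j) * h \<omega>) / real (Suc j) = r j \<omega> - h \<omega>"
        by (simp add: r_def diff_divide_distrib del: of_nat_Suc)
      also have "1 / real (Suc j) \<le> inverse (real (Suc N))" using that by (simp add: field_simps)
      finally show ?thesis using N by (simp add: dist_real_def)
    qed
    then show "\<forall>\<^sub>F j in sequentially. \<forall>\<omega>\<in>space M. dist (r j \<omega>) (h \<omega>) < e"
      unfolding eventually_sequentially by blast
  qed
  ultimately show ?thesis by blast
qed

lemma measurable_parts [measurable]:
  "f \<in> borel_measurable N \<Longrightarrow> (\<lambda>\<omega>. cRe (f \<omega>)) \<in> borel_measurable N"
  "f \<in> borel_measurable N \<Longrightarrow> (\<lambda>\<omega>. cIm \<II> (f \<omega>)) \<in> borel_measurable N"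
  "f \<in> borel_measurable N \<Longrightarrow> (\<lambda>\<omega>. cconj (f \<omega>)) \<in> borel_measurable N"
  "f \<in> borel_measurable N \<Longrightarrow> g \<in> borel_measurable N \<Longrightarrow>
    (\<lambda>\<omega>. (f \<omega> :: 'n clifford) \<odot> g \<omega>) \<in> borel_measurable N"
proof -
  show "f \<in> borel_measurable N \<Longrightarrow> (\<lambda>\<omega>. cRe (f \<omega>)) \<in> borel_measurable N" for f :: "'b \<Rightarrow> 'n clifford" and N
    by (rule borel_measurable_continuous_on[where f = cRe]) (intro continuous_intros)
  show "f \<in> borel_measurable N \<Longrightarrow> (\<lambda>\<omega>. cIm \<II> (f \<omega>)) \<in> borel_measurable N" for f :: "'b \<Rightarrow> 'n clifford" and N
    by (rule borel_measurable_continuous_on[where f = "cIm \<II>"]) (intro continuous_intros)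
  show "f \<in> borel_measurable N \<Longrightarrow> (\<lambda>\<omega>. cconj (f \<omega>)) \<in> borel_measurable N" for f :: "'b \<Rightarrow> 'n clifford" and N
    by (rule borel_measurable_continuous_on[where f = cconj]) (intro continuous_intros)
  show "f \<in> borel_measurable N \<Longrightarrow> g \<in> borel_measurable N \<Longrightarrow>
    (\<lambda>\<omega>. (f \<omega> :: 'n clifford) \<odot> g \<omega>) \<in> borel_measurable N" for f g :: "'b \<Rightarrow> 'n clifford" and N
    by (rule borel_measurable_continuous_Pair) (auto intro!: continuous_intros)
qed

lemma abs_cRe_le: "\<bar>cRe a\<bar> \<le> norm a"
  unfolding cRe_def by (rule component_le_norm_cart)

lemma abs_cIm_le: "\<bar>cIm \<II> a\<bar> \<le> norm a"
  unfolding cIm_def using Cauchy_Schwarz_ineq2[of a \<II>] sphere_orthonormal(4)[OF \<II>]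
  by (simp add: norm_eq_sqrt_inner[of \<II>])

lemma simple_approx:
  assumes "bcfun f"
  shows "\<exists>s. (\<forall>j. scfun (s j)) \<and> uniform_limit (space M) s f sequentially"
proof -
  have f: "f \<in> borel_measurable M" "\<And>\<omega>. \<omega> \<in> space M \<Longrightarrow> f \<omega> \<in> cplane \<II>"
    using assms unfolding bcfun_def by auto
  obtain k where k: "\<And>\<omega>. \<omega> \<in> space M \<Longrightarrow> norm (f \<omega>) \<le> k"
    using assms unfolding bcfun_def bounded_iff by auto
  have "bounded ((\<lambda>\<omega>. cRe (f \<omega>)) ` space M)" "bounded ((\<lambda>\<omega>. cIm \<II> (f \<omega>)) ` space M)"
    unfolding bounded_iff using k abs_cRe_le abs_cIm_le by (auto intro!: exI[of _ k] intro: order_trans)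
  then obtain r q where rq: "\<And>j. simple_function M (r j)" "\<And>j. simple_function M (q j)"
    and lim: "uniform_limit (space M) r (\<lambda>\<omega>. cRe (f \<omega>)) sequentially"
      "uniform_limit (space M) q (\<lambda>\<omega>. cIm \<II> (f \<omega>)) sequentially"
    using real_simple_approx[OF measurable_parts(1)[OF f(1)]]
      real_simple_approx[OF measurable_parts(2)[OF f(1)]] by blast
  have "scfun (\<lambda>\<omega>. r j \<omega> *\<^sub>R ebasis {} + q j \<omega> *\<^sub>R \<II>)" for j
    using rq[of j] unfolding scfun_def cplane_def
    by (auto intro: simple_function_compose2[where h = "\<lambda>u v. u *\<^sub>R ebasis {} + v *\<^sub>R \<II>"])
  moreover have "uniform_limit (space M) (\<lambda>j \<omega>. r j \<omega> *\<^sub>R ebasis {} + q j \<omega> *\<^sub>R \<II>) f sequentially"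
  proof -
    have "uniform_limit (space M) (\<lambda>j \<omega>. r j \<omega> *\<^sub>R ebasis {} + q j \<omega> *\<^sub>R \<II>)
        (\<lambda>\<omega>. cRe (f \<omega>) *\<^sub>R ebasis {} + cIm \<II> (f \<omega>) *\<^sub>R \<II>) sequentially"
      by (intro uniform_limit_add bounded_linear.uniform_limit[OF bounded_linear_scaleR_left] lim)
    then show ?thesis
      by (rule uniform_limit_cong'[THEN iffD1, rotated -1]) (use f(2) cplane_iff[OF \<II>] in auto)
  qed
  ultimately show ?thesis by (intro exI[of _ "\<lambda>j \<omega>. r j \<omega> *\<^sub>R ebasis {} + q j \<omega> *\<^sub>R \<II>"]) blast
qed

end

lemma bounded_bilinear_cmult: "bounded_bilinear ((\<odot>) :: 'n::{finite,linorder} clifford \<Rightarrow> _ \<Rightarrow> _)"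
  unfolding bilinear_conv_bounded_bilinear[symmetric] bilinear_def
  by (auto intro!: linearI
      simp: cmult_add_left cmult_add_right cmult_scaleR_left cmult_scaleR_right)

section \<open>Extension of the integral by uniform limits\<close>

context spectral_calculus
begin

abbreviation BI :: "('a \<Rightarrow> 'n clifford) \<Rightarrow> ('h, 'n) bop" where
  "BI \<equiv> bounded_spectral_integral \<II> J M E"

lemma SI_diff:
  assumes "scfun s" "scfun t"
  shows "SI (\<lambda>\<omega>. s \<omega> - t \<omega>) = SI s - SI t"
proof (rule blinfun_eqI)
  fix x
  show "SI (\<lambda>\<omega>. s \<omega> - t \<omega>) x = (SI s - SI t) x"
    using SI_add[OF scfun_intros(2)[OF assms] assms(2), of x] by (simp add: blinfun.bilinear_simps)
qed

text \<open>Taken with one sequence twice this is the Cauchy property; with two sequences it shows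
  that the limit does not depend on the approximation.\<close>

lemma SI_close:
  assumes s: "\<And>j. scfun (s j)" "uniform_limit (space M) s f sequentially"
    and t: "\<And>j. scfun (t j)" "uniform_limit (space M) t f sequentially"
    and e: "e > 0"
  shows "\<exists>N. \<forall>m\<ge>N. \<forall>n\<ge>N. norm (SI (s m) - SI (t n)) < e"
proof -
  \<comment> \<open>Two errors of \<open>e / 3\<close> leave room for strictness, since
    \<open>norm_SI_le\<close> yields only a weak inequality.\<close>
  have e3: "e / 3 > 0" using e by simp
  obtain N1 where N1: "\<And>n \<omega>. n \<ge> N1 \<Longrightarrow> \<omega> \<in> space M \<Longrightarrow> dist (s n \<omega>) (f \<omega>) < e / 3"
    using uniform_limitD[OF s(2) e3] unfolding eventually_sequentially by blast
  obtain N2 where N2: "\<And>n \<omega>. n \<ge> N2 \<Longrightarrow> \<omega> \<in> space M \<Longrightarrow> dist (t n \<omega>) (f \<omega>) < e / 3"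
    using uniform_limitD[OF t(2) e3] unfolding eventually_sequentially by blast
  have "norm (SI (s m) - SI (t n)) < e" if "m \<ge> max N1 N2" "n \<ge> max N1 N2" for m n
  proof -
    have "norm (SI (\<lambda>\<omega>. s m \<omega> - t n \<omega>)) \<le> 2 * (e / 3)"
    proof (rule norm_SI_le[OF scfun_intros(2)[OF s(1) t(1)]])
      fix \<omega> assume w: "\<omega> \<in> space M"
      have "dist (s m \<omega>) (t n \<omega>) \<le> dist (s m \<omega>) (f \<omega>) + dist (t n \<omega>) (f \<omega>)"
        by (rule dist_triangle2)
      also have "\<dots> \<le> 2 * (e / 3)"
        using N1[of m, OF _ w] N2[of n, OF _ w] that by simp
      finally show "norm (s m \<omega> - t n \<omega>) \<le> 2 * (e / 3)" by (simp only: dist_norm)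
    qed (use e in simp)
    then show ?thesis using e by (simp add: SI_diff[OF s(1) t(1)])
  qed
  then show ?thesis by blast
qed

text \<open>Turns the definite description into a limit. The given sequence serves twice: it
  produces the limit, and it keeps the quantified condition from holding vacuously, which gives
  uniqueness.\<close>

lemma SI_tendsto_BI:
  assumes s: "\<And>j. scfun (s j)" "uniform_limit (space M) s f sequentially"
  shows "(\<lambda>j. SI (s j)) \<longlonglongrightarrow> BI f"
proof -
  have "Cauchy (\<lambda>j. SI (s j))"
    by (rule CauchyI) (rule SI_close[OF s s])
  then obtain L where L: "(\<lambda>j. SI (s j)) \<longlonglongrightarrow> L"
    using blinfun_Cauchy_convergent unfolding convergent_def by blast
  have "BI f = L"
    unfolding bounded_spectral_integral_def
  proof (rule the_equality, intro allI impI)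
    fix t :: "nat \<Rightarrow> 'a \<Rightarrow> 'n clifford"
    assume "\<forall>j. simple_function M (t j) \<and> t j ` space M \<subseteq> cplane \<II>"
      and lim: "uniform_limit (space M) t f sequentially"
    then have t: "\<And>j. scfun (t j)" unfolding scfun_def by blast
    have "(\<lambda>j. SI (t j) - SI (s j)) \<longlonglongrightarrow> 0"
    proof (rule LIMSEQ_I)
      fix r :: real assume "r > 0"
      from SI_close[OF t lim s this] show "\<exists>N. \<forall>n\<ge>N. norm (SI (t n) - SI (s n) - 0) < r"
        by auto
    qed
    from tendsto_add[OF this L] show "(\<lambda>j. SI (t j)) \<longlonglongrightarrow> L" by simp
  next
    fix A assume A: "\<forall>s::nat \<Rightarrow> 'a \<Rightarrow> 'n clifford.
      (\<forall>j. simple_function M (s j) \<and> s j ` space M \<subseteq> cplane \<II>) \<longrightarrow>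
      uniform_limit (space M) s f sequentially \<longrightarrow> (\<lambda>j. SI (s j)) \<longlonglongrightarrow> A"
    have "(\<lambda>j. SI (s j)) \<longlonglongrightarrow> A"
      using A s unfolding scfun_def by blast
    then show "A = L" using L by (rule LIMSEQ_unique)
  qed
  then show ?thesis using L by simp
qed

lemma BI_cong:
  assumes "\<And>\<omega>. \<omega> \<in> space M \<Longrightarrow> f \<omega> = g \<omega>"
  shows "BI f = BI g"
proof -
  have "uniform_limit (space M) s f F = uniform_limit (space M) s g F" for s :: "nat \<Rightarrow> 'a \<Rightarrow> 'n clifford" and F
    using assms by (intro uniform_limit_cong') auto
  then show ?thesis unfolding bounded_spectral_integral_def by simp
qed

lemma bcfunI:
  assumes "f \<in> borel_measurable M" "\<And>\<omega>. \<omega> \<in> space M \<Longrightarrow> f \<omega> \<in> cplane \<II>"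
    "\<And>\<omega>. \<omega> \<in> space M \<Longrightarrow> norm (f \<omega>) \<le> k"
  shows "bcfun f"
  using assms unfolding bcfun_def bounded_iff by auto

lemma bcfunD:
  assumes "bcfun f"
  shows "f \<in> borel_measurable M" "\<omega> \<in> space M \<Longrightarrow> f \<omega> \<in> cplane \<II>" "bounded (f ` space M)"
    "\<exists>k\<ge>0. \<forall>\<omega>\<in>space M. norm (f \<omega>) \<le> k"
proof -
  show "f \<in> borel_measurable M" "\<omega> \<in> space M \<Longrightarrow> f \<omega> \<in> cplane \<II>" "bounded (f ` space M)"
    using assms unfolding bcfun_def by auto
  then obtain k where "\<forall>\<omega>\<in>space M. norm (f \<omega>) \<le> k" unfolding bounded_iff by auto
  then show "\<exists>k\<ge>0. \<forall>\<omega>\<in>space M. norm (f \<omega>) \<le> k" by (intro exI[of _ "max k 0"]) auto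
qed

lemma bcfun_mult: "bcfun f \<Longrightarrow> bcfun g \<Longrightarrow> bcfun (\<lambda>\<omega>. f \<omega> \<odot> g \<omega>)"
proof -
  assume f: "bcfun f" and g: "bcfun g"
  obtain k l where kl: "k \<ge> 0" "\<forall>\<omega>\<in>space M. norm (f \<omega>) \<le> k" "\<forall>\<omega>\<in>space M. norm (g \<omega>) \<le> l"
    using bcfunD(4)[OF f] bcfunD(4)[OF g] by blast
  have "norm (f \<omega> \<odot> g \<omega>) \<le> k * l" if "\<omega> \<in> space M" for \<omega>
    using that kl bcfunD(2)[OF f] bcfunD(2)[OF g] by (simp add: cplane_arith(7)[OF \<II>] mult_mono)
  then show ?thesis
    by (intro bcfunI[where k = "k * l"] measurable_parts(4) bcfunD(1)[OF f] bcfunD(1)[OF g])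
      (simp_all add: bcfunD(2)[OF f] bcfunD(2)[OF g])
qed

lemma bcfun_cconj: "bcfun f \<Longrightarrow> bcfun (\<lambda>\<omega>. cconj (f \<omega>))"
proof -
  assume f: "bcfun f"
  obtain k where k: "\<forall>\<omega>\<in>space M. norm (f \<omega>) \<le> k" using bcfunD(4)[OF f] by auto
  show ?thesis
    by (rule bcfunI[where k = k]) (simp_all add: k bcfunD(1,2)[OF f] measurable_parts(3))
qed

lemma bcfun_const: "c \<in> cplane \<II> \<Longrightarrow> bcfun (\<lambda>_. c)"
  by (rule bcfunI[where k = "norm c"]) auto

lemma bcfun_if: "bcfun f \<Longrightarrow> A \<in> sets M \<Longrightarrow> bcfun (\<lambda>\<omega>. if \<omega> \<in> A then f \<omega> else 0)"
proof -
  assume f: "bcfun f" and A: "A \<in> sets M"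
  obtain k where k: "k \<ge> 0" "\<forall>\<omega>\<in>space M. norm (f \<omega>) \<le> k" using bcfunD(4)[OF f] by auto
  have "(\<lambda>\<omega>. if \<omega> \<in> A then f \<omega> else 0) \<in> borel_measurable M"
    using A bcfunD(1)[OF f] by (intro measurable_If_set) (auto simp: sets.Int_space_eq2)
  then show ?thesis
    by (rule bcfunI[where k = k]) (use k bcfunD(2)[OF f] in auto)
qed

lemma SI_eq_BI: "scfun s \<Longrightarrow> BI s = SI s"
proof -
  assume s: "scfun s"
  have "uniform_limit (space M) (\<lambda>_::nat. s) s sequentially"
    by (rule uniform_limitI) simp
  with s have "(\<lambda>_::nat. SI s) \<longlonglongrightarrow> BI s" by (intro SI_tendsto_BI)
  then show ?thesis by (simp add: LIMSEQ_const_iff)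
qed

lemma BI_add: "bcfun f \<Longrightarrow> bcfun g \<Longrightarrow> BI (\<lambda>\<omega>. f \<omega> + g \<omega>) = BI f + BI g"
proof -
  assume f: "bcfun f" and g: "bcfun g"
  obtain s t where s: "\<And>j. scfun (s j)" "uniform_limit (space M) s f sequentially"
    and t: "\<And>j. scfun (t j)" "uniform_limit (space M) t g sequentially"
    using simple_approx[OF f] simple_approx[OF g] by blast
  have "(\<lambda>j. SI (\<lambda>\<omega>. s j \<omega> + t j \<omega>)) \<longlonglongrightarrow> BI (\<lambda>\<omega>. f \<omega> + g \<omega>)"
    by (intro SI_tendsto_BI scfun_intros s t uniform_limit_add)
  moreover have "SI (\<lambda>\<omega>. s j \<omega> + t j \<omega>) = SI (s j) + SI (t j)" for j
    by (rule blinfun_eqI) (simp add: SI_add s t blinfun.bilinear_simps)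
  moreover have "(\<lambda>j. SI (s j) + SI (t j)) \<longlonglongrightarrow> BI f + BI g"
    by (intro tendsto_add SI_tendsto_BI s t)
  ultimately show ?thesis by (auto intro: LIMSEQ_unique)
qed

lemma BI_mult: "bcfun f \<Longrightarrow> bcfun g \<Longrightarrow> BI (\<lambda>\<omega>. f \<omega> \<odot> g \<omega>) = BI f o\<^sub>L BI g"
proof -
  assume f: "bcfun f" and g: "bcfun g"
  obtain s t where s: "\<And>j. scfun (s j)" "uniform_limit (space M) s f sequentially"
    and t: "\<And>j. scfun (t j)" "uniform_limit (space M) t g sequentially"
    using simple_approx[OF f] simple_approx[OF g] by blast
  have "(\<lambda>j. SI (\<lambda>\<omega>. s j \<omega> \<odot> t j \<omega>)) \<longlonglongrightarrow> BI (\<lambda>\<omega>. f \<omega> \<odot> g \<omega>)"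
    by (intro SI_tendsto_BI scfun_intros s t bcfunD(3) f g
        bounded_bilinear.bounded_uniform_limit[OF bounded_bilinear_cmult])
  moreover have "SI (\<lambda>\<omega>. s j \<omega> \<odot> t j \<omega>) = SI (s j) o\<^sub>L SI (t j)" for j
    by (rule blinfun_eqI) (simp add: SI_mult s t)
  moreover have "(\<lambda>j. SI (s j) o\<^sub>L SI (t j)) \<longlonglongrightarrow> (BI f o\<^sub>L BI g)"
    by (intro bounded_bilinear.tendsto[OF bounded_bilinear_blinfun_compose] SI_tendsto_BI s t)
  ultimately show ?thesis by (auto intro: LIMSEQ_unique)
qed

lemma BI_inner: "bcfun f \<Longrightarrow> BI f x \<bullet> y = x \<bullet> BI (\<lambda>\<omega>. cconj (f \<omega>)) y"
proof -
  assume f: "bcfun f"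
  obtain s where s: "\<And>j. scfun (s j)" "uniform_limit (space M) s f sequentially"
    using simple_approx[OF f] by blast
  have "uniform_limit (space M) (\<lambda>j \<omega>. cconj (s j \<omega>)) (\<lambda>\<omega>. cconj (f \<omega>)) sequentially"
    using s(2) unfolding uniform_limit_iff dist_norm by (simp flip: cconj_simps)
  then have "(\<lambda>j. SI (\<lambda>\<omega>. cconj (s j \<omega>))) \<longlonglongrightarrow> BI (\<lambda>\<omega>. cconj (f \<omega>))"
    by (intro SI_tendsto_BI scfun_intros s)
  then have "(\<lambda>j. x \<bullet> SI (\<lambda>\<omega>. cconj (s j \<omega>)) y) \<longlonglongrightarrow> x \<bullet> BI (\<lambda>\<omega>. cconj (f \<omega>)) y"
    by (intro tendsto_inner blinfun.tendsto tendsto_const)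
  moreover have "(\<lambda>j. SI (s j) x \<bullet> y) \<longlonglongrightarrow> BI f x \<bullet> y"
    by (intro tendsto_inner blinfun.tendsto tendsto_const SI_tendsto_BI s)
  ultimately show ?thesis by (auto simp: SI_inner s intro: LIMSEQ_unique)
qed

lemma BI_cmult: "bcfun f \<Longrightarrow> BI f (x \<odot> a) = BI f x \<odot> a"
proof -
  assume f: "bcfun f"
  obtain s where s: "\<And>j. scfun (s j)" "uniform_limit (space M) s f sequentially"
    using simple_approx[OF f] by blast
  have "(\<lambda>j. SI (s j) (x \<odot> a)) \<longlonglongrightarrow> BI f (x \<odot> a)" "(\<lambda>j. SI (s j) x \<odot> a) \<longlonglongrightarrow> BI f x \<odot> a"
    by (intro tendsto_cmult blinfun.tendsto tendsto_const SI_tendsto_BI s)+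
  then show ?thesis by (auto simp: SI_cmult s intro: LIMSEQ_unique)
qed

lemma BI_const: "c \<in> cplane \<II> \<Longrightarrow> BI (\<lambda>_. c) = cmplx c"
proof (rule blinfun_eqI)
  fix x assume c: "c \<in> cplane \<II>"
  \<comment> \<open>The one-piece partition indexed by \<open>()\<close> also covers an empty
    \<open>space M\<close>, on which the constant is never attained.\<close>
  have "SI (\<lambda>_. c) x = (\<Sum>v\<in>{()}. E ((\<lambda>_. ()) -` {v} \<inter> space M) (cmplx c x))"
    by (rule SI_partition) auto
  moreover have "scfun (\<lambda>_. c)" using c unfolding scfun_def by auto
  ultimately show "BI (\<lambda>_. c) x = cmplx c x" by (simp add: SI_eq_BI)
qed

lemma BI_indicator: "A \<in> sets M \<Longrightarrow> BI (\<lambda>\<omega>. if \<omega> \<in> A then ebasis {} else 0) = E A"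
proof (rule blinfun_eqI)
  fix x assume A: "A \<in> sets M"
  have pre: "(\<lambda>\<omega>. \<omega> \<in> A) -` {v} \<inter> space M = (if v then A else space M - A)" for v
    using sets.sets_into_space[OF A] by auto
  have "SI (\<lambda>\<omega>. if \<omega> \<in> A then ebasis {} else 0) x =
      (\<Sum>v\<in>UNIV. E ((\<lambda>\<omega>. \<omega> \<in> A) -` {v} \<inter> space M) (cmplx (if v then ebasis {} else 0) x))"
    by (rule SI_partition) (use A pre in auto)
  also have "\<dots> = E A x" unfolding pre by (simp add: UNIV_bool)
  finally have "SI (\<lambda>\<omega>. if \<omega> \<in> A then ebasis {} else 0) x = E A x" .
  moreover have "scfun (\<lambda>\<omega>. if \<omega> \<in> A then ebasis {} else 0)"
    using A unfolding scfun_def by (auto intro!: simple_function_If_set simp: sets.Int_space_eq2)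
  ultimately show "BI (\<lambda>\<omega>. if \<omega> \<in> A then ebasis {} else 0) x = E A x" by (simp add: SI_eq_BI)
qed

lemma BI_zero [simp]: "BI (\<lambda>_. 0) = 0"
  using BI_const[of 0] by simp

lemma BI_if:
  assumes f: "bcfun f" and A: "A \<in> sets M"
  shows "BI (\<lambda>\<omega>. if \<omega> \<in> A then f \<omega> else 0) x = E A (BI f x)"
    "BI (\<lambda>\<omega>. if \<omega> \<in> A then f \<omega> else 0) x = BI f (E A x)"
proof -
  have b: "bcfun (\<lambda>\<omega>. if \<omega> \<in> A then ebasis {} else 0)" by (intro bcfun_if bcfun_const cplane A)
  have e: "(\<lambda>\<omega>. if \<omega> \<in> A then f \<omega> else 0) = (\<lambda>\<omega>. (if \<omega> \<in> A then ebasis {} else 0) \<odot> f \<omega>)"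
    "(\<lambda>\<omega>. if \<omega> \<in> A then f \<omega> else 0) = (\<lambda>\<omega>. f \<omega> \<odot> (if \<omega> \<in> A then ebasis {} else 0))"
    by auto
  have "BI (\<lambda>\<omega>. if \<omega> \<in> A then f \<omega> else 0) = E A o\<^sub>L BI f"
    by (subst e(1), subst BI_mult[OF b f]) (simp only: BI_indicator[OF A])
  moreover have "BI (\<lambda>\<omega>. if \<omega> \<in> A then f \<omega> else 0) = BI f o\<^sub>L E A"
    by (subst e(2), subst BI_mult[OF f b]) (simp only: BI_indicator[OF A])
  ultimately show "BI (\<lambda>\<omega>. if \<omega> \<in> A then f \<omega> else 0) x = E A (BI f x)"
    "BI (\<lambda>\<omega>. if \<omega> \<in> A then f \<omega> else 0) x = BI f (E A x)"
    by (metis blinfun_apply_blinfun_compose)+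
qed

section \<open>Scalar measures\<close>

text \<open>Two vectors are kept because the parts of a Hahn decomposition have the form
  \<open>E A x \<bullet> E Y y\<close>; for equal vectors this is the scalar measure. It is
  meaningful when all values \<open>E A x \<bullet> y\<close> are nonnegative, as
  \<open>ennreal\<close> cuts off negative ones.\<close>

definition pmeas :: "('h, 'n) cmodule \<Rightarrow> ('h, 'n) cmodule \<Rightarrow> 'a measure" where
  "pmeas x y = measure_of (space M) (sets M) (\<lambda>A. ennreal (E A x \<bullet> y))"

lemma sets_pmeas [simp, measurable_cong]: "sets (pmeas x y) = sets M"
  unfolding pmeas_def by (rule sets.sets_measure_of_eq)

lemma space_pmeas [simp]: "space (pmeas x y) = space M"
  unfolding pmeas_def by (rule sets.space_measure_of_eq)

lemma
  assumes pos: "\<And>A. A \<in> sets M \<Longrightarrow> E A x \<bullet> y \<ge> 0"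
  shows emeasure_pmeas: "A \<in> sets M \<Longrightarrow> emeasure (pmeas x y) A = ennreal (E A x \<bullet> y)"
    and measure_pmeas: "A \<in> sets M \<Longrightarrow> measure (pmeas x y) A = E A x \<bullet> y"
    and finite_measure_pmeas: "finite_measure (pmeas x y)"
proof -
  show em: "emeasure (pmeas x y) A = ennreal (E A x \<bullet> y)" if "A \<in> sets M" for A
    unfolding pmeas_def
  proof (rule emeasure_measure_of_sigma[OF sets.sigma_algebra_axioms])
    show "positive (sets M) (\<lambda>A. ennreal (E A x \<bullet> y))" by (simp add: positive_def)
    show "countably_additive (sets M) (\<lambda>A. ennreal (E A x \<bullet> y))"
    proof (rule countably_additiveI)
      fix A :: "nat \<Rightarrow> 'a set" assume A: "range A \<subseteq> sets M" "disjoint_family A"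
      have "(\<lambda>i. E (A i) x \<bullet> y) sums (E (\<Union>i. A i) x \<bullet> y)"
        using bounded_linear.sums[OF bounded_linear_inner_left E_sums[OF A]] .
      then show "(\<Sum>i. ennreal (E (A i) x \<bullet> y)) = ennreal (E (\<Union>i. A i) x \<bullet> y)"
        using A pos by (intro suminf_ennreal_eq) auto
    qed
  qed fact
  then show "A \<in> sets M \<Longrightarrow> measure (pmeas x y) A = E A x \<bullet> y"
    using pos by (simp add: measure_def)
  show "finite_measure (pmeas x y)"
    by (rule finite_measureI) (use em[of "space M"] in simp)
qed

lemma pmeas_self_nonneg: "A \<in> sets M \<Longrightarrow> E A x \<bullet> x \<ge> 0"
  by (simp add: E_inner_self)

lemma scalar_measure_pmeas: "scalar_measure M E x = pmeas x x"
  unfolding scalar_measure_def pmeas_def by (simp add: cRe_cinner)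

lemma bcfun_real: "h \<in> borel_measurable M \<Longrightarrow> bounded (h ` space M) \<Longrightarrow> bcfun (\<lambda>\<omega>. (h \<omega> :: real) *\<^sub>R ebasis {})"
proof -
  assume h: "h \<in> borel_measurable M" "bounded (h ` space M)"
  then obtain k where "\<And>\<omega>. \<omega> \<in> space M \<Longrightarrow> \<bar>h \<omega>\<bar> \<le> k" unfolding bounded_iff by auto
  then show ?thesis
    using h(1) by (intro bcfunI[where k = k]) (auto simp: norm_eq_sqrt_inner[of "ebasis {}"])
qed

text \<open>Both sides are finite sums for simple functions, and both are continuous under uniform
  convergence because the measure is finite.\<close>

lemma integral_pmeas:
  assumes pos: "\<And>A. A \<in> sets M \<Longrightarrow> E A x \<bullet> y \<ge> 0"
    and h: "h \<in> borel_measurable M" "bounded (h ` space M)"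
  shows "(\<integral>\<omega>. h \<omega> \<partial>pmeas x y) = BI (\<lambda>\<omega>. h \<omega> *\<^sub>R ebasis {}) x \<bullet> y"
proof -
  interpret finite_measure "pmeas x y" using pos by (rule finite_measure_pmeas)
  obtain r where r: "\<And>j. simple_function M (r j)" "uniform_limit (space M) r h sequentially"
    using real_simple_approx[OF h] by blast
  have int: "integrable (pmeas x y) g" if g: "g \<in> borel_measurable M" "bounded (g ` space M)" for g :: "'a \<Rightarrow> real"
  proof -
    obtain k where "\<And>\<omega>. \<omega> \<in> space M \<Longrightarrow> \<bar>g \<omega>\<bar> \<le> k" using g(2) unfolding bounded_iff by auto
    then show ?thesis using g(1) by (intro integrable_const_bound[where B = k]) auto
  qed
  have simple: "(\<integral>\<omega>. r j \<omega> \<partial>pmeas x y) = SI (\<lambda>\<omega>. r j \<omega> *\<^sub>R ebasis {}) x \<bullet> y" for j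
  proof -
    let ?E = "\<lambda>v. r j -` {v} \<inter> space M"
    have fin: "finite (r j ` space M)" using r(1) by (simp add: simple_function_def)
    have E: "?E v \<in> sets M" if "v \<in> r j ` space M" for v using that r(1) by (simp add: simple_sets)
    have "(\<integral>\<omega>. r j \<omega> \<partial>pmeas x y) = (\<integral>\<omega>. (\<Sum>v\<in>r j ` space M. v * indicator (?E v) \<omega>) \<partial>pmeas x y)"
    proof (rule Bochner_Integration.integral_cong[OF refl])
      fix \<omega> assume "\<omega> \<in> space (pmeas x y)"
      then have w: "\<omega> \<in> space M" by simp
      have "(\<Sum>v\<in>r j ` space M. v * indicator (?E v) \<omega>) = (\<Sum>v\<in>r j ` space M. if v = r j \<omega> then v else 0)"
        using w by (intro sum.cong refl) (auto simp: indicator_def)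
      then show "r j \<omega> = (\<Sum>v\<in>r j ` space M. v * indicator (?E v) \<omega>)" using fin w by simp
    qed
    also have "\<dots> = (\<Sum>v\<in>r j ` space M. v * measure (pmeas x y) (?E v))"
      using E by (subst Bochner_Integration.integral_sum) (auto simp: less_top[symmetric])
    also have "\<dots> = (\<Sum>v\<in>r j ` space M. v * (E (?E v) x \<bullet> y))"
      using E pos by (intro sum.cong refl) (simp add: measure_pmeas)
    also have "\<dots> = SI (\<lambda>\<omega>. r j \<omega> *\<^sub>R ebasis {}) x \<bullet> y"
      unfolding SI_eq[OF r(1)[of j], of "\<lambda>\<omega>. r j \<omega> *\<^sub>R ebasis {}" "\<lambda>v. v *\<^sub>R ebasis {}", OF refl]
      by (simp add: inner_sum_left cmplx_real blinfun.bilinear_simps)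
    finally show ?thesis .
  qed
  have "(\<lambda>j. SI (\<lambda>\<omega>. r j \<omega> *\<^sub>R ebasis {})) \<longlonglongrightarrow> BI (\<lambda>\<omega>. h \<omega> *\<^sub>R ebasis {})"
  proof (rule SI_tendsto_BI)
    show "scfun (\<lambda>\<omega>. r j \<omega> *\<^sub>R ebasis {})" for j
      unfolding scfun_def using r(1) by (auto intro: simple_function_compose1[where g = "\<lambda>v. v *\<^sub>R ebasis {}"])
  qed (intro bounded_linear.uniform_limit[OF bounded_linear_scaleR_left] r)
  then have 1: "(\<lambda>j. \<integral>\<omega>. r j \<omega> \<partial>pmeas x y) \<longlonglongrightarrow> BI (\<lambda>\<omega>. h \<omega> *\<^sub>R ebasis {}) x \<bullet> y"
    unfolding simple by (intro tendsto_inner blinfun.tendsto tendsto_const)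
  have 2: "(\<lambda>j. \<integral>\<omega>. r j \<omega> \<partial>pmeas x y) \<longlonglongrightarrow> (\<integral>\<omega>. h \<omega> \<partial>pmeas x y)"
  proof (rule LIMSEQ_I)
    fix e :: real assume e: "e > 0"
    define m where "m = measure (pmeas x y) (space M)"
    have m: "m \<ge> 0" by (simp add: m_def)
    then have "e / (m + 1) > 0" using e by simp
    from uniform_limitD[OF r(2) this] obtain N
      where N: "\<And>j \<omega>. j \<ge> N \<Longrightarrow> \<omega> \<in> space M \<Longrightarrow> \<bar>r j \<omega> - h \<omega>\<bar> < e / (m + 1)"
      unfolding eventually_sequentially dist_real_def by blast
    have "norm ((\<integral>\<omega>. r j \<omega> \<partial>pmeas x y) - (\<integral>\<omega>. h \<omega> \<partial>pmeas x y)) < e" if "j \<ge> N" for j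
    proof -
      have ir: "integrable (pmeas x y) (r j)"
        using r(1)[of j] by (intro int borel_measurable_simple_function)
          (auto simp: simple_function_def finite_imp_bounded)
      have ih: "integrable (pmeas x y) h" using h by (rule int)
      have "norm ((\<integral>\<omega>. r j \<omega> \<partial>pmeas x y) - (\<integral>\<omega>. h \<omega> \<partial>pmeas x y)) = norm (\<integral>\<omega>. r j \<omega> - h \<omega> \<partial>pmeas x y)"
        using ir ih by simp
      also have "\<dots> \<le> (\<integral>\<omega>. \<bar>r j \<omega> - h \<omega>\<bar> \<partial>pmeas x y)" unfolding real_norm_def by (rule integral_abs_bound)
      also have "\<dots> \<le> (\<integral>\<omega>. e / (m + 1) \<partial>pmeas x y)"
        using N[OF that] ir ih by (intro integral_mono integrable_abs Bochner_Integration.integrable_diff) (auto intro: less_imp_le)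
      also have "\<dots> = m * (e / (m + 1))" by (simp add: m_def)
      also have "\<dots> < e" using e m by (simp add: field_simps)
      finally show ?thesis .
    qed
    then show "\<exists>N. \<forall>j\<ge>N. norm ((\<integral>\<omega>. r j \<omega> \<partial>pmeas x y) - (\<integral>\<omega>. h \<omega> \<partial>pmeas x y)) < e" by blast
  qed
  show ?thesis by (rule LIMSEQ_unique[OF 2 1])
qed

text \<open>Moving one factor to the other side of the inner product produces the integral of
  \<open>cconj (f \<omega>) \<odot> f \<omega>\<close>, a real function, so
  \<open>integral_pmeas\<close> applies. The result is the isometry with the square integrable
  functions.\<close>

lemma BI_norm_sq:
  assumes f: "bcfun f"
  shows "(norm (BI f x))\<^sup>2 = (\<integral>\<omega>. (norm (f \<omega>))\<^sup>2 \<partial>pmeas x x)"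
proof -
  obtain k where k: "\<And>\<omega>. \<omega> \<in> space M \<Longrightarrow> norm (f \<omega>) \<le> k" using bcfunD(4)[OF f] by blast
  have b: "bounded ((\<lambda>\<omega>. (norm (f \<omega>))\<^sup>2) ` space M)"
    unfolding bounded_iff using k by (auto intro!: exI[of _ "k\<^sup>2"] power_mono)
  have "(norm (BI f x))\<^sup>2 = (BI (\<lambda>\<omega>. cconj (f \<omega>)) o\<^sub>L BI f) x \<bullet> x"
    using BI_inner[OF bcfun_cconj[OF f], of "BI f x" x] by (simp add: power2_norm_eq_inner)
  also have "\<dots> = BI (\<lambda>\<omega>. cconj (f \<omega>) \<odot> f \<omega>) x \<bullet> x"
    by (simp add: BI_mult[OF bcfun_cconj[OF f] f])
  also have "BI (\<lambda>\<omega>. cconj (f \<omega>) \<odot> f \<omega>) = BI (\<lambda>\<omega>. (norm (f \<omega>))\<^sup>2 *\<^sub>R ebasis {})"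
  proof (rule BI_cong)
    fix \<omega> assume "\<omega> \<in> space M"
    then show "cconj (f \<omega>) \<odot> f \<omega> = (norm (f \<omega>))\<^sup>2 *\<^sub>R ebasis {}"
      using cplane_arith(6)[OF \<II>, of "cconj (f \<omega>)" 0] bcfunD(2)[OF f] by simp
  qed
  also have "\<dots> x \<bullet> x = (\<integral>\<omega>. (norm (f \<omega>))\<^sup>2 \<partial>pmeas x x)"
    using b bcfunD(1)[OF f] by (intro integral_pmeas[symmetric] pmeas_self_nonneg) auto
  finally show ?thesis .
qed

lemma BI_norm_sq_nn:
  assumes f: "bcfun f"
  shows "ennreal ((norm (BI f x))\<^sup>2) = (\<integral>\<^sup>+\<omega>. ennreal ((norm (f \<omega>))\<^sup>2) \<partial>pmeas x x)"
proof -
  interpret finite_measure "pmeas x x" using pmeas_self_nonneg by (rule finite_measure_pmeas)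
  obtain k where k: "\<And>\<omega>. \<omega> \<in> space M \<Longrightarrow> norm (f \<omega>) \<le> k" using bcfunD(4)[OF f] by blast
  have "integrable (pmeas x x) (\<lambda>\<omega>. (norm (f \<omega>))\<^sup>2)"
    using k bcfunD(1)[OF f] by (intro integrable_const_bound[where B = "k\<^sup>2"]) (auto intro!: power_mono)
  then show ?thesis by (simp add: nn_integral_eq_integral BI_norm_sq[OF f])
qed

lemma norm_BI_le:
  assumes f: "bcfun f" and b: "b \<ge> 0" "\<And>\<omega>. \<omega> \<in> space M \<Longrightarrow> norm (f \<omega>) \<le> b"
  shows "norm (BI f x) \<le> b * norm x"
proof -
  interpret finite_measure "pmeas x x" using pmeas_self_nonneg by (rule finite_measure_pmeas)
  have "integrable (pmeas x x) (\<lambda>\<omega>. (norm (f \<omega>))\<^sup>2)"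
    using b bcfunD(1)[OF f] by (intro integrable_const_bound[where B = "b\<^sup>2"]) (auto intro!: power_mono)
  then have "(norm (BI f x))\<^sup>2 \<le> (\<integral>\<omega>. b\<^sup>2 \<partial>pmeas x x)"
    unfolding BI_norm_sq[OF f] using b by (intro integral_mono) (auto intro: power_mono)
  also have "\<dots> = (b * norm x)\<^sup>2"
    by (simp add: measure_pmeas[OF pmeas_self_nonneg] power_mult_distrib power2_norm_eq_inner)
  finally show ?thesis using b by (simp add: power2_le_iff_abs_le)
qed

text \<open>In \<open>BI_norm_sq\<close>, already the part of the integral over \<open>A\<close>
  gives the bound. It will show that vectors supported off a disc grow too fast.\<close>

lemma norm_BI_ge:
  assumes f: "bcfun f" and A: "A \<in> sets M" and b: "b \<ge> 0" "\<And>\<omega>. \<omega> \<in> A \<Longrightarrow> b \<le> norm (f \<omega>)"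
  shows "b * norm (E A x) \<le> norm (BI f x)"
proof -
  interpret finite_measure "pmeas x x" using pmeas_self_nonneg by (rule finite_measure_pmeas)
  obtain k where k: "\<And>\<omega>. \<omega> \<in> space M \<Longrightarrow> norm (f \<omega>) \<le> k" using bcfunD(4)[OF f] by blast
  have "integrable (pmeas x x) (\<lambda>\<omega>. (norm (f \<omega>))\<^sup>2)"
    using k bcfunD(1)[OF f] by (intro integrable_const_bound[where B = "k\<^sup>2"]) (auto intro!: power_mono)
  moreover have "integrable (pmeas x x) (\<lambda>\<omega>. b\<^sup>2 * indicator A \<omega>)"
    using A by (intro integrable_mult_right integrable_real_indicator) (auto simp: less_top[symmetric])
  ultimately have "(\<integral>\<omega>. b\<^sup>2 * indicator A \<omega> \<partial>pmeas x x) \<le> (norm (BI f x))\<^sup>2"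
    unfolding BI_norm_sq[OF f] using b
    by (intro integral_mono) (auto split: split_indicator intro: power_mono)
  also have "(\<integral>\<omega>. b\<^sup>2 * indicator A \<omega> \<partial>pmeas x x) = (b * norm (E A x))\<^sup>2"
    using A by (simp add: measure_pmeas[OF pmeas_self_nonneg] E_inner_self power_mult_distrib)
  finally show ?thesis by (rule power2_le_imp_le) simp
qed

end

lemma finite_part_simps [simp]:
  "finite_part (Some a) = a" "finite_part None = 0"
  "finite_part (xconj z) = cconj (finite_part z)"
  "finite_part (xmult z w) = finite_part z \<odot> finite_part w"
  "finite_part (xplus z w) = (if z = None \<or> w = None then 0 else finite_part z + finite_part w)"
  "finite_part (xinverse z) = inverse ((norm (finite_part z))\<^sup>2) *\<^sub>R cconj (finite_part z)"
  by (auto simp: finite_part_def xconj_def xmult_def xplus_def xinverse_def split: option.splits)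

lemma x_None_iff [simp]:
  "xconj z = None \<longleftrightarrow> z = None" "xmult z w = None \<longleftrightarrow> z = None \<or> w = None"
  "xplus z w = None \<longleftrightarrow> z = None \<or> w = None" "xinverse z = None \<longleftrightarrow> z = Some 0"
  by (auto simp: xconj_def xmult_def xplus_def xinverse_def split: option.splits)

lemma xconj_xconj [simp]: "xconj (xconj z) = z"
  by (cases z) (auto simp: xconj_def)

lemma xnorm_sq_xconj [simp]: "xnorm_sq (xconj z) = xnorm_sq z"
  by (cases z) (auto simp: xconj_def xnorm_sq_def)

context spectral_calculus
begin

section \<open>Functions that are finite almost everywhere\<close>

text \<open>Measurability is expressed through the total function \<open>finite_part\<close>, so
  that pointwise operations preserve the property with few case distinctions at infinity.\<close>

definition aefin :: "('a \<Rightarrow> 'n xclifford) \<Rightarrow> bool" where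
  "aefin f \<longleftrightarrow> (\<lambda>\<omega>. finite_part (f \<omega>)) \<in> borel_measurable M \<and>
    (\<forall>\<omega>\<in>space M. finite_part (f \<omega>) \<in> cplane \<II>) \<and>
    {\<omega>\<in>space M. f \<omega> = None} \<in> sets M \<and> E {\<omega>\<in>space M. f \<omega> = None} = 0"

lemma E_null_mono: "A \<in> sets M \<Longrightarrow> B \<in> sets M \<Longrightarrow> A \<subseteq> B \<Longrightarrow> E B = 0 \<Longrightarrow> E A = 0"
  using E_Int[of A B] by (intro blinfun_eqI) (simp add: Int_absorb2)

lemma E_null_Un: "A \<in> sets M \<Longrightarrow> B \<in> sets M \<Longrightarrow> E A = 0 \<Longrightarrow> E B = 0 \<Longrightarrow> E (A \<union> B) = 0"
proof (rule blinfun_eqI)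
  fix x assume *: "A \<in> sets M" "B \<in> sets M" "E A = 0" "E B = 0"
  have "E (A \<union> (B - A)) x = E A x + E (B - A) x" using * by (intro E_Un) auto
  moreover have "E (B - A) = 0" using * by (intro E_null_mono[of "B - A" B]) auto
  ultimately show "E (A \<union> B) x = blinfun_apply 0 x" using * by simp
qed

lemma E_compl: "A \<in> sets M \<Longrightarrow> E (space M - A) = id_blinfun - E A"
  using E_Diff[of "space M" A] sets.sets_into_space[of A]
  by (intro blinfun_eqI) (simp add: blinfun.bilinear_simps)

lemma E_compl_null: "A \<in> sets M \<Longrightarrow> E (space M - A) = id_blinfun \<longleftrightarrow> E A = 0"
  by (simp add: E_compl)

lemma E_ae_iff:
  assumes "{\<omega>\<in>space M. \<not> P \<omega>} \<in> sets M"
  shows "E_ae M E P \<longleftrightarrow> E {\<omega>\<in>space M. \<not> P \<omega>} = 0"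
  unfolding E_ae_def using assms E_null_mono by blast

lemma aefin_xmeasurable:
  assumes f: "xmeasurable \<II> M f" and fin: "E_ae M E (\<lambda>\<omega>. f \<omega> \<noteq> None)"
  shows "aefin f"
proof -
  have N: "{\<omega>\<in>space M. f \<omega> = None} \<in> sets M"
    using f unfolding xmeasurable_def by blast
  have "(\<lambda>\<omega>. finite_part (f \<omega>)) \<in> borel_measurable M"
  proof (rule borel_measurableI)
    fix S :: "'n clifford set" assume "open S"
    then have "{\<omega>\<in>space M. f \<omega> \<in> Some ` S} \<in> sets M"
      using f unfolding xmeasurable_def by auto
    \<comment> \<open>Infinity has the dummy finite part 0, so its preimage is included exactly when
      \<open>0 \<in> S\<close>.\<close>
    moreover have "(\<lambda>\<omega>. finite_part (f \<omega>)) -` S \<inter> space M =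
        {\<omega>\<in>space M. f \<omega> \<in> Some ` S} \<union> (if 0 \<in> S then {\<omega>\<in>space M. f \<omega> = None} else {})"
      by (auto simp: finite_part_def image_iff split: option.splits if_splits)
    ultimately show "(\<lambda>\<omega>. finite_part (f \<omega>)) -` S \<inter> space M \<in> sets M"
      using N by auto
  qed
  moreover have "finite_part (f \<omega>) \<in> cplane \<II>" if "\<omega> \<in> space M" for \<omega>
    using f that unfolding xmeasurable_def by auto
  ultimately show ?thesis
    using N fin E_ae_iff[of "\<lambda>\<omega>. f \<omega> \<noteq> None"] unfolding aefin_def by simp
qed

lemma aefinD:
  assumes "aefin f"
  shows "(\<lambda>\<omega>. finite_part (f \<omega>)) \<in> borel_measurable M" "\<omega> \<in> space M \<Longrightarrow> finite_part (f \<omega>) \<in> cplane \<II>"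
    "{\<omega>\<in>space M. f \<omega> = None} \<in> sets M" "E {\<omega>\<in>space M. f \<omega> = None} = 0"
    "{\<omega>\<in>space M. f \<omega> \<noteq> None} \<in> sets M" "E {\<omega>\<in>space M. f \<omega> \<noteq> None} = id_blinfun"
proof -
  show f: "(\<lambda>\<omega>. finite_part (f \<omega>)) \<in> borel_measurable M" "\<omega> \<in> space M \<Longrightarrow> finite_part (f \<omega>) \<in> cplane \<II>"
    "{\<omega>\<in>space M. f \<omega> = None} \<in> sets M" "E {\<omega>\<in>space M. f \<omega> = None} = 0"
    using assms unfolding aefin_def by auto
  have e: "{\<omega>\<in>space M. f \<omega> \<noteq> None} = space M - {\<omega>\<in>space M. f \<omega> = None}" by auto
  show "{\<omega>\<in>space M. f \<omega> \<noteq> None} \<in> sets M" unfolding e using f(3) by (rule sets.compl_sets)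
  show "E {\<omega>\<in>space M. f \<omega> \<noteq> None} = id_blinfun"
    unfolding e E_compl_null[OF f(3)] by (rule f(4))
qed

lemma aefin_sets:
  assumes "aefin f" "B \<in> sets borel"
  shows "{\<omega>\<in>space M. f \<omega> \<in> Some ` B} \<in> sets M"
proof -
  have "{\<omega>\<in>space M. f \<omega> \<in> Some ` B} =
      ((\<lambda>\<omega>. finite_part (f \<omega>)) -` B \<inter> space M) \<inter> {\<omega>\<in>space M. f \<omega> \<noteq> None}"
    by (auto simp: image_iff)
  then show ?thesis using measurable_sets[OF aefinD(1)[OF assms(1)] assms(2)] aefinD(5)[OF assms(1)] by auto
qed

lemma aefin_zero_set:
  assumes "aefin f"
  shows "{\<omega>\<in>space M. f \<omega> = Some 0} \<in> sets M"
  using aefin_sets[OF assms, of "{0}"] by simp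

lemma aefin_xconj: "aefin f \<Longrightarrow> aefin (\<lambda>\<omega>. xconj (f \<omega>))"
  unfolding aefin_def by (auto intro: measurable_parts)

lemma aefin_xmult:
  assumes "aefin f" "aefin g"
  shows "aefin (\<lambda>\<omega>. xmult (f \<omega>) (g \<omega>))"
proof -
  have e: "{\<omega>\<in>space M. xmult (f \<omega>) (g \<omega>) = None} = {\<omega>\<in>space M. f \<omega> = None} \<union> {\<omega>\<in>space M. g \<omega> = None}"
    by auto
  show ?thesis
    unfolding aefin_def e using aefinD[OF assms(1)] aefinD[OF assms(2)]
    by (auto intro: measurable_parts E_null_Un)
qed

lemma aefin_xplus:
  assumes "aefin f" "aefin g"
  shows "aefin (\<lambda>\<omega>. xplus (f \<omega>) (g \<omega>))"
proof -
  have e: "{\<omega>\<in>space M. xplus (f \<omega>) (g \<omega>) = None} = {\<omega>\<in>space M. f \<omega> = None} \<union> {\<omega>\<in>space M. g \<omega> = None}"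
    by auto
  have s: "{\<omega>\<in>space M. f \<omega> = None \<or> g \<omega> = None} \<in> sets M"
    using sets.Un[OF aefinD(3)[OF assms(1)] aefinD(3)[OF assms(2)]] by (simp add: Collect_disj_eq conj_disj_distribL)
  show ?thesis
    unfolding aefin_def e using aefinD[OF assms(1)] aefinD[OF assms(2)] s
    by (auto intro!: measurable_If borel_measurable_add E_null_Un)
qed

lemma aefin_const: "c \<in> cplane \<II> \<Longrightarrow> aefin (\<lambda>_. Some c)"
  unfolding aefin_def by auto

lemma aefin_xinverse:
  assumes "aefin f" "E {\<omega>\<in>space M. f \<omega> = Some 0} = 0"
  shows "aefin (\<lambda>\<omega>. xinverse (f \<omega>))"
  unfolding aefin_def using aefinD[OF assms(1)] aefin_zero_set[OF assms(1)] assms(2)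
  by (auto intro!: measurable_parts borel_measurable_scaleR borel_measurable_inverse)

definition bdd_on :: "('a \<Rightarrow> 'n xclifford) \<Rightarrow> 'a set \<Rightarrow> bool" where
  "bdd_on f A \<longleftrightarrow> A \<in> sets M \<and> (\<exists>K. \<forall>\<omega>\<in>A. f \<omega> \<noteq> None \<and> norm (finite_part (f \<omega>)) \<le> K)"

text \<open>The part of \<open>bounding_sequence\<close> that does not mention the function; it
  allows sequences for different functions to be intersected.\<close>

definition exhausting :: "(nat \<Rightarrow> 'a set) \<Rightarrow> bool" where
  "exhausting A \<longleftrightarrow> range A \<subseteq> sets M \<and> incseq A \<and> E (\<Union>j. A j) = id_blinfun"

lemma bounding_sequence_iff:
  "bounding_sequence M E f A \<longleftrightarrow> exhausting A \<and> (\<forall>j. bdd_on f (A j))"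
proof -
  have "(\<exists>z. f \<omega> = Some z \<and> norm z \<le> K) \<longleftrightarrow> f \<omega> \<noteq> None \<and> norm (finite_part (f \<omega>)) \<le> K" for \<omega> K
    by auto
  then show ?thesis unfolding bounding_sequence_def exhausting_def bdd_on_def by auto
qed

lemma bdd_on_sets: "bdd_on f A \<Longrightarrow> A \<in> sets M"
  unfolding bdd_on_def by blast

lemma bdd_on_subset: "bdd_on f A \<Longrightarrow> B \<in> sets M \<Longrightarrow> B \<subseteq> A \<Longrightarrow> bdd_on f B"
  unfolding bdd_on_def by blast

lemma exhausting_sets: "exhausting A \<Longrightarrow> A j \<in> sets M"
  unfolding exhausting_def by blast

lemma exhausting_tendsto: "exhausting A \<Longrightarrow> (\<lambda>j. E (A j) x) \<longlonglongrightarrow> x"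
  unfolding exhausting_def using E_incseq[of A x] by auto

lemma exhausting_eqI:
  assumes "exhausting A" "\<And>j. E (A j) x = E (A j) y"
  shows "x = y"
  using LIMSEQ_unique[OF exhausting_tendsto[OF assms(1), of x]] exhausting_tendsto[OF assms(1), of y] assms(2)
  by simp

lemma exhausting_Int:
  assumes "exhausting A" "exhausting B"
  shows "exhausting (\<lambda>j. A j \<inter> B j)"
proof -
  have A: "range A \<subseteq> sets M" "incseq A" "E (\<Union>j. A j) = id_blinfun"
    and B: "range B \<subseteq> sets M" "incseq B" "E (\<Union>j. B j) = id_blinfun"
    using assms unfolding exhausting_def by auto
  have "incseq (\<lambda>j. A j \<inter> B j)"
    using A(2) B(2) unfolding incseq_def by blast
  moreover have "(\<Union>j. A j \<inter> B j) = (\<Union>j. A j) \<inter> (\<Union>j. B j)"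
  proof safe
    fix \<omega> i j assume "\<omega> \<in> A i" "\<omega> \<in> B j"
    then have "\<omega> \<in> A (max i j)" "\<omega> \<in> B (max i j)"
      using A(2) B(2) unfolding incseq_def by (meson max.cobounded1 max.cobounded2 subsetD)+
    then show "\<omega> \<in> (\<Union>j. A j \<inter> B j)" by blast
  qed auto
  moreover have "E ((\<Union>j. A j) \<inter> (\<Union>j. B j)) = id_blinfun"
    using E_Int[of "\<Union>j. A j" "\<Union>j. B j"] A B by (intro blinfun_eqI) auto
  ultimately show ?thesis using A(1) B(1) unfolding exhausting_def by auto
qed

lemma exhausting_const: "A \<in> sets M \<Longrightarrow> E A = id_blinfun \<Longrightarrow> exhausting (\<lambda>_. A)"
  unfolding exhausting_def by (auto simp: incseq_def)

lemma bounding_sequence_exists: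
  assumes f: "aefin f"
  shows "\<exists>A. bounding_sequence M E f A"
proof -
  define A where "A j = {\<omega>\<in>space M. f \<omega> \<noteq> None} \<inter> {\<omega>\<in>space M. norm (finite_part (f \<omega>)) \<le> real j}" for j
  have "A j \<in> sets M" for j
  proof -
    have "(\<lambda>\<omega>. norm (finite_part (f \<omega>))) \<in> borel_measurable M"
      using aefinD(1)[OF f] by (rule measurable_compose[OF _ borel_measurable_norm])
    then have "{\<omega>\<in>space M. norm (finite_part (f \<omega>)) \<le> real j} \<in> sets M"
      by (simp add: borel_measurable_iff_le)
    then show ?thesis unfolding A_def using aefinD(5)[OF f] by (rule sets.Int[rotated])
  qed
  then have "bdd_on f (A j)" for j unfolding bdd_on_def by (auto simp: A_def)
  moreover have "incseq A" unfolding incseq_def A_def by (auto intro: order_trans)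
  moreover have "(\<Union>j. A j) = {\<omega>\<in>space M. f \<omega> \<noteq> None}"
    unfolding A_def using real_arch_simple by blast
  ultimately have "bounding_sequence M E f A"
    using aefinD(6)[OF f] \<open>\<And>j. A j \<in> sets M\<close> unfolding bounding_sequence_iff exhausting_def by auto
  then show ?thesis by blast
qed

lemma bounding_sequence_Int:
  assumes "bounding_sequence M E f A" "exhausting B"
  shows "bounding_sequence M E f (\<lambda>j. A j \<inter> B j)"
  using assms exhausting_Int[of A B] unfolding bounding_sequence_iff
  by (auto intro: bdd_on_subset exhausting_sets dest: bdd_on_sets)

lemma bounding_sequence_common:
  assumes "aefin f" "aefin g"
  shows "\<exists>A. bounding_sequence M E f A \<and> bounding_sequence M E g A"
proof -
  obtain A B where A: "bounding_sequence M E f A" and B: "bounding_sequence M E g B"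
    using bounding_sequence_exists assms by blast
  have "bounding_sequence M E f (\<lambda>j. A j \<inter> B j)" "bounding_sequence M E g (\<lambda>j. B j \<inter> A j)"
    using bounding_sequence_Int A B unfolding bounding_sequence_iff by blast+
  then show ?thesis by (auto simp: Int_commute)
qed

section \<open>Unbounded spectral integrals\<close>

abbreviation SPI :: "('a \<Rightarrow> 'n xclifford) \<Rightarrow> ('h, 'n) opgraph" where
  "SPI \<equiv> spectral_integral \<II> J M E"

definition trunc :: "('a \<Rightarrow> 'n xclifford) \<Rightarrow> 'a set \<Rightarrow> ('h, 'n) bop" where
  "trunc f A = BI (\<lambda>\<omega>. if \<omega> \<in> A then finite_part (f \<omega>) else 0)"

lemma bcfun_trunc:
  assumes "aefin f" "bdd_on f A"
  shows "bcfun (\<lambda>\<omega>. if \<omega> \<in> A then finite_part (f \<omega>) else 0)"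
proof -
  obtain K where K: "\<And>\<omega>. \<omega> \<in> A \<Longrightarrow> norm (finite_part (f \<omega>)) \<le> K" and A: "A \<in> sets M"
    using assms(2) unfolding bdd_on_def by blast
  have "(\<lambda>\<omega>. if \<omega> \<in> A then finite_part (f \<omega>) else 0) \<in> borel_measurable M"
    using A aefinD(1)[OF assms(1)] by (intro measurable_If_set) (auto simp: sets.Int_space_eq2)
  then show ?thesis
    by (rule bcfunI[where k = "max K 0"]) (use aefinD(2)[OF assms(1)] K in \<open>auto simp: le_max_iff_disj\<close>)
qed

lemma trunc_E:
  assumes "aefin f" "bdd_on f A" "B \<in> sets M"
  shows "E B (trunc f A x) = trunc f (A \<inter> B) x" "trunc f A (E B x) = trunc f (A \<inter> B) x"
proof -
  have "(\<lambda>\<omega>. if \<omega> \<in> A \<inter> B then finite_part (f \<omega>) else 0) =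
      (\<lambda>\<omega>. if \<omega> \<in> B then (if \<omega> \<in> A then finite_part (f \<omega>) else 0) else 0)" by auto
  then show "E B (trunc f A x) = trunc f (A \<inter> B) x" "trunc f A (E B x) = trunc f (A \<inter> B) x"
    unfolding trunc_def using BI_if[OF bcfun_trunc[OF assms(1,2)] assms(3), of x] by simp_all
qed

lemma trunc_E_self:
  assumes "aefin f" "bdd_on f A"
  shows "E A (trunc f A x) = trunc f A x" "trunc f A (E A x) = trunc f A x"
  using trunc_E[OF assms bdd_on_sets[OF assms(2)]] by simp_all

lemma trunc_cmult: "aefin f \<Longrightarrow> bdd_on f A \<Longrightarrow> trunc f A (x \<odot> a) = trunc f A x \<odot> a"
  unfolding trunc_def by (rule BI_cmult) (rule bcfun_trunc)

lemma trunc_inner: "aefin f \<Longrightarrow> bdd_on f A \<Longrightarrow> trunc f A x \<bullet> y = x \<bullet> trunc (\<lambda>\<omega>. xconj (f \<omega>)) A y"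
proof -
  assume *: "aefin f" "bdd_on f A"
  have "(\<lambda>\<omega>. cconj (if \<omega> \<in> A then finite_part (f \<omega>) else 0)) =
      (\<lambda>\<omega>. if \<omega> \<in> A then finite_part (xconj (f \<omega>)) else 0)" by auto
  then show ?thesis unfolding trunc_def using BI_inner[OF bcfun_trunc[OF *], of x y] by simp
qed

lemma trunc_xmult:
  assumes "aefin f" "bdd_on f A" "aefin g" "bdd_on g A"
  shows "trunc (\<lambda>\<omega>. xmult (f \<omega>) (g \<omega>)) A x = trunc f A (trunc g A x)"
proof -
  have "(\<lambda>\<omega>. if \<omega> \<in> A then finite_part (xmult (f \<omega>) (g \<omega>)) else 0) =
     (\<lambda>\<omega>. (if \<omega> \<in> A then finite_part (f \<omega>) else 0) \<odot> (if \<omega> \<in> A then finite_part (g \<omega>) else 0))"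
    by auto
  then show ?thesis
    unfolding trunc_def using BI_mult[OF bcfun_trunc[OF assms(1,2)] bcfun_trunc[OF assms(3,4)]] by simp
qed

lemma trunc_xplus:
  assumes "aefin f" "bdd_on f A" "aefin g" "bdd_on g A"
  shows "trunc (\<lambda>\<omega>. xplus (f \<omega>) (g \<omega>)) A x = trunc f A x + trunc g A x"
proof -
  have "(\<lambda>\<omega>. if \<omega> \<in> A then finite_part (xplus (f \<omega>) (g \<omega>)) else 0) =
     (\<lambda>\<omega>. (if \<omega> \<in> A then finite_part (f \<omega>) else 0) + (if \<omega> \<in> A then finite_part (g \<omega>) else 0))"
    using assms(2,4) unfolding bdd_on_def by (intro ext) auto
  then show ?thesis
    unfolding trunc_def using BI_add[OF bcfun_trunc[OF assms(1,2)] bcfun_trunc[OF assms(3,4)]]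
    by (simp add: blinfun.bilinear_simps)
qed

lemma trunc_const: "c \<in> cplane \<II> \<Longrightarrow> A \<in> sets M \<Longrightarrow> trunc (\<lambda>_. Some c) A x = E A (cmplx c x)"
  unfolding trunc_def using BI_if(1)[OF bcfun_const, of c A x] by (simp add: BI_const cong: if_cong)

lemma bdd_on_intros:
  "bdd_on f A \<Longrightarrow> bdd_on (\<lambda>\<omega>. xconj (f \<omega>)) A"
  "A \<in> sets M \<Longrightarrow> bdd_on (\<lambda>_. Some c) A"
  unfolding bdd_on_def by auto

lemma bdd_on_xmult:
  assumes "aefin f" "bdd_on f A" "aefin g" "bdd_on g A"
  shows "bdd_on (\<lambda>\<omega>. xmult (f \<omega>) (g \<omega>)) A"
proof -
  obtain K L where A: "A \<in> sets M" and K: "\<And>\<omega>. \<omega> \<in> A \<Longrightarrow> f \<omega> \<noteq> None \<and> norm (finite_part (f \<omega>)) \<le> K"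
    and L: "\<And>\<omega>. \<omega> \<in> A \<Longrightarrow> g \<omega> \<noteq> None \<and> norm (finite_part (g \<omega>)) \<le> L"
    using assms(2,4) unfolding bdd_on_def by blast
  have "norm (finite_part (xmult (f \<omega>) (g \<omega>))) \<le> max K 0 * L" if "\<omega> \<in> A" for \<omega>
  proof -
    have "\<omega> \<in> space M" using that A sets.sets_into_space by blast
    then have "norm (finite_part (xmult (f \<omega>) (g \<omega>))) = norm (finite_part (f \<omega>)) * norm (finite_part (g \<omega>))"
      by (simp add: cplane_arith(7)[OF \<II>] aefinD(2)[OF assms(1)] aefinD(2)[OF assms(3)])
    also have "\<dots> \<le> max K 0 * L"
      using K[OF that] L[OF that] by (intro mult_mono) (auto simp: le_max_iff_disj)
    finally show ?thesis .
  qed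
  then show ?thesis using A K L unfolding bdd_on_def by auto
qed

lemma bdd_on_xplus:
  assumes "bdd_on f A" "bdd_on g A"
  shows "bdd_on (\<lambda>\<omega>. xplus (f \<omega>) (g \<omega>)) A"
proof -
  obtain K L where A: "A \<in> sets M" and K: "\<And>\<omega>. \<omega> \<in> A \<Longrightarrow> f \<omega> \<noteq> None \<and> norm (finite_part (f \<omega>)) \<le> K"
    and L: "\<And>\<omega>. \<omega> \<in> A \<Longrightarrow> g \<omega> \<noteq> None \<and> norm (finite_part (g \<omega>)) \<le> L"
    using assms unfolding bdd_on_def by blast
  have "norm (finite_part (xplus (f \<omega>) (g \<omega>))) \<le> K + L" if "\<omega> \<in> A" for \<omega>
    using K[OF that] L[OF that] by (auto intro: norm_triangle_mono)
  then show ?thesis using A K L unfolding bdd_on_def by (metis x_None_iff(3))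
qed

text \<open>Off a null set the squared moduli of the truncations increase to that of
  \<open>f\<close>, so monotone convergence reduces the claim to the isometry for bounded
  functions.\<close>

lemma nn_integral_xnorm_sq:
  assumes f: "aefin f" and A: "bounding_sequence M E f A"
  shows "(\<integral>\<^sup>+\<omega>. xnorm_sq (f \<omega>) \<partial>pmeas x x) = (SUP j. ennreal ((norm (trunc f (A j) x))\<^sup>2))"
proof -
  define U where "U = (\<Union>j. A j)"
  have A': "exhausting A" "\<And>j. bdd_on f (A j)" using A unfolding bounding_sequence_iff by auto
  have U: "U \<in> sets M" "E U = id_blinfun" "incseq A"
    using A'(1) unfolding exhausting_def U_def by auto
  let ?h = "\<lambda>j \<omega>. ennreal ((norm (if \<omega> \<in> A j then finite_part (f \<omega>) else 0))\<^sup>2)"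
  have "emeasure (pmeas x x) (space M - U) = 0"
    using U by (subst emeasure_pmeas) (auto simp: pmeas_self_nonneg E_compl)
  then have "AE \<omega> in pmeas x x. \<omega> \<in> U"
    using U(1) by (intro AE_I[of _ _ "space M - U"]) auto
  then have "AE \<omega> in pmeas x x. xnorm_sq (f \<omega>) = (SUP j. ?h j \<omega>)"
  proof (rule AE_mp, intro AE_I2 impI)
    fix \<omega> assume "\<omega> \<in> U"
    then obtain i where i: "\<omega> \<in> A i" unfolding U_def by blast
    then obtain z where z: "f \<omega> = Some z" using A'(2)[of i] unfolding bdd_on_def by auto
    have "(SUP j. ?h j \<omega>) = ennreal ((norm z)\<^sup>2)"
    proof (rule antisym)
      show "(SUP j. ?h j \<omega>) \<le> ennreal ((norm z)\<^sup>2)" by (rule SUP_least) (simp add: z)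
      show "ennreal ((norm z)\<^sup>2) \<le> (SUP j. ?h j \<omega>)" by (rule SUP_upper2[of i]) (simp_all add: z i)
    qed
    then show "xnorm_sq (f \<omega>) = (SUP j. ?h j \<omega>)" by (simp add: z xnorm_sq_def)
  qed
  then have "(\<integral>\<^sup>+\<omega>. xnorm_sq (f \<omega>) \<partial>pmeas x x) = (\<integral>\<^sup>+\<omega>. (SUP j. ?h j \<omega>) \<partial>pmeas x x)"
    by (rule nn_integral_cong_AE)
  also have "\<dots> = (SUP j. \<integral>\<^sup>+\<omega>. ?h j \<omega> \<partial>pmeas x x)"
  proof (rule nn_integral_monotone_convergence_SUP)
    show "incseq ?h"
      using U(3) unfolding incseq_def le_fun_def by (auto simp: subset_iff)
    show "?h j \<in> borel_measurable (pmeas x x)" for j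
      using bcfunD(1)[OF bcfun_trunc[OF f A'(2)[of j]]] by simp
  qed
  also have "\<dots> = (SUP j. ennreal ((norm (trunc f (A j) x))\<^sup>2))"
    unfolding trunc_def by (simp add: BI_norm_sq_nn bcfun_trunc f A')
  finally show ?thesis .
qed

text \<open>One sequence suffices although the definition quantifies over all: projecting a later
  truncation by \<open>E (A i)\<close> gives the earlier one, so the limit is visible at every
  stage. Conversely the truncations of \<open>x\<close> have norm at most \<open>norm y\<close>,
  which makes the integral finite.\<close>

lemma mem_SPI:
  assumes f: "aefin f" and A: "bounding_sequence M E f A"
  shows "(x, y) \<in> SPI f \<longleftrightarrow> (\<forall>j. E (A j) y = trunc f (A j) x)"
proof
  have A': "exhausting A" "\<And>j. bdd_on f (A j)" using A unfolding bounding_sequence_iff by auto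
  have inc: "A i \<subseteq> A j" if "i \<le> j" for i j
    using A'(1) that unfolding exhausting_def incseq_def by blast
  {
    assume "(x, y) \<in> SPI f"
    then have lim: "(\<lambda>j. trunc f (A j) x) \<longlonglongrightarrow> y"
      using A unfolding spectral_integral_def trunc_def by blast
    show "\<forall>j. E (A j) y = trunc f (A j) x"
    proof
      fix i
      have "(\<lambda>j. E (A i) (trunc f (A j) x)) \<longlonglongrightarrow> E (A i) y"
        by (intro blinfun.tendsto tendsto_const lim)
      moreover have "\<forall>\<^sub>F j in sequentially. E (A i) (trunc f (A j) x) = trunc f (A i) x"
        unfolding eventually_sequentially
      proof (intro exI allI impI)
        fix j assume "i \<le> j"
        then show "E (A i) (trunc f (A j) x) = trunc f (A i) x"
          using trunc_E(1)[OF f A'(2)[of j] exhausting_sets[OF A'(1), of i], of x] inc[of i j]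
          by (simp add: Int_absorb1)
      qed
      ultimately have "(\<lambda>j::nat. trunc f (A i) x) \<longlonglongrightarrow> E (A i) y"
        using tendsto_cong by fast
      then show "E (A i) y = trunc f (A i) x" by (simp add: LIMSEQ_const_iff)
    qed
  next
    assume *: "\<forall>j. E (A j) y = trunc f (A j) x"
    have "(\<integral>\<^sup>+\<omega>. xnorm_sq (f \<omega>) \<partial>scalar_measure M E x) = (SUP j. ennreal ((norm (E (A j) y))\<^sup>2))"
      unfolding scalar_measure_pmeas nn_integral_xnorm_sq[OF f A] using * by simp
    also have "\<dots> \<le> ennreal ((norm y)\<^sup>2)"
      by (intro SUP_least ennreal_leI power_mono norm_E_le exhausting_sets A') simp
    also have "\<dots> < \<infinity>" by simp
    finally have dom: "(\<integral>\<^sup>+\<omega>. xnorm_sq (f \<omega>) \<partial>scalar_measure M E x) < \<infinity>" .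
    moreover have "(\<lambda>j. trunc f (B j) x) \<longlonglongrightarrow> y" if B: "bounding_sequence M E f B" for B
    proof -
      have B': "exhausting B" "\<And>j. bdd_on f (B j)" using B unfolding bounding_sequence_iff by auto
      \<comment> \<open>Two bounding sequences are compared on the intersections
        \<open>A i \<inter> B j\<close>, where both truncations are available.\<close>
      have "trunc f (B j) x = E (B j) y" for j
      proof (rule exhausting_eqI[OF A'(1)])
        fix i
        have "E (A i) (trunc f (B j) x) = trunc f (A i \<inter> B j) x"
          using trunc_E(1)[OF f B'(2)[of j] exhausting_sets[OF A'(1), of i], of x] by (simp add: Int_commute)
        also have "\<dots> = E (B j) (trunc f (A i) x)"
          using trunc_E(1)[OF f A'(2)[of i] exhausting_sets[OF B'(1), of j], of x] by simp
        also have "\<dots> = E (B j) (E (A i) y)" using * by simp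
        also have "\<dots> = E (A i) (E (B j) y)"
          using A'(1) B'(1) by (simp add: E_Int exhausting_sets Int_commute)
        finally show "E (A i) (trunc f (B j) x) = E (A i) (E (B j) y)" .
      qed
      then show ?thesis using exhausting_tendsto[OF B'(1), of y] by simp
    qed
    ultimately show "(x, y) \<in> SPI f"
      unfolding spectral_integral_def trunc_def by blast
  }
qed

text \<open>Finiteness of the integral must produce a value. The truncations \<open>v j\<close> have
  orthogonal increments, so \<open>(norm (v j - v i))\<^sup>2\<close> is the difference of the
  squared norms; these increase and are bounded. Completeness of the space then yields the
  limit.\<close>

lemma Domain_SPI:
  assumes f: "aefin f"
  shows "x \<in> Domain (SPI f) \<longleftrightarrow> (\<integral>\<^sup>+\<omega>. xnorm_sq (f \<omega>) \<partial>pmeas x x) < \<infinity>"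
proof
  assume "x \<in> Domain (SPI f)"
  then show "(\<integral>\<^sup>+\<omega>. xnorm_sq (f \<omega>) \<partial>pmeas x x) < \<infinity>"
    unfolding spectral_integral_def scalar_measure_pmeas by auto
next
  assume fin: "(\<integral>\<^sup>+\<omega>. xnorm_sq (f \<omega>) \<partial>pmeas x x) < \<infinity>"
  obtain A where A: "bounding_sequence M E f A" using bounding_sequence_exists[OF f] by blast
  then have A': "exhausting A" "\<And>j. bdd_on f (A j)" unfolding bounding_sequence_iff by auto
  have inc: "A i \<subseteq> A j" if "i \<le> j" for i j
    using A'(1) that unfolding exhausting_def incseq_def by blast
  define v where "v j = trunc f (A j) x" for j
  have E_v: "E (A i) (v j) = v i" if "i \<le> j" for i j
    using trunc_E(1)[OF f A'(2)[of j] exhausting_sets[OF A'(1), of i], of x] inc[OF that]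
    by (simp add: Int_absorb1 v_def)
  obtain c where c: "(\<integral>\<^sup>+\<omega>. xnorm_sq (f \<omega>) \<partial>pmeas x x) = ennreal c" "c \<ge> 0"
    using fin by (cases "\<integral>\<^sup>+\<omega>. xnorm_sq (f \<omega>) \<partial>pmeas x x" rule: ennreal_cases) auto
  have bound: "(norm (v j))\<^sup>2 \<le> c" for j
  proof -
    have "ennreal ((norm (v j))\<^sup>2) \<le> ennreal c"
      unfolding c(1)[symmetric] nn_integral_xnorm_sq[OF f A] v_def by (rule SUP_upper) simp
    then show ?thesis using c(2) by simp
  qed
  have pyth: "(norm (v j - v i))\<^sup>2 = (norm (v j))\<^sup>2 - (norm (v i))\<^sup>2" if "i \<le> j" for i j
  proof -
    have "v i \<bullet> v j = v i \<bullet> v i"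
      using E_inner[OF exhausting_sets[OF A'(1)], of i "v j" "v j"]
        E_inner[OF exhausting_sets[OF A'(1)], of i "v i" "v j"] E_v[OF that] E_v[of i i] by simp
    then show ?thesis
      by (simp add: power2_norm_eq_inner inner_diff_left inner_diff_right inner_commute)
  qed
  have mono: "incseq (\<lambda>j. (norm (v j))\<^sup>2)"
    unfolding incseq_def using pyth by (metis diff_ge_0_iff_ge zero_le_power2)
  have "Bseq (\<lambda>j. (norm (v j))\<^sup>2)"
    using bound by (intro BseqI'[of _ c]) simp
  then have "Cauchy (\<lambda>j. (norm (v j))\<^sup>2)"
    using mono by (intro convergent_Cauchy Bseq_monoseq_convergent) (auto simp: incseq_imp_monoseq)
  have "Cauchy v"
  proof (rule metric_CauchyI)
    fix e :: real assume e: "e > 0"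
    then obtain N where N: "\<And>m n. m \<ge> N \<Longrightarrow> n \<ge> N \<Longrightarrow> norm ((norm (v m))\<^sup>2 - (norm (v n))\<^sup>2) < e\<^sup>2"
      using CauchyD[OF \<open>Cauchy (\<lambda>j. (norm (v j))\<^sup>2)\<close>, of "e\<^sup>2"] by auto
    have le: "dist (v m) (v n) < e" if "m \<ge> N" "n \<ge> N" "m \<le> n" for m n
    proof -
      have "(norm (v n - v m))\<^sup>2 < e\<^sup>2" using N[OF that(2,1)] pyth[OF that(3)] by simp
      then show ?thesis using e by (metis dist_commute dist_norm less_imp_le power2_less_imp_less)
    qed
    have "dist (v m) (v n) < e" if "m \<ge> N" "n \<ge> N" for m n
      using le[OF that] le[OF that(2,1)] by (cases "m \<le> n") (auto simp: dist_commute)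
    then show "\<exists>N. \<forall>m\<ge>N. \<forall>n\<ge>N. dist (v m) (v n) < e" by blast
  qed
  then obtain y where y: "v \<longlonglongrightarrow> y" by (auto simp: Cauchy_convergent_iff convergent_def)
  have "E (A i) y = v i" for i
  proof -
    have "(\<lambda>j. E (A i) (v j)) \<longlonglongrightarrow> E (A i) y"
      by (intro blinfun.tendsto tendsto_const y)
    moreover have "\<forall>\<^sub>F j in sequentially. E (A i) (v j) = v i"
      unfolding eventually_sequentially using E_v by blast
    ultimately have "(\<lambda>j::nat. v i) \<longlonglongrightarrow> E (A i) y"
      using tendsto_cong by fast
    then show ?thesis by (simp add: LIMSEQ_const_iff)
  qed
  then have "(x, y) \<in> SPI f" unfolding mem_SPI[OF f A] v_def by blast
  then show "x \<in> Domain (SPI f)" by blast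
qed

text \<open>Vectors cut off by a set on which \<open>f\<close> is bounded lie in the domain. By
  \<open>exhausting_tendsto\<close> they approximate every vector, which gives density of the
  domain, test vectors for the adjoint, and the closures in (ii) and (iii).\<close>

lemma SPI_core:
  assumes f: "aefin f" and D: "bdd_on f D"
  shows "(E D x, trunc f D x) \<in> SPI f"
proof -
  obtain A where A: "bounding_sequence M E f A" using bounding_sequence_exists[OF f] by blast
  then have A': "exhausting A" "\<And>j. bdd_on f (A j)" unfolding bounding_sequence_iff by auto
  show ?thesis
    unfolding mem_SPI[OF f A]
    by (simp add: trunc_E(1)[OF f D exhausting_sets[OF A'(1)]] trunc_E(2)[OF f A'(2) bdd_on_sets[OF D]] Int_commute)
qed

text \<open>Frees the graph equations from the chosen sequence: they hold for every set on which
  \<open>f\<close> is bounded.\<close>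

lemma SPI_E:
  assumes f: "aefin f" and D: "bdd_on f D" and xy: "(x, y) \<in> SPI f"
  shows "E D y = trunc f D x"
proof -
  obtain A where A: "bounding_sequence M E f A" using bounding_sequence_exists[OF f] by blast
  then have A': "exhausting A" "\<And>j. bdd_on f (A j)" unfolding bounding_sequence_iff by auto
  show ?thesis
  proof (rule exhausting_eqI[OF A'(1)])
    fix j
    have "E (A j) (E D y) = E D (trunc f (A j) x)"
      using xy A'(1) D unfolding mem_SPI[OF f A] by (metis E_Int Int_commute bdd_on_sets exhausting_sets)
    then show "E (A j) (E D y) = E (A j) (trunc f D x)"
      by (simp add: trunc_E(1)[OF f A'(2) bdd_on_sets[OF D]] trunc_E(1)[OF f D exhausting_sets[OF A'(1)]] Int_commute)
  qed
qed

section \<open>Spectral integrals as closed normal operators, their products, sums and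
  inverses\<close>

lemma SPI_unique: "aefin f \<Longrightarrow> (x, y) \<in> SPI f \<Longrightarrow> (x, y') \<in> SPI f \<Longrightarrow> y = y'"
proof -
  assume f: "aefin f" and *: "(x, y) \<in> SPI f" "(x, y') \<in> SPI f"
  obtain A where A: "bounding_sequence M E f A" using bounding_sequence_exists[OF f] by blast
  then have "exhausting A" unfolding bounding_sequence_iff by auto
  then show ?thesis by (rule exhausting_eqI) (use * mem_SPI[OF f A] in simp)
qed

lemma right_linear_SPI:
  assumes f: "aefin f"
  shows "right_linear (SPI f)"
proof -
  obtain A where A: "bounding_sequence M E f A" using bounding_sequence_exists[OF f] by blast
  then have A': "exhausting A" "\<And>j. bdd_on f (A j)" unfolding bounding_sequence_iff by auto
  have "single_valued (SPI f)" by (rule single_valuedI) (rule SPI_unique[OF f])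
  then show ?thesis
    unfolding right_linear_def
    by (auto simp: mem_SPI[OF f A] blinfun.bilinear_simps trunc_cmult f A' E_cmult exhausting_sets)
qed

lemma closed_SPI:
  assumes f: "aefin f"
  shows "closed (SPI f)"
proof -
  obtain A where A: "bounding_sequence M E f A" using bounding_sequence_exists[OF f] by blast
  have "SPI f = {p. \<forall>j. E (A j) (snd p) = trunc f (A j) (fst p)}"
    using mem_SPI[OF f A] by auto
  moreover have "closed {p. \<forall>j. E (A j) (snd p) = trunc f (A j) (fst p)}"
    by (intro closed_Collect_all closed_Collect_eq continuous_intros)
  ultimately show ?thesis by simp
qed

lemma densely_defined_SPI:
  assumes f: "aefin f"
  shows "densely_defined (SPI f)"
proof -
  obtain A where A: "bounding_sequence M E f A" using bounding_sequence_exists[OF f] by blast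
  then have A': "exhausting A" "\<And>j. bdd_on f (A j)" unfolding bounding_sequence_iff by auto
  have "x \<in> closure (Domain (SPI f))" for x
    unfolding closure_sequential
    using exhausting_tendsto[OF A'(1), of x] SPI_core[OF f A'(2)]
    by (intro exI[of _ "\<lambda>j. E (A j) x"]) blast
  then show ?thesis unfolding densely_defined_def by blast
qed

text \<open>Testing an adjoint pair against cut-off vectors gives exactly the graph equations for
  the conjugate function. The converse passes to the limit for real inner products;
  \<open>cinner_eqI\<close> applies since the graph is closed under right multiplication.\<close>

lemma op_adjoint_SPI:
  assumes f: "aefin f"
  shows "op_adjoint (SPI f) = SPI (\<lambda>\<omega>. xconj (f \<omega>))"
proof -
  obtain A where A: "bounding_sequence M E f A" using bounding_sequence_exists[OF f] by blast
  then have A': "exhausting A" "\<And>j. bdd_on f (A j)" unfolding bounding_sequence_iff by auto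
  have A2: "bounding_sequence M E (\<lambda>\<omega>. xconj (f \<omega>)) A"
    using A' bdd_on_intros(1) unfolding bounding_sequence_iff by blast
  have "(y, z) \<in> op_adjoint (SPI f) \<longleftrightarrow> (\<forall>j. E (A j) z = trunc (\<lambda>\<omega>. xconj (f \<omega>)) (A j) y)" for y z
  proof
    assume "(y, z) \<in> op_adjoint (SPI f)"
    then have *: "w \<bullet> y = x \<bullet> z" if "(x, w) \<in> SPI f" for x w
      using that unfolding op_adjoint_def by (fastforce simp flip: cRe_cinner)
    show "\<forall>j. E (A j) z = trunc (\<lambda>\<omega>. xconj (f \<omega>)) (A j) y"
    proof
      fix j
      have "x \<bullet> E (A j) z = x \<bullet> trunc (\<lambda>\<omega>. xconj (f \<omega>)) (A j) y" for x
        using *[OF SPI_core[OF f A'(2)], of j x]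
        by (simp add: trunc_inner[OF f A'(2)] E_inner[OF exhausting_sets[OF A'(1)]])
      then show "E (A j) z = trunc (\<lambda>\<omega>. xconj (f \<omega>)) (A j) y"
        by (metis inner_commute vector_eq_rdot)
    qed
  next
    assume *: "\<forall>j. E (A j) z = trunc (\<lambda>\<omega>. xconj (f \<omega>)) (A j) y"
    have in_eq: "w \<bullet> y = x \<bullet> z" if xw: "(x, w) \<in> SPI f" for x w
    proof -
      have "E (A j) w \<bullet> y = x \<bullet> E (A j) z" for j
        using xw * by (simp add: mem_SPI[OF f A] trunc_inner[OF f A'(2)])
      moreover have "(\<lambda>j. E (A j) w \<bullet> y) \<longlonglongrightarrow> w \<bullet> y" "(\<lambda>j. x \<bullet> E (A j) z) \<longlonglongrightarrow> x \<bullet> z"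
        by (intro tendsto_inner exhausting_tendsto[OF A'(1)] tendsto_const)+
      ultimately show ?thesis by (auto intro: LIMSEQ_unique)
    qed
    have "cinner w y = cinner x z" if xw: "(x, w) \<in> SPI f" for x w
    proof (rule cinner_eqI)
      fix a
      have "(x \<odot> a, w \<odot> a) \<in> SPI f" using right_linear_SPI[OF f] xw unfolding right_linear_def by blast
      then show "(w \<odot> a) \<bullet> y = (x \<odot> a) \<bullet> z" by (rule in_eq)
    qed
    then show "(y, z) \<in> op_adjoint (SPI f)" unfolding op_adjoint_def by blast
  qed
  then show ?thesis using mem_SPI[OF aefin_xconj[OF f] A2] by auto
qed

text \<open>Once \<open>y\<close> is the value of the inner factor at \<open>x\<close>, both
  memberships say that \<open>E (A j) z\<close> is the same truncated product. Item (v), half of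
  (ii) and normality all rest on this.\<close>

lemma SPI_comp_iff:
  assumes f: "aefin f" and g: "aefin g" and xy: "(x, y) \<in> SPI g"
  shows "(y, z) \<in> SPI f \<longleftrightarrow> (x, z) \<in> SPI (\<lambda>\<omega>. xmult (f \<omega>) (g \<omega>))"
proof -
  obtain A where A: "bounding_sequence M E f A" "bounding_sequence M E g A"
    using bounding_sequence_common[OF f g] by blast
  then have A': "\<And>j. bdd_on f (A j)" "\<And>j. bdd_on g (A j)" unfolding bounding_sequence_iff by auto
  have A2: "bounding_sequence M E (\<lambda>\<omega>. xmult (f \<omega>) (g \<omega>)) A"
    using A bdd_on_xmult[OF f _ g] unfolding bounding_sequence_iff by blast
  have "trunc f (A j) y = trunc (\<lambda>\<omega>. xmult (f \<omega>) (g \<omega>)) (A j) x" for j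
    using xy trunc_E_self(2)[OF f A'(1), of j y]
    by (simp add: mem_SPI[OF g A(2)] trunc_xmult[OF f A'(1) g A'(2)])
  then show ?thesis by (simp add: mem_SPI[OF f A(1)] mem_SPI[OF aefin_xmult[OF f g] A2])
qed

lemma SPI_cong:
  assumes f: "aefin f" and g: "aefin g" and eq: "\<And>\<omega>. \<omega> \<in> space M \<Longrightarrow> f \<omega> = g \<omega>"
  shows "SPI f = SPI g"
proof -
  obtain A where A: "bounding_sequence M E f A" "bounding_sequence M E g A"
    using bounding_sequence_common[OF f g] by blast
  have "trunc f (A j) = trunc g (A j)" for j
    unfolding trunc_def by (rule BI_cong) (simp add: eq)
  then show ?thesis using mem_SPI[OF f A(1)] mem_SPI[OF g A(2)] by auto
qed

lemma Domain_comp_SPI: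
  assumes f: "aefin f" and g: "aefin g"
  shows "Domain (op_comp (SPI f) (SPI g)) = Domain (SPI (\<lambda>\<omega>. xmult (f \<omega>) (g \<omega>))) \<inter> Domain (SPI g)"
  unfolding op_comp_def using SPI_comp_iff[OF f g] by blast

text \<open>The product can fall short of the integral of \<open>xmult\<close> only because
  \<open>x\<close> may lie outside the domain of \<open>SPI g\<close>. Projecting by
  \<open>E (A j)\<close> repairs this, and the projected points of the graph converge.\<close>

lemma closure_comp_SPI:
  assumes f: "aefin f" and g: "aefin g"
  shows "SPI (\<lambda>\<omega>. xmult (f \<omega>) (g \<omega>)) = closure (op_comp (SPI f) (SPI g))"
proof
  let ?h = "\<lambda>\<omega>. xmult (f \<omega>) (g \<omega>)"
  have "op_comp (SPI f) (SPI g) \<subseteq> SPI ?h"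
    unfolding op_comp_def using SPI_comp_iff[OF f g] by blast
  then show "closure (op_comp (SPI f) (SPI g)) \<subseteq> SPI ?h"
    by (rule closure_minimal) (rule closed_SPI[OF aefin_xmult[OF f g]])
  obtain A where A: "bounding_sequence M E f A" "bounding_sequence M E g A"
    using bounding_sequence_common[OF f g] by blast
  then have A': "exhausting A" "\<And>j. bdd_on f (A j)" "\<And>j. bdd_on g (A j)" unfolding bounding_sequence_iff by auto
  show "SPI ?h \<subseteq> closure (op_comp (SPI f) (SPI g))"
  proof safe
    fix x z assume xz: "(x, z) \<in> SPI ?h"
    have "(E (A j) x, E (A j) z) \<in> op_comp (SPI f) (SPI g)" for j
    proof -
      have h: "bdd_on ?h (A j)" by (rule bdd_on_xmult[OF f A'(2) g A'(3)])
      have "(E (A j) x, E (A j) z) \<in> SPI ?h"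
        using SPI_core[OF aefin_xmult[OF f g] h, of x] SPI_E[OF aefin_xmult[OF f g] h xz] by simp
      moreover have "(E (A j) x, trunc g (A j) x) \<in> SPI g" by (rule SPI_core[OF g A'(3)])
      ultimately show ?thesis unfolding op_comp_def using SPI_comp_iff[OF f g] by blast
    qed
    moreover have "(\<lambda>j. (E (A j) x, E (A j) z)) \<longlonglongrightarrow> (x, z)"
      by (intro tendsto_Pair exhausting_tendsto[OF A'(1)])
    ultimately show "(x, z) \<in> closure (op_comp (SPI f) (SPI g))"
      unfolding closure_sequential by (intro exI[of _ "\<lambda>j. (E (A j) x, E (A j) z)"]) blast
  qed
qed

lemma closure_plus_SPI:
  assumes f: "aefin f" and g: "aefin g" and c: "c \<in> cplane \<II>"
  shows "SPI (\<lambda>\<omega>. xplus (xmult (f \<omega>) (Some c)) (g \<omega>)) =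
    closure (op_plus (op_comp (SPI f) (gr (cmplx c))) (SPI g))"
proof
  let ?fc = "\<lambda>\<omega>. xmult (f \<omega>) (Some c)" and ?h = "\<lambda>\<omega>. xplus (xmult (f \<omega>) (Some c)) (g \<omega>)"
  note fc = aefin_xmult[OF f aefin_const[OF c]]
  note h = aefin_xplus[OF fc g]
  obtain A where A: "bounding_sequence M E f A" "bounding_sequence M E g A"
    using bounding_sequence_common[OF f g] by blast
  then have A': "exhausting A" "\<And>j. bdd_on f (A j)" "\<And>j. bdd_on g (A j)" unfolding bounding_sequence_iff by auto
  note cA = bdd_on_intros(2)[OF exhausting_sets[OF A'(1)], of c]
  note Afc = bdd_on_xmult[OF f A'(2) aefin_const[OF c] cA]
  note Ah = bdd_on_xplus[OF Afc A'(3)]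
  have A2: "bounding_sequence M E ?h A" using A'(1) Ah unfolding bounding_sequence_iff by blast
  have trunc_h: "trunc ?h (A j) x = trunc f (A j) (cmplx c x) + trunc g (A j) x" for j x
    unfolding trunc_xplus[OF fc Afc g A'(3)] trunc_xmult[OF f A'(2) aefin_const[OF c] cA]
      trunc_const[OF c exhausting_sets[OF A'(1)]] trunc_E_self(2)[OF f A'(2)] ..
  have "op_plus (op_comp (SPI f) (gr (cmplx c))) (SPI g) \<subseteq> SPI ?h"
    unfolding op_plus_def op_comp_def gr_def
    by (auto simp: mem_SPI[OF f A(1)] mem_SPI[OF g A(2)] mem_SPI[OF h A2] trunc_h blinfun.bilinear_simps)
  then show "closure (op_plus (op_comp (SPI f) (gr (cmplx c))) (SPI g)) \<subseteq> SPI ?h"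
    by (rule closure_minimal) (rule closed_SPI[OF h])
  show "SPI ?h \<subseteq> closure (op_plus (op_comp (SPI f) (gr (cmplx c))) (SPI g))"
  proof safe
    fix x z assume xz: "(x, z) \<in> SPI ?h"
    have "(E (A j) x, E (A j) z) \<in> op_plus (op_comp (SPI f) (gr (cmplx c))) (SPI g)" for j
    proof -
      have "(cmplx c (E (A j) x), trunc f (A j) (cmplx c x)) \<in> SPI f"
        using SPI_core[OF f A'(2), of j "cmplx c x"] exhausting_sets[OF A'(1)] by (simp add: E_cmplx)
      moreover have "(E (A j) x, trunc g (A j) x) \<in> SPI g" by (rule SPI_core[OF g A'(3)])
      moreover have "E (A j) z = trunc f (A j) (cmplx c x) + trunc g (A j) x"
        using xz by (simp add: mem_SPI[OF h A2] trunc_h)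
      ultimately show ?thesis unfolding op_plus_def op_comp_def gr_def by auto
    qed
    moreover have "(\<lambda>j. (E (A j) x, E (A j) z)) \<longlonglongrightarrow> (x, z)"
      by (intro tendsto_Pair exhausting_tendsto[OF A'(1)])
    ultimately show "(x, z) \<in> closure (op_plus (op_comp (SPI f) (gr (cmplx c))) (SPI g))"
      unfolding closure_sequential by (intro exI[of _ "\<lambda>j. (E (A j) x, E (A j) z)"]) blast
  qed
qed

text \<open>A function and its conjugate have the same modulus, hence integrals with the same
  domain, and their pointwise products in either order coincide.\<close>

lemma SPI_comp_adjoint_subset:
  assumes f: "aefin f"
  shows "op_comp (SPI f) (SPI (\<lambda>\<omega>. xconj (f \<omega>))) \<subseteq> op_comp (SPI (\<lambda>\<omega>. xconj (f \<omega>))) (SPI f)"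
proof safe
  let ?g = "\<lambda>\<omega>. xconj (f \<omega>)"
  note g = aefin_xconj[OF f]
  fix x z assume "(x, z) \<in> op_comp (SPI f) (SPI ?g)"
  then obtain y where y: "(x, y) \<in> SPI ?g" "(y, z) \<in> SPI f" unfolding op_comp_def by blast
  have "x \<in> Domain (SPI ?g)" using y(1) by blast
  then have "x \<in> Domain (SPI f)" by (simp add: Domain_SPI f g)
  then obtain y' where y': "(x, y') \<in> SPI f" by blast
  have "SPI (\<lambda>\<omega>. xmult (f \<omega>) (?g \<omega>)) = SPI (\<lambda>\<omega>. xmult (?g \<omega>) (f \<omega>))"
  proof (rule SPI_cong[OF aefin_xmult[OF f g] aefin_xmult[OF g f]])
    fix \<omega> assume w: "\<omega> \<in> space M"
    show "xmult (f \<omega>) (?g \<omega>) = xmult (?g \<omega>) (f \<omega>)"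
      using aefinD(2)[OF f w] cplane_arith(5)[OF \<II>]
      by (cases "f \<omega>") (auto simp: xmult_def xconj_def)
  qed
  then have "(x, z) \<in> SPI (\<lambda>\<omega>. xmult (?g \<omega>) (f \<omega>))"
    using SPI_comp_iff[OF f g y(1)] y(2) by simp
  then show "(x, z) \<in> op_comp (SPI ?g) (SPI f)"
    using SPI_comp_iff[OF g f y'] y' unfolding op_comp_def by blast
qed

lemma normal_SPI:
  assumes f: "aefin f"
  shows "normal_op (SPI f)"
proof -
  have "Domain (SPI f) = Domain (SPI (\<lambda>\<omega>. xconj (f \<omega>)))"
    unfolding set_eq_iff Domain_SPI[OF f] Domain_SPI[OF aefin_xconj[OF f]] by simp
  moreover have "op_comp (SPI f) (SPI (\<lambda>\<omega>. xconj (f \<omega>))) = op_comp (SPI (\<lambda>\<omega>. xconj (f \<omega>))) (SPI f)"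
    using SPI_comp_adjoint_subset[OF f] SPI_comp_adjoint_subset[OF aefin_xconj[OF f]] by auto
  ultimately show ?thesis
    unfolding normal_op_def op_adjoint_SPI[OF f] using densely_defined_SPI[OF f] closed_SPI[OF f] by blast
qed

text \<open>On sets where both \<open>f\<close> and its inverse are bounded, the two truncations are
  mutually inverse on the range of \<open>E (A j)\<close>, so the two systems of graph equations are
  equivalent.\<close>

lemma converse_SPI:
  assumes f: "aefin f" and nz: "E {\<omega>\<in>space M. f \<omega> = Some 0} = 0"
  shows "converse (SPI f) = SPI (\<lambda>\<omega>. xinverse (f \<omega>))"
proof -
  let ?g = "\<lambda>\<omega>. xinverse (f \<omega>)"
  note g = aefin_xinverse[OF f nz]
  obtain A where A: "bounding_sequence M E f A" "bounding_sequence M E ?g A"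
    using bounding_sequence_common[OF f g] by blast
  then have A': "exhausting A" "\<And>j. bdd_on f (A j)" "\<And>j. bdd_on ?g (A j)" unfolding bounding_sequence_iff by auto
  have one: "trunc h (A j) x = E (A j) x"
    if "\<And>\<omega>. \<omega> \<in> A j \<Longrightarrow> finite_part (h \<omega>) = ebasis {}" for h j x
  proof -
    have "trunc h (A j) = BI (\<lambda>\<omega>. if \<omega> \<in> A j then ebasis {} else 0)"
      unfolding trunc_def using that by (intro BI_cong) auto
    then show ?thesis by (simp add: BI_indicator exhausting_sets[OF A'(1)])
  qed
  have inv: "finite_part (f \<omega>) \<odot> finite_part (?g \<omega>) = ebasis {}" "finite_part (?g \<omega>) \<odot> finite_part (f \<omega>) = ebasis {}"
    if w: "\<omega> \<in> A j" for \<omega> j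
  proof -
    have ws: "\<omega> \<in> space M" using w exhausting_sets[OF A'(1), of j] sets.sets_into_space by blast
    \<comment> \<open>Boundedness of the inverse on \<open>A j\<close> includes its finiteness and
      thereby excludes the zeros of \<open>f\<close>.\<close>
    have "f \<omega> \<noteq> None" "f \<omega> \<noteq> Some 0" using A'(2)[of j] A'(3)[of j] w unfolding bdd_on_def by auto
    then have nz: "finite_part (f \<omega>) \<noteq> 0" by (cases "f \<omega>") auto
    then show 1: "finite_part (f \<omega>) \<odot> finite_part (?g \<omega>) = ebasis {}"
      using cplane_arith(6)[OF \<II> aefinD(2)[OF f ws] aefinD(2)[OF f ws]] by (simp add: cmult_scaleR_right)
    show "finite_part (?g \<omega>) \<odot> finite_part (f \<omega>) = ebasis {}"
      using 1 cplane_arith(5)[OF \<II> aefinD(2)[OF f ws] aefinD(2)[OF g ws]] by simp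
  qed
  have fg: "trunc f (A j) (trunc ?g (A j) x) = E (A j) x" and gf: "trunc ?g (A j) (trunc f (A j) x) = E (A j) x" for j x
    using one[of j "\<lambda>\<omega>. xmult (f \<omega>) (?g \<omega>)" x] one[of j "\<lambda>\<omega>. xmult (?g \<omega>) (f \<omega>)" x] inv[of _ j]
    by (simp_all only: trunc_xmult[OF f A'(2) g A'(3)] trunc_xmult[OF g A'(3) f A'(2)] finite_part_simps(4))
  have "E (A j) y = trunc f (A j) x \<longleftrightarrow> E (A j) x = trunc ?g (A j) y" for x y j
    using gf[of j x] fg[of j y] trunc_E_self[OF f A'(2), of j] trunc_E_self[OF g A'(3), of j] by metis
  then show ?thesis by (auto simp: mem_SPI[OF f A(1)] mem_SPI[OF g A(2)])
qed

text \<open>The range of the projection on the zero set of \<open>f\<close> is annihilated by the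
  integral, so a single valued inverse forces that projection to vanish.\<close>

lemma right_linear_converse_SPI:
  assumes f: "aefin f"
  shows "right_linear (converse (SPI f)) \<longleftrightarrow> E {\<omega>\<in>space M. f \<omega> = Some 0} = 0"
proof
  assume "E {\<omega>\<in>space M. f \<omega> = Some 0} = 0"
  then show "right_linear (converse (SPI f))"
    using right_linear_SPI[OF aefin_xinverse[OF f]] by (simp add: converse_SPI[OF f])
next
  let ?Z = "{\<omega>\<in>space M. f \<omega> = Some 0}"
  assume "right_linear (converse (SPI f))"
  then have sv: "single_valued (converse (SPI f))" "(0, 0) \<in> SPI f" unfolding right_linear_def by auto
  have Z: "bdd_on f ?Z" unfolding bdd_on_def using aefin_zero_set[OF f] by auto
  have "trunc f ?Z = BI (\<lambda>_. 0)" unfolding trunc_def by (rule BI_cong) auto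
  then have "(E ?Z x, 0) \<in> SPI f" for x using SPI_core[OF f Z, of x] by simp
  then have "E ?Z x = 0" for x using sv unfolding single_valued_def by blast
  then show "E ?Z = 0" by (intro blinfun_eqI) simp
qed


section \<open>Compatibility with \<open>J\<close>\<close>

lemma cmplx_unit: "cmplx \<II> = J"
  by (rule blinfun_eqI) (simp add: cmplx_apply sphere_orthonormal[OF \<II>] cIm_sphere \<II>)

lemma unit_cplane [simp]: "\<II> \<in> cplane \<II>"
  by (simp add: cplane_iff[OF \<II>] \<II> sphere_orthonormal(1)[OF \<II>])

lemma BI_J:
  assumes f: "bcfun f"
  shows "BI (\<lambda>\<omega>. \<II> \<odot> f \<omega>) x = J (BI f x)" "BI f (J x) = J (BI f x)"
proof -
  have 1: "BI (\<lambda>\<omega>. \<II> \<odot> f \<omega>) = J o\<^sub>L BI f"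
    using BI_mult[OF bcfun_const[OF unit_cplane] f] by (simp add: BI_const cmplx_unit)
  then show "BI (\<lambda>\<omega>. \<II> \<odot> f \<omega>) x = J (BI f x)" by simp
  have "BI (\<lambda>\<omega>. \<II> \<odot> f \<omega>) = BI (\<lambda>\<omega>. f \<omega> \<odot> \<II>)"
    using bcfunD(2)[OF f] by (intro BI_cong) (simp add: cplane_arith(5)[OF \<II> unit_cplane])
  also have "\<dots> = BI f o\<^sub>L J"
    using BI_mult[OF f bcfun_const[OF unit_cplane]] by (simp add: BI_const cmplx_unit)
  finally show "BI f (J x) = J (BI f x)"
    unfolding 1 by (metis blinfun_apply_blinfun_compose)
qed

lemma trunc_J: "aefin f \<Longrightarrow> bdd_on f A \<Longrightarrow> trunc f A (J x) = J (trunc f A x)"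
  unfolding trunc_def by (rule BI_J(2)) (rule bcfun_trunc)

lemma BI_cinner:
  assumes f: "bcfun f"
  shows "cinner (BI f x) y = cinner x (BI (\<lambda>\<omega>. cconj (f \<omega>)) y)"
  by (rule cinner_eqI) (simp add: BI_inner[OF f] flip: BI_cmult[OF f])

lemma SPI_closed_under:
  assumes f: "aefin f" and xu: "(x, u) \<in> SPI f"
  shows "(y, v) \<in> SPI f \<Longrightarrow> (x + y, u + v) \<in> SPI f" "(r *\<^sub>R x, r *\<^sub>R u) \<in> SPI f"
    "(J x, J u) \<in> SPI f" "(x \<odot> a, u \<odot> a) \<in> SPI f"
proof -
  obtain A where A: "bounding_sequence M E f A" using bounding_sequence_exists[OF f] by blast
  then have A': "exhausting A" "\<And>j. bdd_on f (A j)" unfolding bounding_sequence_iff by auto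
  show "(y, v) \<in> SPI f \<Longrightarrow> (x + y, u + v) \<in> SPI f" "(r *\<^sub>R x, r *\<^sub>R u) \<in> SPI f"
    "(J x, J u) \<in> SPI f" "(x \<odot> a, u \<odot> a) \<in> SPI f"
    using xu exhausting_sets[OF A'(1)]
    by (simp_all add: mem_SPI[OF f A] blinfun.bilinear_simps E_J E_cmult trunc_J[OF f A'(2)] trunc_cmult[OF f A'(2)])
qed

section \<open>Integrals of real functions\<close>

abbreviation re_fun :: "('a \<Rightarrow> real) \<Rightarrow> 'a \<Rightarrow> 'n xclifford" where
  "re_fun h \<equiv> \<lambda>\<omega>. Some (h \<omega> *\<^sub>R ebasis {})"

lemma aefin_re: "h \<in> borel_measurable M \<Longrightarrow> aefin (re_fun h)"
  unfolding aefin_def by auto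

lemma norm_ebasis_empty [simp]: "norm (ebasis {} :: 'n clifford) = 1"
  by (simp add: norm_eq_sqrt_inner)

text \<open>The domain controls the square of \<open>h\<close> for \<open>pmeas x x\<close>, but
  here \<open>h\<close> is integrated against \<open>pmeas x y\<close>. The integral of
  \<open>\<bar>h\<bar>\<close> over \<open>A j\<close> is an inner product with \<open>y\<close>, so
  Cauchy-Schwarz bounds it by \<open>norm u * norm y\<close>, uniformly in \<open>j\<close>.\<close>

lemma integral_SPI_re:
  assumes h: "h \<in> borel_measurable M" and xu: "(x, u) \<in> SPI (re_fun h)"
    and pos: "\<And>A. A \<in> sets M \<Longrightarrow> E A x \<bullet> y \<ge> 0"
  shows "integrable (pmeas x y) h" "(\<integral>\<omega>. h \<omega> \<partial>pmeas x y) = u \<bullet> y"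
proof -
  interpret finite_measure "pmeas x y" using pos by (rule finite_measure_pmeas)
  define A where "A j = {\<omega>\<in>space M. \<bar>h \<omega>\<bar> \<le> real j}" for j
  have As: "A j \<in> sets M" for j unfolding A_def using h by measurable
  have inc: "incseq A" unfolding incseq_def A_def by (auto intro: order_trans)
  have U: "(\<Union>j. A j) = space M" unfolding A_def using real_arch_simple by blast
  have A: "bounding_sequence M E (re_fun h) A"
    unfolding bounding_sequence_iff exhausting_def bdd_on_def using As inc U by (auto simp: A_def)
  have A': "exhausting A" "\<And>j. bdd_on (re_fun h) (A j)" using A unfolding bounding_sequence_iff by auto
  let ?h = "\<lambda>j \<omega>. if \<omega> \<in> A j then h \<omega> else 0"
  have hm: "?h j \<in> borel_measurable M" for j
    using h As by (intro measurable_If_set) (auto simp: sets.Int_space_eq2)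
  have hb: "bounded (?h j ` space M)" for j
    unfolding bounded_iff A_def by (auto intro!: exI[of _ "real j"])
  have ahb: "bounded ((\<lambda>\<omega>. \<bar>?h j \<omega>\<bar>) ` space M)" for j
    unfolding bounded_iff A_def by (auto intro!: exI[of _ "real j"])
  have trunc: "trunc (re_fun h) (A j) = BI (\<lambda>\<omega>. ?h j \<omega> *\<^sub>R ebasis {})" for j
    unfolding trunc_def by (rule BI_cong) auto
  have le: "(\<integral>\<omega>. \<bar>?h j \<omega>\<bar> \<partial>pmeas x y) \<le> norm u * norm y" for j
  proof -
    have "(\<integral>\<omega>. \<bar>?h j \<omega>\<bar> \<partial>pmeas x y) = BI (\<lambda>\<omega>. \<bar>?h j \<omega>\<bar> *\<^sub>R ebasis {}) x \<bullet> y"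
      using hm ahb pos by (intro integral_pmeas) auto
    also have "\<dots> \<le> norm (BI (\<lambda>\<omega>. \<bar>?h j \<omega>\<bar> *\<^sub>R ebasis {}) x) * norm y"
      by (rule norm_cauchy_schwarz)
    \<comment> \<open>A function and its absolute value have integrals of the same norm at
      \<open>x\<close>, by \<open>BI_norm_sq\<close>; for \<open>h\<close> cut off at
      \<open>A j\<close> this integral is \<open>E (A j) u\<close>.\<close>
    also have "(norm (BI (\<lambda>\<omega>. \<bar>?h j \<omega>\<bar> *\<^sub>R ebasis {}) x))\<^sup>2 = (norm (BI (\<lambda>\<omega>. ?h j \<omega> *\<^sub>R ebasis {}) x))\<^sup>2"
      using hm[of j] hb[of j] ahb[of j] by (simp add: BI_norm_sq bcfun_real)
    then have "norm (BI (\<lambda>\<omega>. \<bar>?h j \<omega>\<bar> *\<^sub>R ebasis {}) x) = norm (E (A j) u)"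
      using xu by (simp add: mem_SPI[OF aefin_re[OF h] A] trunc power2_eq_iff_nonneg)
    also have "\<dots> \<le> norm u" by (rule norm_E_le[OF As])
    finally show ?thesis by (simp add: mult_right_mono)
  qed
  have int_b: "integrable (pmeas x y) (?h j)" for j
    using hm[of j] by (intro integrable_const_bound[where B = "real j"]) (auto simp: A_def)
  have "(\<integral>\<^sup>+\<omega>. ennreal \<bar>h \<omega>\<bar> \<partial>pmeas x y) = (\<integral>\<^sup>+\<omega>. (SUP j. ennreal \<bar>?h j \<omega>\<bar>) \<partial>pmeas x y)"
  proof (rule nn_integral_cong)
    fix \<omega> assume "\<omega> \<in> space (pmeas x y)"
    then obtain i where i: "\<omega> \<in> A i" using U by auto
    show "ennreal \<bar>h \<omega>\<bar> = (SUP j. ennreal \<bar>?h j \<omega>\<bar>)"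
    proof (rule antisym)
      show "ennreal \<bar>h \<omega>\<bar> \<le> (SUP j. ennreal \<bar>?h j \<omega>\<bar>)" by (rule SUP_upper2[of i]) (simp_all add: i)
      show "(SUP j. ennreal \<bar>?h j \<omega>\<bar>) \<le> ennreal \<bar>h \<omega>\<bar>" by (rule SUP_least) simp
    qed
  qed
  also have "\<dots> = (SUP j. \<integral>\<^sup>+\<omega>. ennreal \<bar>?h j \<omega>\<bar> \<partial>pmeas x y)"
  proof (rule nn_integral_monotone_convergence_SUP)
    show "incseq (\<lambda>j \<omega>. ennreal \<bar>?h j \<omega>\<bar>)"
      using inc unfolding incseq_def le_fun_def by (auto simp: subset_iff)
    show "(\<lambda>\<omega>. ennreal \<bar>?h j \<omega>\<bar>) \<in> borel_measurable (pmeas x y)" for j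
      using hm[of j] by simp
  qed
  also have "\<dots> \<le> ennreal (norm u * norm y)"
  proof (rule SUP_least)
    fix j
    have "(\<integral>\<^sup>+\<omega>. ennreal \<bar>?h j \<omega>\<bar> \<partial>pmeas x y) = ennreal (\<integral>\<omega>. \<bar>?h j \<omega>\<bar> \<partial>pmeas x y)"
      using int_b[of j] by (intro nn_integral_eq_integral) auto
    then show "(\<integral>\<^sup>+\<omega>. ennreal \<bar>?h j \<omega>\<bar> \<partial>pmeas x y) \<le> ennreal (norm u * norm y)"
      using le[of j] by (simp add: ennreal_leI)
  qed
  also have "\<dots> < \<infinity>" by simp
  finally show int: "integrable (pmeas x y) h"
    using h by (intro integrableI_bounded) auto
  have "(\<lambda>j. \<integral>\<omega>. ?h j \<omega> \<partial>pmeas x y) \<longlonglongrightarrow> (\<integral>\<omega>. h \<omega> \<partial>pmeas x y)"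
  proof (rule integral_dominated_convergence[where w = "\<lambda>\<omega>. \<bar>h \<omega>\<bar>"])
    show "AE \<omega> in pmeas x y. (\<lambda>j. ?h j \<omega>) \<longlonglongrightarrow> h \<omega>"
    proof (rule AE_I2)
      fix \<omega> assume "\<omega> \<in> space (pmeas x y)"
      then obtain i where "\<omega> \<in> A i" using U by auto
      then have "\<forall>\<^sub>F j in sequentially. ?h j \<omega> = h \<omega>"
        using inc unfolding eventually_sequentially incseq_def by (auto intro!: exI[of _ i])
      then show "(\<lambda>j. ?h j \<omega>) \<longlonglongrightarrow> h \<omega>" by (rule tendsto_eventually)
    qed
  qed (use h hm int in auto)
  moreover have "(\<integral>\<omega>. ?h j \<omega> \<partial>pmeas x y) = E (A j) u \<bullet> y" for j
    using xu integral_pmeas[OF pos hm[of j] hb[of j]] by (simp add: mem_SPI[OF aefin_re[OF h] A] trunc)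
  moreover have "(\<lambda>j. E (A j) u \<bullet> y) \<longlonglongrightarrow> u \<bullet> y"
    by (intro tendsto_inner exhausting_tendsto[OF A'(1)] tendsto_const)
  ultimately show "(\<integral>\<omega>. h \<omega> \<partial>pmeas x y) = u \<bullet> y" by (auto intro: LIMSEQ_unique)
qed

text \<open>By polarization \<open>4 * (E A x \<bullet> y)\<close> is a difference of two finite
  positive measures, those of \<open>x + y\<close> and \<open>x - y\<close>, for which a Hahn set is
  available.\<close>

lemma Hahn_decomposition:
  "\<exists>Y\<in>sets M. (\<forall>A\<in>sets M. A \<subseteq> Y \<longrightarrow> E A x \<bullet> y \<ge> 0) \<and> (\<forall>A\<in>sets M. A \<inter> Y = {} \<longrightarrow> E A x \<bullet> y \<le> 0)"
proof -
  have polar: "E A (x + y) \<bullet> (x + y) - E A (x - y) \<bullet> (x - y) = 4 * (E A x \<bullet> y)" if "A \<in> sets M" for A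
    using E_inner[OF that, of y x]
    by (simp add: blinfun.bilinear_simps inner_add_left inner_add_right inner_diff_left inner_diff_right inner_commute)
  obtain Y where Y: "Y \<in> sets M"
    "\<And>A. A \<in> sets M \<Longrightarrow> A \<subseteq> Y \<Longrightarrow> emeasure (pmeas (x - y) (x - y)) A \<le> emeasure (pmeas (x + y) (x + y)) A"
    "\<And>A. A \<in> sets M \<Longrightarrow> A \<inter> Y = {} \<Longrightarrow> emeasure (pmeas (x + y) (x + y)) A \<le> emeasure (pmeas (x - y) (x - y)) A"
    using finite_unsigned_Hahn_decomposition[of "pmeas (x + y) (x + y)" "pmeas (x - y) (x - y)"]
      finite_measure_pmeas[OF pmeas_self_nonneg] by auto
  have "E A x \<bullet> y \<ge> 0" if "A \<in> sets M" "A \<subseteq> Y" for A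
    using Y(2)[OF that] polar[OF that(1)] that(1) by (simp add: emeasure_pmeas pmeas_self_nonneg)
  moreover have "E A x \<bullet> y \<le> 0" if "A \<in> sets M" "A \<inter> Y = {}" for A
    using Y(3)[OF that] polar[OF that(1)] that(1) by (simp add: emeasure_pmeas pmeas_self_nonneg)
  ultimately show ?thesis using Y(1) by blast
qed

text \<open>The supremum over subsets of \<open>A\<close> is attained at
  \<open>A \<inter> Y\<close>. The projection \<open>E Y\<close> can then be moved to
  \<open>y\<close>, so the variation is again a measure to which \<open>integral_SPI_re\<close>
  applies.\<close>

lemma positive_variation_pmeas:
  assumes Y: "Y \<in> sets M" and pos: "\<forall>A\<in>sets M. A \<subseteq> Y \<longrightarrow> E A x \<bullet> y \<ge> 0"
    and neg: "\<forall>A\<in>sets M. A \<inter> Y = {} \<longrightarrow> E A x \<bullet> y \<le> 0"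
  shows "positive_variation M (\<lambda>A. E A x \<bullet> y) = pmeas x (E Y y)"
    "A \<in> sets M \<Longrightarrow> E A x \<bullet> E Y y \<ge> 0"
proof -
  have eq: "E A x \<bullet> E Y y = E (A \<inter> Y) x \<bullet> y" if "A \<in> sets M" for A
    using E_inner[OF Y, of "E A x" y] E_Int[OF Y that, of x] by (simp add: Int_commute)
  then show "A \<in> sets M \<Longrightarrow> E A x \<bullet> E Y y \<ge> 0" using pos Y by auto
  show "positive_variation M (\<lambda>A. E A x \<bullet> y) = pmeas x (E Y y)"
    unfolding positive_variation_def pmeas_def
  proof (rule measure_of_eq[OF sets.space_closed])
    fix A assume "A \<in> sigma_sets (space M) (sets M)"
    then have A: "A \<in> sets M" by (simp add: sets.sigma_sets_eq)
    have "(SUP B\<in>{B \<in> sets M. B \<subseteq> A}. ennreal (E B x \<bullet> y)) = ennreal (E (A \<inter> Y) x \<bullet> y)"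
    proof (rule antisym)
      show "(SUP B\<in>{B \<in> sets M. B \<subseteq> A}. ennreal (E B x \<bullet> y)) \<le> ennreal (E (A \<inter> Y) x \<bullet> y)"
      proof (rule SUP_least, rule ennreal_leI)
        fix B assume "B \<in> {B \<in> sets M. B \<subseteq> A}"
        then have B: "B \<in> sets M" "B \<subseteq> A" by auto
        have "E ((B \<inter> Y) \<union> (B - Y)) x = E (B \<inter> Y) x + E (B - Y) x"
          using B Y by (intro E_Un) auto
        moreover have "(B \<inter> Y) \<union> (B - Y) = B" by auto
        ultimately have "E B x \<bullet> y = E (B \<inter> Y) x \<bullet> y + E (B - Y) x \<bullet> y"
          by (simp only: inner_add_left)
        moreover have "E (B - Y) x \<bullet> y \<le> 0" using B Y neg by auto
        moreover have "E ((B \<inter> Y) \<union> (A - B) \<inter> Y) x = E (B \<inter> Y) x + E ((A - B) \<inter> Y) x"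
          using A B Y by (intro E_Un) auto
        moreover have "(B \<inter> Y) \<union> (A - B) \<inter> Y = A \<inter> Y" using B(2) by auto
        moreover have "E ((A - B) \<inter> Y) x \<bullet> y \<ge> 0" using A B Y pos by auto
        ultimately show "E B x \<bullet> y \<le> E (A \<inter> Y) x \<bullet> y" by (simp add: inner_add_left)
      qed
      show "ennreal (E (A \<inter> Y) x \<bullet> y) \<le> (SUP B\<in>{B \<in> sets M. B \<subseteq> A}. ennreal (E B x \<bullet> y))"
        using A Y by (intro SUP_upper) auto
    qed
    then show "(SUP B\<in>{B \<in> sets M. B \<subseteq> A}. ennreal (E B x \<bullet> y)) = ennreal (E A x \<bullet> E Y y)"
      by (simp add: eq[OF A])
  qed
qed

lemma signed_integral_SPI:
  assumes h: "h \<in> borel_measurable M" and xu: "(x, u) \<in> SPI (re_fun h)"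
  shows "signed_integrable M (\<lambda>A. E A x \<bullet> y) h" "signed_integral M (\<lambda>A. E A x \<bullet> y) h = u \<bullet> y"
proof -
  obtain Y where Y: "Y \<in> sets M" "\<forall>A\<in>sets M. A \<subseteq> Y \<longrightarrow> E A x \<bullet> y \<ge> 0"
    "\<forall>A\<in>sets M. A \<inter> Y = {} \<longrightarrow> E A x \<bullet> y \<le> 0"
    using Hahn_decomposition[of x y] by (elim bexE conjE)
  \<comment> \<open>The negative variation is the positive variation for \<open>- y\<close>, with
    the complement of \<open>Y\<close> as its Hahn set.\<close>
  let ?Z = "space M - Y"
  have Z: "?Z \<in> sets M" "\<forall>A\<in>sets M. A \<subseteq> ?Z \<longrightarrow> E A x \<bullet> - y \<ge> 0"
    "\<forall>A\<in>sets M. A \<inter> ?Z = {} \<longrightarrow> E A x \<bullet> - y \<le> 0"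
  proof -
    show "?Z \<in> sets M" using Y(1) by blast
    show "\<forall>A\<in>sets M. A \<subseteq> ?Z \<longrightarrow> E A x \<bullet> - y \<ge> 0" using Y(3) by auto
    have "A \<subseteq> Y" if "A \<in> sets M" "A \<inter> ?Z = {}" for A
      using that sets.sets_into_space[of A M] by auto
    then show "\<forall>A\<in>sets M. A \<inter> ?Z = {} \<longrightarrow> E A x \<bullet> - y \<le> 0" using Y(2) by simp
  qed
  have pv: "positive_variation M (\<lambda>A. E A x \<bullet> y) = pmeas x (E Y y)"
    "positive_variation M (\<lambda>A. - (E A x \<bullet> y)) = pmeas x (E ?Z (- y))"
    by (rule positive_variation_pmeas(1)[OF Y])
      (rule positive_variation_pmeas(1)[OF Z, unfolded inner_minus_right])
  have i1: "integrable (pmeas x (E Y y)) h" "(\<integral>\<omega>. h \<omega> \<partial>pmeas x (E Y y)) = u \<bullet> E Y y"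
    by (rule integral_SPI_re[OF h xu], erule positive_variation_pmeas(2)[OF Y])+
  have i2: "integrable (pmeas x (E ?Z (- y))) h" "(\<integral>\<omega>. h \<omega> \<partial>pmeas x (E ?Z (- y))) = u \<bullet> E ?Z (- y)"
    by (rule integral_SPI_re[OF h xu], erule positive_variation_pmeas(2)[OF Z])+
  show "signed_integrable M (\<lambda>A. E A x \<bullet> y) h"
    unfolding signed_integrable_def pv using i1(1) i2(1) by blast
  have "signed_integral M (\<lambda>A. E A x \<bullet> y) h = u \<bullet> E Y y - u \<bullet> E ?Z (- y)"
    unfolding signed_integral_def pv using i1(2) i2(2) by simp
  also have "\<dots> = u \<bullet> y"
    using Y(1) by (simp add: E_compl blinfun.bilinear_simps inner_diff_right)
  finally show "signed_integral M (\<lambda>A. E A x \<bullet> y) h = u \<bullet> y" .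
qed

lemma real_cintegral_SPI:
  assumes h: "h \<in> borel_measurable M" and xu: "(x, u) \<in> SPI (re_fun h)"
  shows "signed_integrable M (\<lambda>A. cinner (E A x) y $ \<alpha>) h"
    "real_cintegral M (\<lambda>A. cinner (E A x) y) h = cinner u y"
  unfolding real_cintegral_def cinner_component vec_eq_iff
  using signed_integral_SPI[OF h xu] by (simp_all add: cinner_component)

section \<open>Real and imaginary parts of the integrand\<close>

abbreviation "Ref f \<equiv> \<lambda>\<omega>. cRe (finite_part (f \<omega>))"
abbreviation "Imf f \<equiv> \<lambda>\<omega>. cIm \<II> (finite_part (f \<omega>))"

lemma parts_measurable:
  "aefin f \<Longrightarrow> Ref f \<in> borel_measurable M" "aefin f \<Longrightarrow> Imf f \<in> borel_measurable M"
  by (auto intro!: measurable_parts aefinD(1))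

lemma Domain_re:
  assumes f: "aefin f" and h: "h \<in> borel_measurable M" and le: "\<And>\<omega>. \<omega> \<in> space M \<Longrightarrow> \<bar>h \<omega>\<bar> \<le> norm (finite_part (f \<omega>))"
    and x: "x \<in> Domain (SPI f)"
  shows "x \<in> Domain (SPI (re_fun h))"
proof -
  have "(\<integral>\<^sup>+\<omega>. xnorm_sq (re_fun h \<omega>) \<partial>pmeas x x) \<le> (\<integral>\<^sup>+\<omega>. xnorm_sq (f \<omega>) \<partial>pmeas x x)"
  proof (rule nn_integral_mono)
    fix \<omega> assume "\<omega> \<in> space (pmeas x x)"
    then have "\<bar>h \<omega>\<bar> \<le> norm (finite_part (f \<omega>))" using le by simp
    from power_mono[OF this, of 2] show "xnorm_sq (re_fun h \<omega>) \<le> xnorm_sq (f \<omega>)"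
      by (cases "f \<omega>") (auto simp: xnorm_sq_def intro: ennreal_leI)
  qed
  also have "\<dots> < \<infinity>" using x by (simp add: Domain_SPI[OF f])
  finally show ?thesis by (simp add: Domain_SPI[OF aefin_re[OF h]])
qed

lemma bdd_on_parts:
  assumes "aefin f" "bdd_on f A"
  shows "bdd_on (re_fun (Ref f)) A" "bdd_on (re_fun (Imf f)) A"
proof -
  obtain K where A: "A \<in> sets M" and K: "\<And>\<omega>. \<omega> \<in> A \<Longrightarrow> norm (finite_part (f \<omega>)) \<le> K"
    using assms(2) unfolding bdd_on_def by blast
  have "\<bar>Ref f \<omega>\<bar> \<le> K" "\<bar>Imf f \<omega>\<bar> \<le> K" if "\<omega> \<in> A" for \<omega>
    using order_trans[OF abs_cRe_le K[OF that]] order_trans[OF abs_cIm_le K[OF that]] by simp_all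
  then show "bdd_on (re_fun (Ref f)) A" "bdd_on (re_fun (Imf f)) A"
    unfolding bdd_on_def using A by (auto intro!: exI[of _ K])
qed

lemma trunc_parts:
  assumes f: "aefin f" and A: "bdd_on f A"
  shows "trunc f A x = trunc (re_fun (Ref f)) A x + J (trunc (re_fun (Imf f)) A x)"
proof -
  let ?r = "\<lambda>\<omega>. if \<omega> \<in> A then Ref f \<omega> *\<^sub>R ebasis {} else 0"
  let ?i = "\<lambda>\<omega>. if \<omega> \<in> A then Imf f \<omega> *\<^sub>R ebasis {} else 0"
  have b: "bcfun ?r" "bcfun ?i"
    using bcfun_trunc[OF aefin_re[OF parts_measurable(1)[OF f]] bdd_on_parts(1)[OF f A]]
      bcfun_trunc[OF aefin_re[OF parts_measurable(2)[OF f]] bdd_on_parts(2)[OF f A]]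
    by (simp_all cong: if_cong)
  have "trunc f A = BI (\<lambda>\<omega>. ?r \<omega> + \<II> \<odot> ?i \<omega>)"
    unfolding trunc_def
  proof (rule BI_cong)
    fix \<omega> assume "\<omega> \<in> space M"
    then have "finite_part (f \<omega>) = Ref f \<omega> *\<^sub>R ebasis {} + Imf f \<omega> *\<^sub>R \<II>"
      using aefinD(2)[OF f] cplane_iff[OF \<II>] by blast
    then show "(if \<omega> \<in> A then finite_part (f \<omega>) else 0) = ?r \<omega> + \<II> \<odot> ?i \<omega>"
      by (simp add: cmult_scaleR_right)
  qed
  also have "\<dots> = BI ?r + BI (\<lambda>\<omega>. \<II> \<odot> ?i \<omega>)"
    by (intro BI_add b bcfun_mult bcfun_const unit_cplane)
  finally show ?thesis
    unfolding trunc_def by (simp add: blinfun.bilinear_simps BI_J(1)[OF b(2)] cong: if_cong)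
qed

text \<open>Both parts are dominated by the modulus of \<open>f\<close>, so \<open>x\<close> lies in
  the domains of their integrals, and the decomposition is checked on truncations.\<close>

lemma SPI_parts:
  assumes f: "aefin f" and xu: "(x, u) \<in> SPI f"
  obtains a b where "(x, a) \<in> SPI (re_fun (Ref f))" "(x, b) \<in> SPI (re_fun (Imf f))" "u = a + J b"
proof -
  have x: "x \<in> Domain (SPI f)" using xu by blast
  note m = parts_measurable[OF f]
  obtain a where a: "(x, a) \<in> SPI (re_fun (Ref f))"
    using Domain_re[OF f m(1) _ x] abs_cRe_le by blast
  obtain b where b: "(x, b) \<in> SPI (re_fun (Imf f))"
    using Domain_re[OF f m(2) _ x] abs_cIm_le by blast
  obtain A where A: "bounding_sequence M E f A" using bounding_sequence_exists[OF f] by blast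
  then have A': "exhausting A" "\<And>j. bdd_on f (A j)" unfolding bounding_sequence_iff by auto
  have "u = a + J b"
  proof (rule exhausting_eqI[OF A'(1)])
    fix j
    show "E (A j) u = E (A j) (a + J b)"
      using xu exhausting_sets[OF A'(1)]
      by (simp add: mem_SPI[OF f A] trunc_parts[OF f A'(2)] blinfun.bilinear_simps E_J
          SPI_E[OF aefin_re[OF m(1)] bdd_on_parts(1)[OF f A'(2)] a]
          SPI_E[OF aefin_re[OF m(2)] bdd_on_parts(2)[OF f A'(2)] b])
  qed
  with a b show ?thesis by (rule that)
qed

text \<open>The integral commutes with \<open>J\<close> and with right multiplication. On
  \<open>\<H>\<^sub>+\<close> and \<open>\<H>\<^sub>-\<close> the operator \<open>J\<close> can thus
  be traded for a right factor, the form in which \<open>cintegral\<close> carries the imaginary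
  unit.\<close>

lemma SPI_unit:
  assumes f: "aefin f" and xu: "(x, u) \<in> SPI f" and x: "J x = x \<odot> c"
  shows "J u = u \<odot> c"
  using SPI_unique[OF f SPI_closed_under(3)[OF f xu]] SPI_closed_under(4)[OF f xu, of c] x by simp

lemma J_Pi:
  "J (Pi_plus J \<II> x) = Pi_plus J \<II> x \<odot> \<II>" "J (Pi_minus J \<II> x) = Pi_minus J \<II> x \<odot> (- \<II>)"
  by (simp_all add: Pi_plus_def Pi_minus_def blinfun.bilinear_simps J_cmult J_square cmult_scaleR_left
      cmult_diff_left cmult_add_left cmult_assoc sphere_square[OF \<II>] scaleR_right_diff_distrib)

lemma Pi_sum: "Pi_plus J \<II> x + Pi_minus J \<II> x = x"
  by (simp add: Pi_plus_def Pi_minus_def algebra_simps flip: scaleR_add_left)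

text \<open>The value at \<open>Pi_plus J \<II> x\<close> is \<open>a + J b\<close> with
  \<open>J b = b \<odot> \<II>\<close>. On the other summand
  \<open>J d = - (d \<odot> \<II>)\<close>, and this sign turns \<open>f\<close> into its
  conjugate.\<close>

lemma SPI_cintegral:
  assumes f: "aefin f" and xu: "(x, u) \<in> SPI f"
  shows "cintegrable \<II> M (\<lambda>A. cinner (E A (Pi_plus J \<II> x)) y) f"
    "cintegrable \<II> M (\<lambda>A. cinner (E A (Pi_minus J \<II> x)) y) (\<lambda>\<omega>. xconj (f \<omega>))"
    "cinner u y = cintegral \<II> M (\<lambda>A. cinner (E A (Pi_plus J \<II> x)) y) f
      + cintegral \<II> M (\<lambda>A. cinner (E A (Pi_minus J \<II> x)) y) (\<lambda>\<omega>. xconj (f \<omega>))"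
proof -
  let ?p = "Pi_plus J \<II> x" and ?m = "Pi_minus J \<II> x"
  note meas = parts_measurable[OF f]
  note Jx = SPI_closed_under(4)[OF f SPI_closed_under(3)[OF f xu]]
  have "(?p, (1/2) *\<^sub>R (u + J u \<odot> (- \<II>))) \<in> SPI f" "(?m, (1/2) *\<^sub>R (u + J u \<odot> \<II>)) \<in> SPI f"
    using SPI_closed_under(2)[OF f SPI_closed_under(1)[OF f xu Jx[of "- \<II>"]], of "1/2"]
      SPI_closed_under(2)[OF f SPI_closed_under(1)[OF f xu Jx[of "\<II>"]], of "1/2"]
    by (simp_all add: Pi_plus_def Pi_minus_def)
  then obtain v w where v: "(?p, v) \<in> SPI f" and w: "(?m, w) \<in> SPI f" by blast
  have u: "u = v + w"
    using SPI_unique[OF f xu] SPI_closed_under(1)[OF f v w] by (simp add: Pi_sum)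
  obtain a b where ab: "(?p, a) \<in> SPI (re_fun (Ref f))" "(?p, b) \<in> SPI (re_fun (Imf f))" "v = a + J b"
    using SPI_parts[OF f v] .
  obtain c d where cd: "(?m, c) \<in> SPI (re_fun (Ref f))" "(?m, d) \<in> SPI (re_fun (Imf f))" "w = c + J d"
    using SPI_parts[OF f w] .
  have fm: "aefin (\<lambda>\<omega>. xconj (f \<omega>))" by (rule aefin_xconj[OF f])
  have "?m \<in> Domain (SPI f)" using w by blast
  then have wm: "?m \<in> Domain (SPI (\<lambda>\<omega>. xconj (f \<omega>)))"
    unfolding Domain_SPI[OF f] Domain_SPI[OF fm] by simp
  obtain c' where c': "(?m, c') \<in> SPI (re_fun (Ref (\<lambda>\<omega>. xconj (f \<omega>))))"
    using Domain_re[OF fm parts_measurable(1)[OF fm] _ wm] abs_cRe_le by blast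
  obtain d' where d': "(?m, d') \<in> SPI (re_fun (Imf (\<lambda>\<omega>. xconj (f \<omega>))))"
    using Domain_re[OF fm parts_measurable(2)[OF fm] _ wm] abs_cIm_le by blast
  note cd' = c' d'
  have "Ref (\<lambda>\<omega>. xconj (f \<omega>)) = Ref f" by simp
  then have cc: "c' = c" using cd' cd SPI_unique[OF aefin_re[OF meas(1)]] by simp
  \<comment> \<open>The sign of the conjugate's imaginary part is written as multiplication by the
    constant \<open>- ebasis {}\<close>, whose integral is minus the identity;
    \<open>SPI_comp_iff\<close> then takes it out of the integral.\<close>
  have dd: "d' = - d"
  proof -
    have "SPI (re_fun (Imf (\<lambda>\<omega>. xconj (f \<omega>)))) = SPI (\<lambda>\<omega>. xmult (Some (- ebasis {})) (re_fun (Imf f) \<omega>))"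
    proof (rule SPI_cong[OF aefin_re[OF parts_measurable(2)[OF fm]] aefin_xmult[OF aefin_const aefin_re[OF meas(2)]]])
      show "- ebasis {} \<in> cplane \<II>" using cplane(5)[OF cplane(2), of "-1"] by simp
      fix \<omega> assume "\<omega> \<in> space M"
      then show "re_fun (Imf (\<lambda>\<omega>. xconj (f \<omega>))) \<omega> = xmult (Some (- ebasis {})) (re_fun (Imf f) \<omega>)"
        using cplane_arith(3)[OF \<II> aefinD(2)[OF f] aefinD(2)[OF f]] by (simp add: xmult_def cmult_scaleR_right)
    qed
    moreover have "(d, - d) \<in> SPI (\<lambda>_. Some (- ebasis {}))"
    proof -
      have m: "- ebasis {} \<in> cplane \<II>" using cplane(5)[OF cplane(2), of "-1"] by simp
      have "bdd_on (\<lambda>_. Some (- ebasis {})) (space M)" by (rule bdd_on_intros) simp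
      from SPI_core[OF aefin_const[OF m] this, of d] show ?thesis
        by (simp add: trunc_const[OF m] cmplx_apply \<II>)
    qed
    ultimately have "(?m, - d) \<in> SPI (re_fun (Imf (\<lambda>\<omega>. xconj (f \<omega>))))"
      using SPI_comp_iff[OF aefin_const aefin_re[OF meas(2)] cd(2)] cplane(5)[OF cplane(2), of "-1"] by simp
    then show ?thesis using cd'(2) SPI_unique[OF aefin_re[OF parts_measurable(2)[OF fm]]] by blast
  qed
  show "cintegrable \<II> M (\<lambda>A. cinner (E A ?p) y) f"
    unfolding cintegrable_def using real_cintegral_SPI(1)[OF meas(1) ab(1)] real_cintegral_SPI(1)[OF meas(2) ab(2)] by blast
  show "cintegrable \<II> M (\<lambda>A. cinner (E A ?m) y) (\<lambda>\<omega>. xconj (f \<omega>))"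
    unfolding cintegrable_def
    using real_cintegral_SPI(1)[OF parts_measurable(1)[OF fm] cd'(1)]
      real_cintegral_SPI(1)[OF parts_measurable(2)[OF fm] cd'(2)] by blast
  have "cintegral \<II> M (\<lambda>A. cinner (E A ?p) y) f = cinner (a + b \<odot> \<II>) y"
    unfolding cintegral_def real_cintegral_SPI(2)[OF meas(1) ab(1)] real_cintegral_SPI(2)[OF meas(2) ab(2)]
    by (simp add: cinner_add_left cinner_cmult_left)
  also have "a + b \<odot> \<II> = v"
    using SPI_unit[OF aefin_re[OF meas(2)] ab(2) J_Pi(1)] ab(3) by simp
  finally have 1: "cintegral \<II> M (\<lambda>A. cinner (E A ?p) y) f = cinner v y" .
  have "cintegral \<II> M (\<lambda>A. cinner (E A ?m) y) (\<lambda>\<omega>. xconj (f \<omega>)) = cinner (c' + d' \<odot> \<II>) y"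
    unfolding cintegral_def real_cintegral_SPI(2)[OF parts_measurable(1)[OF fm] cd'(1)]
      real_cintegral_SPI(2)[OF parts_measurable(2)[OF fm] cd'(2)]
    by (simp add: cinner_add_left cinner_cmult_left)
  also have "c' + d' \<odot> \<II> = w"
    using SPI_unit[OF aefin_re[OF meas(2)] cd(2) J_Pi(2)] cd(3) by (simp add: cc dd)
  finally show "cinner u y = cintegral \<II> M (\<lambda>A. cinner (E A ?p) y) f
      + cintegral \<II> M (\<lambda>A. cinner (E A ?m) y) (\<lambda>\<omega>. xconj (f \<omega>))"
    by (simp add: u 1 cinner_add_left)
qed

section \<open>Positivity\<close>

text \<open>On a set where \<open>f\<close> is bounded and nonnegative it equals
  \<open>cconj (s \<omega>) \<odot> s \<omega>\<close> for its bounded square root, so the truncated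
  form is \<open>cinner v v\<close> with \<open>v = BI s x\<close>. Closedness of positivity covers
  the limit.\<close>

lemma positive_SPI:
  assumes f: "aefin f" and pos: "E_ae M E (\<lambda>\<omega>. \<exists>r\<ge>0. f \<omega> = Some (r *\<^sub>R ebasis {}))"
  shows "positive_op (SPI f)"
proof -
  define B :: "'n clifford set" where "B = {z. z = cRe z *\<^sub>R ebasis {} \<and> 0 \<le> cRe z}"
  define P where "P = {\<omega>\<in>space M. f \<omega> \<in> Some ` B}"
  have "closed B" unfolding B_def
    by (intro closed_Collect_conj closed_Collect_eq closed_Collect_le continuous_intros)
  then have P: "P \<in> sets M" unfolding P_def by (intro aefin_sets[OF f]) auto
  have B: "(\<exists>r\<ge>0. z = Some (r *\<^sub>R ebasis {})) \<longleftrightarrow> z \<in> Some ` B" for z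
    unfolding B_def by (auto simp: image_iff)
  have "{\<omega>\<in>space M. f \<omega> \<notin> Some ` B} = space M - P" unfolding P_def by auto
  then have "E (space M - P) = 0"
    using pos E_ae_iff[of "\<lambda>\<omega>. f \<omega> \<in> Some ` B"] P unfolding B by auto
  then have "E P = id_blinfun" using E_compl[OF P] by simp
  then have "exhausting (\<lambda>_. P)" by (rule exhausting_const[OF P])
  moreover obtain A0 where "bounding_sequence M E f A0" using bounding_sequence_exists[OF f] by blast
  ultimately have bs: "bounding_sequence M E f (\<lambda>j. A0 j \<inter> P)" by (intro bounding_sequence_Int)
  \<comment> \<open>Intersecting with \<open>P\<close> makes \<open>f\<close> a nonnegative real at
    every point of \<open>A j\<close> and not merely almost everywhere.\<close>
  define A where "A j = A0 j \<inter> P" for j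
  have A: "bounding_sequence M E f A" using bs unfolding A_def .
  then have A': "exhausting A" "\<And>j. bdd_on f (A j)" unfolding bounding_sequence_iff by auto
  have AP: "A j \<subseteq> P" for j unfolding A_def by auto
  show ?thesis
    unfolding positive_op_def
  proof safe
    fix x u assume xu: "(x, u) \<in> SPI f"
    show "cnonneg (cinner u x)"
    proof (rule cnonneg_limit)
      show "(\<lambda>j. cinner (E (A j) u) x) \<longlonglongrightarrow> cinner u x"
        by (intro tendsto_cinner exhausting_tendsto[OF A'(1)] tendsto_const)
      fix j
      define s :: "'a \<Rightarrow> 'n clifford" where
        "s \<omega> = (if \<omega> \<in> A j then sqrt (Ref f \<omega>) *\<^sub>R ebasis {} else 0)" for \<omega>
      obtain K where K: "\<And>\<omega>. \<omega> \<in> A j \<Longrightarrow> norm (finite_part (f \<omega>)) \<le> K"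
        using A'(2)[of j] unfolding bdd_on_def by blast
      have s: "bcfun s"
      proof (rule bcfunI[where k = "sqrt (max K 0)"])
        have "(\<lambda>\<omega>. sqrt (Ref f \<omega>) *\<^sub>R ebasis {}) \<in> borel_measurable M"
          using parts_measurable(1)[OF f] by (intro borel_measurable_scaleR borel_measurable_const
              measurable_compose[OF _ borel_measurable_sqrt])
        then show "s \<in> borel_measurable M"
          unfolding s_def using exhausting_sets[OF A'(1), of j]
          by (intro measurable_If_set) (auto simp: sets.Int_space_eq2)
        show "norm (s \<omega>) \<le> sqrt (max K 0)" for \<omega>
        proof (cases "\<omega> \<in> A j")
          case True
          then have "\<bar>Ref f \<omega>\<bar> \<le> max K 0"
            using K abs_cRe_le[of "finite_part (f \<omega>)"] by (meson max.coboundedI1 order_trans)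
          then show ?thesis using True by (simp add: s_def flip: real_sqrt_abs2 real_sqrt_abs)
        qed (simp add: s_def)
      qed (auto simp: s_def)
      have ss: "(if \<omega> \<in> A j then finite_part (f \<omega>) else 0) = cconj (s \<omega>) \<odot> s \<omega>" for \<omega>
      proof (cases "\<omega> \<in> A j")
        case True
        then obtain z where z: "f \<omega> = Some z" "z = cRe z *\<^sub>R ebasis {}" "0 \<le> cRe z"
          using AP unfolding P_def B_def by blast
        have "cconj (s \<omega>) \<odot> s \<omega> = (sqrt (cRe z) * sqrt (cRe z)) *\<^sub>R ebasis {}"
          using True z(1) by (simp add: s_def cconj_linear cconj_generators cmult_scaleR_left cmult_scaleR_right)
        then show ?thesis using True z by simp
      qed (simp add: s_def)
      have "E (A j) u = trunc f (A j) x" using xu by (simp add: mem_SPI[OF f A])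
      also have "\<dots> = BI (\<lambda>\<omega>. cconj (s \<omega>)) (BI s x)"
        unfolding trunc_def ss BI_mult[OF bcfun_cconj[OF s] s] by simp
      finally have "cinner (E (A j) u) x = cinner (BI s x) (BI s x)"
        using BI_cinner[OF bcfun_cconj[OF s], of "BI s x" x] by simp
      then show "cnonneg (cinner (E (A j) u) x)" by (simp add: cnonneg_cinner_self)
    qed
  qed
qed

section \<open>Reconstruction of the spectral measure\<close>

text \<open>The real part contributes nothing: its integral is symmetric and commutes with the skew
  operator \<open>J\<close>. The imaginary part survives because \<open>J\<close> is isometric. Thus
  the sign of \<open>Imf f\<close> can be read off from the graph and \<open>J\<close>.\<close>

lemma trunc_inner_J:
  assumes f: "aefin f" and A: "bdd_on f A"
  shows "trunc f A x \<bullet> J x = (\<integral>\<omega>. (if \<omega> \<in> A then Imf f \<omega> else 0) \<partial>pmeas x x)"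
proof -
  note m = parts_measurable[OF f]
  let ?i = "\<lambda>\<omega>. if \<omega> \<in> A then Imf f \<omega> else 0"
  have sym: "trunc (re_fun h) A x \<bullet> y = x \<bullet> trunc (re_fun h) A y"
    if "aefin (re_fun h)" "bdd_on (re_fun h) A" for h y
    using trunc_inner[OF that] by (simp add: xconj_def cconj_linear cconj_generators)
  let ?R = "trunc (re_fun (Ref f)) A" and ?S = "trunc (re_fun (Imf f)) A"
  have "?R x \<bullet> J x = x \<bullet> J (?R x)"
    using sym[OF aefin_re[OF m(1)] bdd_on_parts(1)[OF f A]]
      trunc_J[OF aefin_re[OF m(1)] bdd_on_parts(1)[OF f A]] by simp
  then have "?R x \<bullet> J x = - (?R x \<bullet> J x)"
    using J_inner[of x "?R x"] by (simp add: inner_commute)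
  moreover have "J (?S x) \<bullet> J x = ?S x \<bullet> x" by (simp add: J_inner J_square)
  ultimately have "trunc f A x \<bullet> J x = ?S x \<bullet> x"
    by (simp add: trunc_parts[OF f A] inner_add_left)
  also have "?S = BI (\<lambda>\<omega>. ?i \<omega> *\<^sub>R ebasis {})"
    unfolding trunc_def by (rule BI_cong) auto
  also have "BI (\<lambda>\<omega>. ?i \<omega> *\<^sub>R ebasis {}) x \<bullet> x = (\<integral>\<omega>. ?i \<omega> \<partial>pmeas x x)"
  proof (rule integral_pmeas[symmetric])
    show "?i \<in> borel_measurable M"
      using m(2) bdd_on_sets[OF A] by (intro measurable_If_set) (auto simp: sets.Int_space_eq2)
    obtain K where "\<And>\<omega>. \<omega> \<in> A \<Longrightarrow> norm (finite_part (f \<omega>)) \<le> K" using A unfolding bdd_on_def by blast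
    then have "norm (?i \<omega>) \<le> max K 0" for \<omega>
      using abs_cIm_le[of "finite_part (f \<omega>)"] by (auto simp: le_max_iff_disj intro: order_trans)
    then show "bounded (?i ` space M)" unfolding bounded_iff by blast
  qed (rule pmeas_self_nonneg)
  finally show ?thesis .
qed

text \<open>The bound on the modulus in \<open>C n\<close> puts the range of \<open>E (C n)\<close>
  into the domain, and the margin \<open>1 / real (Suc n)\<close> makes the form at most
  \<open>- (norm x)\<^sup>2 / real (Suc n)\<close> there. Nonnegativity leaves only 0, and the sets
  \<open>C n\<close> increase to the whole exceptional set.\<close>

lemma Im_nonneg_of_SPI:
  assumes f: "aefin f" and nn: "\<And>x u. (x, u) \<in> SPI f \<Longrightarrow> u \<bullet> J x \<ge> 0"
  shows "E {\<omega>\<in>space M. f \<omega> \<noteq> None \<and> Imf f \<omega> < 0} = 0"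
proof -
  define C where "C n = {\<omega>\<in>space M. f \<omega> \<noteq> None} \<inter>
    {\<omega>\<in>space M. norm (finite_part (f \<omega>)) \<le> real n \<and> Imf f \<omega> \<le> - 1 / real (Suc n)}" for n
  have C: "C n \<in> sets M" for n
  proof -
    have "(\<lambda>\<omega>. norm (finite_part (f \<omega>))) \<in> borel_measurable M"
      using aefinD(1)[OF f] by (rule measurable_compose[OF _ borel_measurable_norm])
    then have "{\<omega>\<in>space M. norm (finite_part (f \<omega>)) \<le> real n \<and> Imf f \<omega> \<le> - 1 / real (Suc n)} \<in> sets M"
      using parts_measurable(2)[OF f] by (simp add: borel_measurable_iff_le sets.sets_Collect_conj)
    then show ?thesis unfolding C_def using aefinD(5)[OF f] by (rule sets.Int[rotated])
  qed
  have b: "bdd_on f (C n)" for n unfolding bdd_on_def using C by (auto simp: C_def)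
  have null: "E (C n) = 0" for n
  proof (rule blinfun_eqI)
    fix x0
    define x where "x = E (C n) x0"
    interpret finite_measure "pmeas x x" using pmeas_self_nonneg by (rule finite_measure_pmeas)
    have x: "E (C n) x = x" unfolding x_def using C by (rule E_idem)
    have "0 \<le> trunc f (C n) x \<bullet> J x" using nn[OF SPI_core[OF f b, of n x]] by (simp add: x)
    also have "\<dots> = (\<integral>\<omega>. (if \<omega> \<in> C n then Imf f \<omega> else 0) \<partial>pmeas x x)" by (rule trunc_inner_J[OF f b])
    also have "\<dots> \<le> (\<integral>\<omega>. (- 1 / real (Suc n)) * indicator (C n) \<omega> \<partial>pmeas x x)"
    proof (rule integral_mono)
      have "(\<lambda>\<omega>. if \<omega> \<in> C n then Imf f \<omega> else 0) \<in> borel_measurable (pmeas x x)"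
        using parts_measurable(2)[OF f] C[of n] by (intro measurable_If_set) (auto simp: sets.Int_space_eq2)
      then show "integrable (pmeas x x) (\<lambda>\<omega>. if \<omega> \<in> C n then Imf f \<omega> else 0)"
        by (intro integrable_const_bound[where B = "real n"])
          (auto simp: C_def intro: order_trans[OF abs_cIm_le])
      show "integrable (pmeas x x) (\<lambda>\<omega>. (- 1 / real (Suc n)) * indicator (C n) \<omega>)"
        using C[of n] by (intro integrable_mult_right integrable_real_indicator) (auto simp: less_top[symmetric])
    qed (auto simp: C_def split: split_indicator)
    also have "\<dots> = (- 1 / real (Suc n)) * (norm x)\<^sup>2"
      using C[of n] by (simp add: measure_pmeas[OF pmeas_self_nonneg] x power2_norm_eq_inner del: of_nat_Suc)
    finally have "(norm x)\<^sup>2 \<le> 0" by (simp add: field_simps del: of_nat_Suc) 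
    then show "E (C n) x0 = blinfun_apply 0 x0" by (simp add: x_def)
  qed
  have inc: "incseq C"
    unfolding incseq_def C_def
  proof (intro allI impI Int_mono subset_refl subsetI)
    fix m n :: nat and \<omega> assume mn: "m \<le> n"
      and w: "\<omega> \<in> {\<omega>\<in>space M. norm (finite_part (f \<omega>)) \<le> real m \<and> Imf f \<omega> \<le> - 1 / real (Suc m)}"
    have "- 1 / real (Suc m) \<le> - 1 / real (Suc n)" using mn by (simp add: field_simps)
    then show "\<omega> \<in> {\<omega>\<in>space M. norm (finite_part (f \<omega>)) \<le> real n \<and> Imf f \<omega> \<le> - 1 / real (Suc n)}"
      using w mn by auto
  qed
  have "{\<omega>\<in>space M. f \<omega> \<noteq> None \<and> Imf f \<omega> < 0} = (\<Union>n. C n)"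
  proof safe
    fix \<omega> z assume w: "\<omega> \<in> space M" "f \<omega> = Some z" "Imf f \<omega> < 0"
    obtain n1 where n1: "inverse (real (Suc n1)) < - Imf f \<omega>"
      using reals_Archimedean[of "- Imf f \<omega>"] w(3) by auto
    obtain n2 where n2: "norm (finite_part (f \<omega>)) \<le> real n2" using real_arch_simple by blast
    have "inverse (real (Suc (max n1 n2))) \<le> inverse (real (Suc n1))" by (simp add: field_simps)
    then have "\<omega> \<in> C (max n1 n2)" using w n1 n2 unfolding C_def by (auto simp: inverse_eq_divide)
    then show "\<omega> \<in> (\<Union>n. C n)" by blast
  next
    fix \<omega> n assume w: "\<omega> \<in> C n"
    then show "Imf f \<omega> < 0" unfolding C_def by (auto intro: order_le_less_trans)
  qed (auto simp: C_def)
  moreover have "E (\<Union>n. C n) = 0"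
  proof (rule blinfun_eqI)
    fix x
    have "(\<lambda>n. E (C n) x) \<longlonglongrightarrow> E (\<Union>n. C n) x" using C inc by (intro E_incseq) auto
    then show "E (\<Union>n. C n) x = blinfun_apply 0 x" by (simp add: null LIMSEQ_const_iff)
  qed
  ultimately show ?thesis by simp
qed

lemma bcfun_shift:
  assumes f: "aefin f" and B: "bdd_on f B" and c: "c \<in> cplane \<II>"
  shows "bcfun (\<lambda>\<omega>. if \<omega> \<in> B then finite_part (f \<omega>) - c else 0)"
    "BI (\<lambda>\<omega>. if \<omega> \<in> B then finite_part (f \<omega>) - c else 0) x = trunc f B x - E B (cmplx c x)"
proof -
  have m: "- c \<in> cplane \<II>" using cplane(5)[OF c, of "-1"] by simp
  let ?c = "\<lambda>_::'a. Some (- c)"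
  have Bc: "bdd_on ?c B" by (rule bdd_on_intros(2)[OF bdd_on_sets[OF B]])
  have e: "finite_part (xplus (f \<omega>) (?c \<omega>)) = finite_part (f \<omega>) - c" if "\<omega> \<in> B" for \<omega>
    using B that unfolding bdd_on_def by auto
  then have e': "(\<lambda>\<omega>. if \<omega> \<in> B then finite_part (f \<omega>) - c else 0) =
      (\<lambda>\<omega>. if \<omega> \<in> B then finite_part (xplus (f \<omega>) (?c \<omega>)) else 0)" by auto
  show "bcfun (\<lambda>\<omega>. if \<omega> \<in> B then finite_part (f \<omega>) - c else 0)"
    unfolding e' by (rule bcfun_trunc[OF aefin_xplus[OF f aefin_const[OF m]] bdd_on_xplus[OF B Bc]])
  have "trunc ?c B x = - E B (cmplx c x)"
    unfolding trunc_const[OF m bdd_on_sets[OF B]] by (simp add: cmplx_apply blinfun.bilinear_simps)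
  then show "BI (\<lambda>\<omega>. if \<omega> \<in> B then finite_part (f \<omega>) - c else 0) x = trunc f B x - E B (cmplx c x)"
    unfolding e' trunc_def[symmetric] trunc_xplus[OF f B aefin_const[OF m] Bc] by simp
qed

text \<open>
  The spectral subspace of the disc of radius \<open>r\<close> about a real point \<open>a\<close> consists of the \<open>x\<close> with
  \<open>\<parallel>(T - a)\<^sup>k x\<parallel> \<le> r\<^sup>k \<parallel>x\<parallel>\<close> for all \<open>k\<close>; this description involves neither the spectral measure nor \<open>J\<close>.
\<close>
lemma range_E_disc:
  fixes a r :: real
  assumes f: "aefin f" and r: "r \<ge> 0"
  defines "D \<equiv> {\<omega>\<in>space M. f \<omega> \<in> Some ` {z. norm (z - a *\<^sub>R ebasis {}) \<le> r}}"
  shows "E D x = x \<longleftrightarrow> (\<exists>X :: nat \<Rightarrow> _. X 0 = x \<and>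
    (\<forall>k. (X k, X (Suc k) + a *\<^sub>R X k) \<in> SPI f \<and> norm (X k) \<le> r ^ k * norm x))"
proof
  have "closed {z :: 'n clifford. norm (z - a *\<^sub>R ebasis {}) \<le> r}"
    by (intro closed_Collect_le continuous_intros)
  then have Ds: "D \<in> sets M" unfolding D_def by (intro aefin_sets[OF f]) auto
  have Dn: "norm (finite_part (f \<omega>) - a *\<^sub>R ebasis {}) \<le> r" "f \<omega> \<noteq> None" if "\<omega> \<in> D" for \<omega>
    using that unfolding D_def by auto
  have "norm (finite_part (f \<omega>)) \<le> r + \<bar>a\<bar>" if "\<omega> \<in> D" for \<omega>
    using norm_triangle_ineq2[of "finite_part (f \<omega>)" "a *\<^sub>R ebasis {}"] Dn[OF that] by simp
  then have D: "bdd_on f D" unfolding bdd_on_def using Ds Dn by blast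
  {
    assume x: "E D x = x"
    \<comment> \<open>On the range of \<open>E D\<close> the bounded operator \<open>G\<close> is
      \<open>SPI f\<close> minus \<open>a\<close>, with norm at most \<open>r\<close>; its orbit of
      \<open>x\<close> is the required sequence.\<close>
    define G where "G = BI (\<lambda>\<omega>. if \<omega> \<in> D then finite_part (f \<omega>) - a *\<^sub>R ebasis {} else 0)"
    define X where "X k = (blinfun_apply G ^^ k) x" for k
    have G: "G y = trunc f D y - a *\<^sub>R E D y" for y unfolding G_def by (simp add: bcfun_shift(2)[OF f D] cmplx_real blinfun.bilinear_simps)
    have Gle: "norm (G y) \<le> r * norm y" for y
      unfolding G_def using r Dn by (intro norm_BI_le bcfun_shift(1)[OF f D] cplane) auto
    have EX: "E D (X k) = X k" for k
    proof (induction k)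
      case (Suc k)
      then show ?case
        by (simp add: X_def G blinfun.bilinear_simps trunc_E_self[OF f D] E_idem[OF Ds])
    qed (simp add: X_def x)
    have "norm (X k) \<le> r ^ k * norm x" for k
    proof (induction k)
      case (Suc k)
      have "norm (X (Suc k)) \<le> r * norm (X k)" using Gle[of "X k"] by (simp add: X_def)
      also have "\<dots> \<le> r * (r ^ k * norm x)" by (intro mult_left_mono Suc r)
      finally show ?case by (simp add: mult.assoc)
    qed (simp add: X_def)
    moreover have "(X k, X (Suc k) + a *\<^sub>R X k) \<in> SPI f" for k
    proof -
      have "X (Suc k) = trunc f D (X k) - a *\<^sub>R X k" using EX[of k] G[of "X k"] by (simp add: X_def)
      then show ?thesis using SPI_core[OF f D, of "X k"] by (simp add: EX)
    qed
    ultimately show "\<exists>X :: nat \<Rightarrow> _. X 0 = x \<and>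
        (\<forall>k. (X k, X (Suc k) + a *\<^sub>R X k) \<in> SPI f \<and> norm (X k) \<le> r ^ k * norm x)"
      by (intro exI[of _ X]) (auto simp: X_def)
  next
    assume "\<exists>X :: nat \<Rightarrow> _. X 0 = x \<and>
        (\<forall>k. (X k, X (Suc k) + a *\<^sub>R X k) \<in> SPI f \<and> norm (X k) \<le> r ^ k * norm x)"
    then obtain X where X: "X 0 = x" "\<And>k. (X k, X (Suc k) + a *\<^sub>R X k) \<in> SPI f"
      "\<And>k. norm (X k) \<le> r ^ k * norm x" by blast
    \<comment> \<open>Where \<open>f\<close> keeps distance \<open>r' > r\<close> from
      \<open>a\<close>, each step enlarges the component \<open>E B (X k)\<close> by a factor of at
      least \<open>r'\<close>, while the whole vector grows at most like \<open>r ^ k\<close>. So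
      \<open>norm (E B x)\<close> is at most \<open>(r / r') ^ k * norm x\<close> for every
      \<open>k\<close>.\<close>
    have zero: "E B x = 0" if B: "bdd_on f B" and r': "r' > r"
      and ge: "\<And>\<omega>. \<omega> \<in> B \<Longrightarrow> r' \<le> norm (finite_part (f \<omega>) - a *\<^sub>R ebasis {})" for B r'
    proof -
      define H where "H = BI (\<lambda>\<omega>. if \<omega> \<in> B then finite_part (f \<omega>) - a *\<^sub>R ebasis {} else 0)"
      have r'0: "r' > 0" using r r' by simp
      have step: "r' * norm (E B (X k)) \<le> norm (E B (X (Suc k)))" for k
      proof -
        have "E B (X (Suc k)) + a *\<^sub>R E B (X k) = trunc f B (X k)"
          using SPI_E[OF f B X(2)] by (simp add: blinfun.bilinear_simps)
        then have "E B (X (Suc k)) = H (X k)"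
          unfolding H_def by (simp add: bcfun_shift(2)[OF f B] cmplx_real blinfun.bilinear_simps algebra_simps)
        moreover have "r' * norm (E B (X k)) \<le> norm (H (X k))"
          unfolding H_def using r'0 ge by (intro norm_BI_ge bcfun_shift(1)[OF f B] cplane bdd_on_sets[OF B]) auto
        ultimately show ?thesis by simp
      qed
      have "r' ^ k * norm (E B x) \<le> norm (E B (X k))" for k
      proof (induction k)
        case (Suc k)
        have "r' * (r' ^ k * norm (E B x)) \<le> r' * norm (E B (X k))"
          using Suc r'0 by (intro mult_left_mono) auto
        also have "\<dots> \<le> norm (E B (X (Suc k)))" by (rule step)
        finally show ?case by (simp add: mult.assoc)
      qed (simp add: X(1))
      also have "norm (E B (X k)) \<le> norm (X k)" for k by (rule norm_E_le[OF bdd_on_sets[OF B]])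
      also note X(3)
      finally have "norm (E B x) \<le> (r / r') ^ k * norm x" for k
        using r'0 by (simp add: power_divide field_simps)
      moreover have "(\<lambda>k. (r / r') ^ k * norm x) \<longlonglongrightarrow> 0 * norm x"
        using r r' r'0 by (intro tendsto_mult tendsto_const LIMSEQ_power_zero) simp
      ultimately have "norm (E B x) \<le> 0 * norm x"
        by (intro LIMSEQ_le_const[of _ "0 * norm x"]) auto
      then show ?thesis by simp
    qed
    \<comment> \<open>These sets increase to the part of the finite values outside the disc. The
      bound \<open>real m\<close> makes \<open>f\<close> bounded, and
      \<open>inverse (real (Suc m))\<close> supplies the gap that \<open>zero\<close> asks
      for.\<close>
    define B where "B m = {\<omega>\<in>space M. f \<omega> \<in> Some ` {z. norm z \<le> real m \<and>
      r + inverse (real (Suc m)) \<le> norm (z - a *\<^sub>R ebasis {})}}" for m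
    have Bs: "B m \<in> sets M" for m
    proof -
      have "closed {z :: 'n clifford. norm z \<le> real m \<and> r + inverse (real (Suc m)) \<le> norm (z - a *\<^sub>R ebasis {})}"
        by (intro closed_Collect_conj closed_Collect_le continuous_intros)
      then show ?thesis unfolding B_def by (intro aefin_sets[OF f]) auto
    qed
    have "E (B m) x = 0" for m
    proof (rule zero)
      show "bdd_on f (B m)" unfolding bdd_on_def using Bs by (auto simp: B_def intro!: exI[of _ "real m"])
      show "r + inverse (real (Suc m)) > r" by simp
    qed (auto simp: B_def)
    moreover have "incseq B"
      unfolding incseq_def
    proof (intro allI impI subsetI)
      fix m n :: nat and \<omega> assume mn: "m \<le> n" and "\<omega> \<in> B m"
      then obtain z where z: "\<omega> \<in> space M" "f \<omega> = Some z" "norm z \<le> real m"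
        "r + inverse (real (Suc m)) \<le> norm (z - a *\<^sub>R ebasis {})" unfolding B_def by blast
      have "inverse (real (Suc n)) \<le> inverse (real (Suc m))" using mn by (simp add: field_simps)
      then have "norm z \<le> real n" "r + inverse (real (Suc n)) \<le> norm (z - a *\<^sub>R ebasis {})"
        using z mn by linarith+
      then show "\<omega> \<in> B n" using z unfolding B_def by blast
    qed
    then have "(\<lambda>m. E (B m) x) \<longlonglongrightarrow> E (\<Union>m. B m) x" using Bs by (intro E_incseq) auto
    ultimately have U: "E (\<Union>m. B m) x = 0" by (simp add: LIMSEQ_const_iff)
    have "{\<omega>\<in>space M. f \<omega> \<noteq> None} = D \<union> (\<Union>m. B m)"
    proof safe
      fix \<omega> z assume w: "\<omega> \<in> space M" "f \<omega> = Some z" "\<omega> \<notin> (\<Union>m. B m)"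
      show "\<omega> \<in> D"
      proof (rule ccontr)
        assume "\<omega> \<notin> D"
        then have "norm (z - a *\<^sub>R ebasis {}) - r > 0" using w unfolding D_def by auto
        then obtain m1 where m1: "inverse (real (Suc m1)) < norm (z - a *\<^sub>R ebasis {}) - r"
          using reals_Archimedean by blast
        obtain m2 where m2: "norm z \<le> real m2" using real_arch_simple by blast
        have "inverse (real (Suc (max m1 m2))) \<le> inverse (real (Suc m1))" by (simp add: field_simps)
        then have "norm z \<le> real (max m1 m2)"
          "r + inverse (real (Suc (max m1 m2))) \<le> norm (z - a *\<^sub>R ebasis {})"
          using m1 m2 by linarith+
        then have "\<omega> \<in> B (max m1 m2)" using w(1,2) unfolding B_def by blast
        then show False using w(3) by blast
      qed
    qed (auto simp: D_def B_def)
    moreover have "D \<inter> (\<Union>m. B m) = {}"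
    proof -
      have False if w: "\<omega> \<in> D" "\<omega> \<in> B m" for \<omega> m
      proof -
        obtain z where z: "f \<omega> = Some z" "norm (z - a *\<^sub>R ebasis {}) \<le> r"
          using w(1) unfolding D_def by blast
        moreover have "r + inverse (real (Suc m)) \<le> norm (z - a *\<^sub>R ebasis {})"
          using w(2) z(1) unfolding B_def by (auto simp del: of_nat_Suc)
        moreover have "inverse (real (Suc m)) > 0" by simp
        ultimately show False by linarith
      qed
      then show ?thesis by blast
    qed
    ultimately have "x = E D x + E (\<Union>m. B m) x"
      using aefinD(6)[OF f] E_Un[OF Ds, of "\<Union>m. B m" x] Bs by auto
    then show "E D x = x" using U by simp
  }
qed

end

section \<open>Uniqueness of the spectral measure\<close>

text \<open>After truncation the form is an integral of \<open>Imf f\<close>. It is meant for the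
  identity function on a spectrum inside the upper half plane.\<close>

lemma (in spectral_calculus) inner_J_nonneg:
  assumes f: "aefin f" and nn: "\<And>\<omega>. \<omega> \<in> space M \<Longrightarrow> Imf f \<omega> \<ge> 0" and xu: "(x, u) \<in> SPI f"
  shows "u \<bullet> J x \<ge> 0"
proof -
  obtain A where A: "bounding_sequence M E f A" using bounding_sequence_exists[OF f] by blast
  then have A': "exhausting A" "\<And>j. bdd_on f (A j)" unfolding bounding_sequence_iff by auto
  have "E (A j) u \<bullet> J x \<ge> 0" for j
  proof -
    have "E (A j) u \<bullet> J x = (\<integral>\<omega>. (if \<omega> \<in> A j then Imf f \<omega> else 0) \<partial>pmeas x x)"
      using xu by (simp add: mem_SPI[OF f A] trunc_inner_J[OF f A'(2)])
    also have "\<dots> \<ge> 0" using nn by (intro integral_nonneg_AE) auto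
    finally show ?thesis .
  qed
  moreover have "(\<lambda>j. E (A j) u \<bullet> J x) \<longlonglongrightarrow> u \<bullet> J x"
    by (intro tendsto_inner exhausting_tendsto[OF A'(1)] tendsto_const)
  ultimately show ?thesis by (intro LIMSEQ_le_const[of _ "u \<bullet> J x"]) auto
qed

text \<open>Equal ranges give that \<open>Q\<close> fixes the values of \<open>P\<close> and
  conversely; symmetry of both turns these two absorption laws into equality.\<close>

lemma projection_eqI:
  fixes P Q :: "('h::real_inner, 'n::{finite,linorder}) bop"
  assumes "\<And>x y. P x \<bullet> y = x \<bullet> P y" "\<And>x y. Q x \<bullet> y = x \<bullet> Q y"
    and "\<And>x. P (P x) = P x" "\<And>x. Q (Q x) = Q x" and fixed: "\<And>x. P x = x \<longleftrightarrow> Q x = x"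
  shows "P = Q"
proof (rule blinfun_eqI)
  fix x
  have "P x \<bullet> y = Q x \<bullet> y" for y
  proof -
    have "P x \<bullet> y = Q (P x) \<bullet> y" using fixed[of "P x"] assms(3)[of x] by simp
    also have "\<dots> = x \<bullet> P (Q y)" by (simp only: assms(1,2))
    also have "\<dots> = x \<bullet> Q y" using fixed[of "Q y"] assms(4)[of y] by simp
    finally show ?thesis unfolding assms(2) .
  qed
  then show "P x = Q x" using vector_eq_rdot by blast
qed

text \<open>Preimages of quadrants are intersections of a disc about 0 with a disc about 1, the sets
  on which two spectral measures can be compared directly.\<close>

definition two_norms :: "'n::{finite,linorder} clifford \<Rightarrow> real \<times> real" where
  "two_norms z = (norm z, norm (z - ebasis {}))"

lemma two_norms_borel: "two_norms \<in> borel_measurable borel"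
  unfolding two_norms_def by (intro borel_measurable_continuous_onI continuous_intros)

lemma two_norms_preimage: "C \<in> sets borel \<Longrightarrow> two_norms -` C \<in> sets borel"
  using measurable_sets[OF two_norms_borel] by simp

text \<open>Recovers a point of the upper half plane from its distances to \<open>0\<close> and \<open>1\<close>.\<close>
definition from_norms :: "'n::{finite,linorder} clifford \<Rightarrow> real \<times> real \<Rightarrow> 'n clifford" where
  "from_norms \<II> = (\<lambda>(p, q). ((p\<^sup>2 - q\<^sup>2 + 1) / 2) *\<^sub>R ebasis {} + sqrt (p\<^sup>2 - ((p\<^sup>2 - q\<^sup>2 + 1) / 2)\<^sup>2) *\<^sub>R \<II>)"

lemma from_norms_borel: "from_norms \<II> \<in> borel_measurable borel"
  unfolding from_norms_def case_prod_unfold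
  by (intro borel_measurable_continuous_onI continuous_intros) auto

text \<open>The squared distances to 0 and 1 differ by \<open>2 * cRe z - 1\<close>, which gives the
  real part. The imaginary part is then known up to sign, and the half plane selects the nonnegative
  root.\<close>

lemma from_two_norms:
  assumes \<II>: "\<II> \<in> imag_sphere" and z: "z \<in> cplane_up \<II>"
  shows "from_norms \<II> (two_norms z) = z"
proof -
  have zc: "z \<in> cplane \<II>" "cIm \<II> z \<ge> 0" using z cplane_up_iff[OF \<II>] by auto
  have z1: "z - ebasis {} \<in> cplane \<II>" using zc \<II> by simp
  have n: "(norm z)\<^sup>2 = (cRe z)\<^sup>2 + (cIm \<II> z)\<^sup>2" "(norm (z - ebasis {}))\<^sup>2 = (cRe z - 1)\<^sup>2 + (cIm \<II> z)\<^sup>2"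
    using cplane_arith(4)[OF \<II> zc(1) zc(1)] cplane_arith(4)[OF \<II> z1 z1] \<II> by simp_all
  have "((norm z)\<^sup>2 - (norm (z - ebasis {}))\<^sup>2 + 1) / 2 = cRe z"
    unfolding n by (simp add: power2_eq_square algebra_simps)
  then show ?thesis
    using zc cplane_iff[OF \<II>, of z] by (simp add: from_norms_def two_norms_def n(1))
qed

lemma borel_quadrants:
  "sets (borel :: (real \<times> real) measure) = sigma_sets UNIV (range (\<lambda>(r, s). {..r} \<times> {..s}))"
proof -
  have "(\<lambda>a::real \<times> real. {..a}) = (\<lambda>(r, s). {..r} \<times> {..s})"
    by (auto simp: fun_eq_iff less_eq_prod_def)
  then have "(borel :: (real \<times> real) measure) = sigma UNIV (range (\<lambda>(r, s). {..r} \<times> {..s}))"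
    by (metis borel_eq_atMost)
  then show ?thesis by (metis sets_measure_of subset_UNIV Pow_UNIV)
qed

lemma cplane_up_borel:
  assumes "\<II> \<in> imag_sphere"
  shows "cplane_up \<II> \<in> sets borel"
proof -
  have "cplane_up \<II> = {z. z = cRe z *\<^sub>R ebasis {} + cIm \<II> z *\<^sub>R \<II> \<and> 0 \<le> cIm \<II> z}"
    using cplane_up_iff[OF assms] cplane_iff[OF assms] by blast
  moreover have "closed \<dots>"
    by (intro closed_Collect_conj closed_Collect_eq closed_Collect_le continuous_intros)
  ultimately show ?thesis by simp
qed

text \<open>The condition in \<open>range_E_disc\<close> mentions only the graph, so both measures
  agree on discs with real centre although \<open>J\<close> and \<open>J'\<close> may differ.
  Quadrants are stable under intersection, so agreement spreads to all preimages under
  \<open>two_norms\<close>; on the half plane these account for every Borel set.\<close>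

lemma spectral_measure_unique:
  assumes S: "spectral_calculus M E J \<II>" and S': "spectral_calculus N F J' \<II>"
    and f: "spectral_calculus.aefin M E \<II> f" and g: "spectral_calculus.aefin N F \<II> g"
    and eq: "spectral_integral \<II> J M E f = spectral_integral \<II> J' N F g"
    and up: "E {\<omega>\<in>space M. f \<omega> \<in> Some ` cplane_up \<II>} = id_blinfun"
      "F {\<omega>\<in>space N. g \<omega> \<in> Some ` cplane_up \<II>} = id_blinfun"
    and B: "B \<in> sets borel"
  shows "E {\<omega>\<in>space M. f \<omega> \<in> Some ` B} = F {\<omega>\<in>space N. g \<omega> \<in> Some ` B}"
proof -
  interpret E: spectral_calculus M E J \<II> by fact
  interpret F: spectral_calculus N F J' \<II> by fact
  let ?E = "\<lambda>B. {\<omega>\<in>space M. f \<omega> \<in> Some ` B}" and ?F = "\<lambda>B. {\<omega>\<in>space N. g \<omega> \<in> Some ` B}"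
  note sE = E.aefin_sets[OF f] and sF = F.aefin_sets[OF g]
  have disc: "E (?E {z. norm (z - a *\<^sub>R ebasis {}) \<le> r}) = F (?F {z. norm (z - a *\<^sub>R ebasis {}) \<le> r})" for a r
  proof (cases "r \<ge> 0")
    case True
    let ?D = "{z :: 'c clifford. norm (z - a *\<^sub>R ebasis {}) \<le> r}"
    have "closed ?D" by (intro closed_Collect_le continuous_intros)
    then have D: "?D \<in> sets borel" by auto
    show ?thesis
    proof (rule projection_eqI)
      show "E (?E ?D) x = x \<longleftrightarrow> F (?F ?D) x = x" for x
        unfolding E.range_E_disc[OF f True] F.range_E_disc[OF g True] eq ..
    qed (use sE[OF D] sF[OF D] in \<open>simp_all add: E.E_inner F.E_inner E.E_idem F.E_idem\<close>)
  next
    case False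
    then have "{z :: 'c clifford. norm (z - a *\<^sub>R ebasis {}) \<le> r} = {}"
      by (auto simp: not_le intro: order_less_le_trans)
    then show ?thesis by simp
  qed
  have closed_disc: "{z :: 'c clifford. norm (z - a *\<^sub>R ebasis {}) \<le> r} \<in> sets borel" for a r
  proof -
    have "closed {z :: 'c clifford. norm (z - a *\<^sub>R ebasis {}) \<le> r}"
      by (intro closed_Collect_le continuous_intros)
    then show ?thesis by auto
  qed
  have C: "E (?E (two_norms -` C)) = F (?F (two_norms -` C))" if "C \<in> sets borel" for C
  proof -
    have C: "C \<in> sigma_sets UNIV (range (\<lambda>(r, s). {..r} \<times> {..s}))" using that borel_quadrants by simp
    have stable: "Int_stable (range (\<lambda>(r :: real, s :: real). {..r} \<times> {..s}))"
    proof (rule Int_stableI)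
      fix a b assume "a \<in> range (\<lambda>(r :: real, s :: real). {..r} \<times> {..s})" "b \<in> range (\<lambda>(r :: real, s :: real). {..r} \<times> {..s})"
      then obtain r s r' s' where "a = {..r} \<times> {..s}" "b = {..r'} \<times> {..s'}" by auto
      then have "a \<inter> b = (\<lambda>(r, s). {..r} \<times> {..s}) (min r r', min s s')" by auto
      then show "a \<inter> b \<in> range (\<lambda>(r :: real, s :: real). {..r} \<times> {..s})" by (metis rangeI)
    qed
    have "range (\<lambda>(r :: real, s :: real). {..r} \<times> {..s}) \<subseteq> Pow UNIV" by simp
    with stable show ?thesis using C
    proof (induction rule: sigma_sets_induct_disjoint)
      case (basic A)
      then obtain r s where A: "A = {..r} \<times> {..s}" by auto
      let ?D = "{z :: 'c clifford. norm (z - 0 *\<^sub>R ebasis {}) \<le> r}" and ?D' = "{z :: 'c clifford. norm (z - 1 *\<^sub>R ebasis {}) \<le> s}"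
      have e: "?E (two_norms -` A) = ?E ?D \<inter> ?E ?D'" "?F (two_norms -` A) = ?F ?D \<inter> ?F ?D'"
        unfolding A two_norms_def by auto
      show ?case
      proof (rule blinfun_eqI)
        fix x
        have "E (?E ?D \<inter> ?E ?D') x = E (?E ?D) (E (?E ?D') x)"
          using closed_disc by (intro E.E_Int[symmetric] sE)
        also have "\<dots> = F (?F ?D) (F (?F ?D') x)" by (simp only: disc)
        also have "\<dots> = F (?F ?D \<inter> ?F ?D') x"
          using closed_disc by (intro F.E_Int sF)
        finally show "E (?E (two_norms -` A)) x = F (?F (two_norms -` A)) x" unfolding e .
      qed
    next
      \<comment> \<open>Preimages under \<open>Some\<close> never contain infinity, so complements
        are taken within the set of finite values, which has full measure.\<close>
      case (compl A)
      then have "A \<in> sets borel" using borel_quadrants by simp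
      note tA = two_norms_preimage[OF this]
      have e: "?E (two_norms -` (UNIV - A)) = {\<omega>\<in>space M. f \<omega> \<noteq> None} - ?E (two_norms -` A)"
        "?F (two_norms -` (UNIV - A)) = {\<omega>\<in>space N. g \<omega> \<noteq> None} - ?F (two_norms -` A)"
        by (auto simp: image_iff)
      show ?case
      proof (rule blinfun_eqI)
        fix x
        have "E ({\<omega>\<in>space M. f \<omega> \<noteq> None} - ?E (two_norms -` A)) x = x - E (?E (two_norms -` A)) x"
          using E.aefinD(5,6)[OF f] sE[OF tA] by (subst E.E_Diff) auto
        moreover have "F ({\<omega>\<in>space N. g \<omega> \<noteq> None} - ?F (two_norms -` A)) x = x - F (?F (two_norms -` A)) x"
          using F.aefinD(5,6)[OF g] sF[OF tA] by (subst F.E_Diff) auto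
        ultimately show "E (?E (two_norms -` (UNIV - A))) x = F (?F (two_norms -` (UNIV - A))) x"
          unfolding e using compl by simp
      qed
    next
      case (union A)
      have A: "A i \<in> sets borel" for i using union(2) borel_quadrants by auto
      note tA = two_norms_preimage[OF A]
      have disj: "disjoint_family (\<lambda>i. ?E (two_norms -` A i))" "disjoint_family (\<lambda>i. ?F (two_norms -` A i))"
        using union(1) unfolding disjoint_family_on_def by fastforce+
      have e: "?E (two_norms -` (\<Union>i. A i)) = (\<Union>i. ?E (two_norms -` A i))"
        "?F (two_norms -` (\<Union>i. A i)) = (\<Union>i. ?F (two_norms -` A i))" by auto
      show ?case
      proof (rule blinfun_eqI)
        fix x
        have "(\<lambda>i. E (?E (two_norms -` A i)) x) sums E (\<Union>i. ?E (two_norms -` A i)) x"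
          using sE[OF tA] disj by (intro E.E_sums) auto
        moreover have "(\<lambda>i. F (?F (two_norms -` A i)) x) sums F (\<Union>i. ?F (two_norms -` A i)) x"
          using sF[OF tA] disj by (intro F.E_sums) auto
        ultimately show "E (?E (two_norms -` (\<Union>i. A i))) x = F (?F (two_norms -` (\<Union>i. A i))) x"
          unfolding e union(3) by (rule sums_unique2)
      qed
    qed (auto)
  qed
  \<comment> \<open>Within the half plane, \<open>from_norms\<close> inverts
    \<open>two_norms\<close>, so \<open>B\<close> and the preimage of \<open>?C\<close> have the
    same part there; by \<open>up\<close> nothing else is charged.\<close>
  let ?C = "from_norms \<II> -` B"
  have Cb: "?C \<in> sets borel" using measurable_sets[OF from_norms_borel B] by simp
  have U: "cplane_up \<II> \<in> sets borel" by (rule cplane_up_borel[OF E.\<II>])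
  have cut: "B \<inter> cplane_up \<II> = two_norms -` ?C \<inter> cplane_up \<II>"
  proof -
    have "two_norms z \<in> ?C \<longleftrightarrow> z \<in> B" if "z \<in> cplane_up \<II>" for z
      unfolding vimage_eq from_two_norms[OF E.\<II> that] ..
    then show ?thesis by blast
  qed
  have 1: "?E (D \<inter> cplane_up \<II>) = ?E D \<inter> ?E (cplane_up \<II>)" "?F (D \<inter> cplane_up \<II>) = ?F D \<inter> ?F (cplane_up \<II>)" for D
    by auto
  have 2: "E (?E (D \<inter> cplane_up \<II>)) = E (?E D)" "F (?F (D \<inter> cplane_up \<II>)) = F (?F D)" if "D \<in> sets borel" for D
    unfolding 1 using E.E_Int[OF sE[OF that] sE[OF U]] F.E_Int[OF sF[OF that] sF[OF U]] up
    by (auto intro!: blinfun_eqI)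
  show ?thesis
    using 2[OF B] 2[OF two_norms_preimage[OF Cb]] C[OF Cb] unfolding cut by simp
qed

lemma aefin_Some_spectrum:
  assumes "spectral_calculus (spectrum_space \<II> T) F J \<II>"
  shows "spectral_calculus.aefin (spectrum_space \<II> T) F \<II> Some"
proof -
  interpret spectral_calculus "spectrum_space \<II> T" F J \<II> by fact
  show ?thesis
    unfolding aefin_def
  proof (intro conjI ballI)
    show "(\<lambda>\<omega>. finite_part (Some \<omega>)) \<in> borel_measurable (spectrum_space \<II> T)"
      unfolding spectrum_space_def by (simp add: measurable_restrict_space1)
    show "finite_part (Some \<omega>) \<in> cplane \<II>" if "\<omega> \<in> space (spectrum_space \<II> T)" for \<omega>
      using that cplane_up_iff[OF \<II>] by (auto simp: spectrum_space_def space_restrict_space)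
  qed auto
qed

section \<open>Existence of the spectral measure of a spectral integral\<close>

context spectral_calculus
begin

abbreviation pre :: "('a \<Rightarrow> 'n xclifford) \<Rightarrow> 'n clifford set \<Rightarrow> 'a set" where
  "pre f B \<equiv> {\<omega>\<in>space M. f \<omega> \<in> Some ` B}"

lemma trunc_cmplx: "aefin f \<Longrightarrow> bdd_on f A \<Longrightarrow> trunc f A (cmplx c x) = cmplx c (trunc f A x)"
  by (simp add: cmplx_apply blinfun.bilinear_simps trunc_J)

text \<open>On vectors carried by a small ball about \<open>s\<close>, \<open>Q_op s\<close> factors
  into multiplication by \<open>f - s\<close>, which is small, and by \<open>f - cconj s\<close>,
  which is bounded. This contradicts the bound on the inverse unless the vector is 0.\<close>

lemma resolvent_null_ball:
  assumes f: "aefin f" and s: "s \<in> cplane \<II>" "s \<in> S_resolvent_set (SPI f)"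
  shows "\<exists>\<epsilon>>0. E (pre f (ball s \<epsilon>)) = 0"
proof -
  have "\<exists>C. \<forall>(x, y)\<in>Q_op s (SPI f). norm x \<le> C * norm y"
    using s(2) unfolding S_resolvent_set_def mem_Collect_eq by (elim conjE)
  then obtain C where C0: "\<forall>(x, y)\<in>Q_op s (SPI f). norm x \<le> C * norm y" ..
  have C: "norm x \<le> C * norm y" if "(x, y) \<in> Q_op s (SPI f)" for x y
    using bspec[OF C0 that] by simp
  \<comment> \<open>\<open>c\<close> is a positive replacement for \<open>C\<close>, and
    \<open>m\<close> bounds the distance from \<open>f\<close> to \<open>cconj s\<close> on a ball
    of radius at most 1. The choice of \<open>\<epsilon>\<close> makes
    \<open>\<epsilon> * (c * m) \<le> 1 / 2\<close>.\<close>
  define c where "c = \<bar>C\<bar> + 1"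
  define m where "m = 1 + 2 * norm s"
  define \<epsilon> where "\<epsilon> = min 1 (1 / (2 * c * m))"
  have cm: "c > 0" "m > 0" unfolding c_def m_def by (auto intro: add_pos_nonneg)
  then have \<epsilon>: "\<epsilon> > 0" "\<epsilon> \<le> 1" "\<epsilon> \<le> 1 / (2 * c * m)" unfolding \<epsilon>_def by auto
  let ?B = "pre f (ball s \<epsilon>)"
  have Bs: "?B \<in> sets M" by (rule aefin_sets[OF f]) simp
  have Bn: "norm (finite_part (f \<omega>) - s) \<le> \<epsilon>" "f \<omega> \<noteq> None" if "\<omega> \<in> ?B" for \<omega>
    using that by (auto simp: dist_norm norm_minus_commute)
  have "norm (finite_part (f \<omega>)) \<le> \<epsilon> + norm s" if "\<omega> \<in> ?B" for \<omega>
    using norm_triangle_ineq2[of "finite_part (f \<omega>)" s] Bn[OF that] by simp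
  then have B: "bdd_on f ?B" unfolding bdd_on_def using Bs Bn by blast
  have cs: "cconj s \<in> cplane \<II>" using s(1) by simp
  define G where "G d = BI (\<lambda>\<omega>. if \<omega> \<in> ?B then finite_part (f \<omega>) - d else 0)" for d
  have "E ?B x0 = 0" for x0
  proof -
    define x where "x = E ?B x0"
    define v where "v = trunc f ?B x"
    define w where "w = trunc f ?B v"
    have x: "E ?B x = x" unfolding x_def by (rule E_idem[OF Bs])
    have v: "E ?B v = v" unfolding v_def by (rule trunc_E_self[OF f B])
    have "(x, v) \<in> SPI f" using SPI_core[OF f B, of x] unfolding x v_def[symmetric] .
    moreover have "(v, w) \<in> SPI f" using SPI_core[OF f B, of v] unfolding v w_def[symmetric] .
    ultimately have Q: "(x, w - (2 * cRe s) *\<^sub>R v + (norm s)\<^sup>2 *\<^sub>R x) \<in> Q_op s (SPI f)"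
      unfolding Q_op_def by blast
    have cc: "cmplx s (cmplx (cconj s) x) = (norm s)\<^sup>2 *\<^sub>R x"
      using cmplx_mult[OF s(1) cs, of x] by (simp add: cplane_arith(6)[OF \<II> s(1) s(1)] cmplx_real)
    have sum: "cmplx s v + cmplx (cconj s) v = (2 * cRe s) *\<^sub>R v"
      by (simp add: cmplx_apply cplane_arith(3)[OF \<II> s(1) s(1)] flip: scaleR_add_left)
    have "G (cconj s) x = v - cmplx (cconj s) x"
      unfolding G_def bcfun_shift(2)[OF f B cs] by (simp add: E_cmplx[OF Bs] x v_def)
    then have "G s (G (cconj s) x) = w - cmplx s v - cmplx (cconj s) v + cmplx s (cmplx (cconj s) x)"
      unfolding G_def bcfun_shift(2)[OF f B s(1)]
      by (simp add: blinfun.bilinear_simps E_cmplx[OF Bs] x v w_def[symmetric] v_def[symmetric]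
          trunc_cmplx[OF f B])
    also have "\<dots> = w - (2 * cRe s) *\<^sub>R v + (norm s)\<^sup>2 *\<^sub>R x"
      unfolding cc sum[symmetric] by simp
    finally have GG: "w - (2 * cRe s) *\<^sub>R v + (norm s)\<^sup>2 *\<^sub>R x = G s (G (cconj s) x)" ..
    have "norm (G s y) \<le> \<epsilon> * norm y" for y
      unfolding G_def using \<epsilon> Bn by (intro norm_BI_le bcfun_shift(1)[OF f B s(1)]) auto
    then have "norm (G s (G (cconj s) x)) \<le> \<epsilon> * norm (G (cconj s) x)" .
    also have "norm (G (cconj s) x) \<le> m * norm x"
      unfolding G_def
    proof (rule norm_BI_le[OF bcfun_shift(1)[OF f B cs]])
      fix \<omega>
      have "norm (finite_part (f \<omega>) - cconj s) \<le> m" if "\<omega> \<in> ?B"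
      proof -
        have "norm (finite_part (f \<omega>) - cconj s) \<le> norm (finite_part (f \<omega>) - s) + norm (s - cconj s)"
          using norm_triangle_ineq[of "finite_part (f \<omega>) - s" "s - cconj s"] by simp
        also have "\<dots> \<le> 1 + (norm s + norm (cconj s))"
          using Bn[OF that] \<epsilon> by (intro add_mono norm_triangle_ineq4) auto
        finally show ?thesis by (simp add: m_def)
      qed
      then show "norm (if \<omega> \<in> ?B then finite_part (f \<omega>) - cconj s else 0) \<le> m" using cm by auto
    qed (use cm in simp)
    finally have "norm (G s (G (cconj s) x)) \<le> \<epsilon> * (m * norm x)" using \<epsilon> by simp
    then have "norm x \<le> c * (\<epsilon> * (m * norm x))"
      using C[OF Q] cm unfolding GG c_def
      by (smt (verit) mult_left_mono mult_right_mono norm_ge_zero)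
    also have "\<dots> = (\<epsilon> * (c * m)) * norm x" by simp
    also have "\<dots> \<le> (1 / 2) * norm x"
      using \<epsilon>(3) cm by (intro mult_right_mono) (auto simp: field_simps)
    finally have "norm x = 0" by simp
    then show ?thesis by (simp add: x_def)
  qed
  then have "E ?B = 0" by (intro blinfun_eqI) simp
  then show ?thesis using \<epsilon>(1) by blast
qed

text \<open>Lindelof leaves a countable subfamily, whose preimages are null for every scalar measure
  \<open>pmeas x x\<close>; this forces the projection of their union to vanish.\<close>

lemma null_open_cover:
  assumes f: "aefin f" and open_null: "\<And>S. S \<in> \<F> \<Longrightarrow> open S \<and> E (pre f S) = 0"
  shows "E (pre f (\<Union>\<F>)) = 0"
proof -
  obtain \<F>' where F': "\<F>' \<subseteq> \<F>" "countable \<F>'" "\<Union>\<F>' = \<Union>\<F>"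
    using Lindelof[of \<F>] open_null by blast
  have e: "pre f (\<Union>\<F>) = (\<Union>S\<in>\<F>'. pre f S)" unfolding F'(3)[symmetric] by auto
  have m: "pre f S \<in> sets M" if "S \<in> \<F>'" for S
    using that F'(1) open_null by (intro aefin_sets[OF f]) auto
  show ?thesis
  proof (rule blinfun_eqI)
    fix x
    have "(\<Union>S\<in>\<F>'. pre f S) \<in> null_sets (pmeas x x)"
    proof (rule null_sets_UN'[OF F'(2)])
      fix S assume S: "S \<in> \<F>'"
      then have "emeasure (pmeas x x) (pre f S) = 0"
        using m[OF S] open_null F'(1) by (subst emeasure_pmeas) (auto simp: pmeas_self_nonneg)
      then show "pre f S \<in> null_sets (pmeas x x)" using m[OF S] by (simp add: null_setsI)
    qed
    then have "emeasure (pmeas x x) (pre f (\<Union>\<F>)) = 0" "pre f (\<Union>\<F>) \<in> sets M"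
      unfolding e by (auto dest: null_setsD1 null_setsD2)
    then have "E (pre f (\<Union>\<F>)) x \<bullet> x \<le> 0" by (simp add: emeasure_pmeas pmeas_self_nonneg)
    then have "(norm (E (pre f (\<Union>\<F>)) x))\<^sup>2 \<le> 0"
      using E_inner_self[OF \<open>pre f (\<Union>\<F>) \<in> sets M\<close>] by simp
    then show "E (pre f (\<Union>\<F>)) x = blinfun_apply 0 x" by simp
  qed
qed

text \<open>
  The spectrum contains the essential range of \<open>f\<close>, so the image of \<open>E\<close> under \<open>f\<close> lives on it; \<open>U\<close> is
  an open null set that covers the rest of the half plane.
\<close>
lemma spectral_measure_exists:
  assumes f: "aefin f" and up: "E (pre f (cplane_up \<II>)) = id_blinfun"
  shows "\<exists>F. is_spectral_measure_of \<II> J (SPI f) F"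
proof -
  define X where "X = S_spectrum (SPI f) \<inter> cplane_up \<II>"
  let ?\<Omega> = "spectrum_space \<II> (SPI f)"
  have sp: "space ?\<Omega> = X" unfolding spectrum_space_def X_def by (simp add: space_restrict_space)
  have sets_\<Omega>: "sets ?\<Omega> = (\<inter>) X ` sets borel" unfolding spectrum_space_def X_def by (rule sets_restrict_space)
  define \<F> where "\<F> = {S. open S \<and> E (pre f S) = 0}"
  define U where "U = \<Union>\<F>"
  have U: "open U" "E (pre f U) = 0"
    unfolding U_def using null_open_cover[OF f, of \<F>] by (auto simp: \<F>_def)
  have XU: "cplane_up \<II> - X \<subseteq> U"
  proof
    fix s assume s: "s \<in> cplane_up \<II> - X"
    then have "s \<in> S_resolvent_set (SPI f)"
      using cplane_up_paravectors[OF \<II>] unfolding X_def S_spectrum_def by auto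
    moreover have "s \<in> cplane \<II>" using s cplane_up_iff[OF \<II>] by auto
    ultimately obtain \<epsilon> where "\<epsilon> > 0" "E (pre f (ball s \<epsilon>)) = 0"
      using resolvent_null_ball[OF f] by blast
    then show "s \<in> U" unfolding U_def \<F>_def by (auto intro!: exI[of _ "ball s \<epsilon>"])
  qed
  have Xup: "X \<subseteq> cplane_up \<II>" unfolding X_def by auto
  \<comment> \<open>A member of the trace algebra is Borel only relative to \<open>X\<close>, and
    \<open>X\<close> is not known to be Borel. Removing \<open>U\<close> helps, since
    \<open>U\<close> covers the rest of the half plane: the remainder is a Borel set cut with the
    half plane. As \<open>U\<close> has null preimage, nothing is lost in \<open>F\<close>.\<close>
  have NU: "N - U \<in> sets borel" if N: "N \<in> sets ?\<Omega>" for N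
  proof -
    obtain B where B: "B \<in> sets borel" "N = X \<inter> B" using N unfolding sets_\<Omega> by auto
    have "N - U = cplane_up \<II> \<inter> B - U" unfolding B(2) using XU Xup by auto
    then show ?thesis using B(1) cplane_up_borel[OF \<II>] U(1) by auto
  qed
  have pN: "pre f (N - U) \<in> sets M" if "N \<in> sets ?\<Omega>" for N by (rule aefin_sets[OF f NU[OF that]])
  define F where "F N = E (pre f (N - U))" for N
  have FX: "F X = id_blinfun"
  proof (rule blinfun_eqI)
    fix x
    have m: "pre f (cplane_up \<II>) \<in> sets M" "pre f U \<in> sets M"
      using U(1) by (auto intro!: aefin_sets[OF f] cplane_up_borel[OF \<II>])
    then have mi: "pre f (cplane_up \<II>) \<inter> pre f U \<in> sets M" by (rule sets.Int)
    have "X - U = cplane_up \<II> - U" using XU Xup by blast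
    moreover have "pre f (cplane_up \<II> - U) = pre f (cplane_up \<II>) - (pre f (cplane_up \<II>) \<inter> pre f U)"
      by auto
    moreover have "E (pre f (cplane_up \<II>) \<inter> pre f U) = 0"
      by (rule E_null_mono[OF mi m(2) Int_lower2 U(2)])
    moreover have "E (pre f (cplane_up \<II>) - (pre f (cplane_up \<II>) \<inter> pre f U)) x
        = E (pre f (cplane_up \<II>)) x - E (pre f (cplane_up \<II>) \<inter> pre f U) x"
      by (rule E_Diff[OF m(1) mi Int_lower1])
    ultimately show "F X x = id_blinfun x"
      unfolding F_def by (simp only: up blinfun.zero_left diff_zero)
  qed
  have F_spectral: "spectral_measure ?\<Omega> F"
    unfolding spectral_measure_def
  proof (intro conjI ballI allI impI)
    show "orth_projection (F N)" if "N \<in> sets ?\<Omega>" for N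
      using spectral pN[OF that] unfolding spectral_measure_def F_def by blast
    show "F (space ?\<Omega>) = id_blinfun" unfolding sp by (rule FX)
    fix A :: "nat \<Rightarrow> 'n clifford set" and x
    assume A: "range A \<subseteq> sets ?\<Omega>" "disjoint_family A"
    have "pre f ((\<Union>i. A i) - U) = (\<Union>i. pre f (A i - U))" by auto
    moreover have "disjoint_family (\<lambda>i. pre f (A i - U))"
      using A(2) unfolding disjoint_family_on_def by fastforce
    moreover have "range (\<lambda>i. pre f (A i - U)) \<subseteq> sets M" using A(1) pN by auto
    ultimately show "(\<lambda>i. F (A i) x) sums F (\<Union>i. A i) x"
      unfolding F_def using E_sums[of "\<lambda>i. pre f (A i - U)" x] by simp
  qed
  have F_assoc: "associated J ?\<Omega> F"
    using assoc pN unfolding associated_def F_def by blast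
  interpret F: spectral_calculus ?\<Omega> F J \<II>
    by unfold_locales (use F_spectral F_assoc J \<II> in auto)
  \<comment> \<open>Pulls a function on the spectrum back along \<open>f\<close>, with the default 0
    on the null set where \<open>f\<close> is infinite or misses \<open>X - U\<close>.\<close>
  define \<tau> :: "('n clifford \<Rightarrow> 'n clifford) \<Rightarrow> 'a \<Rightarrow> 'n clifford" where
    "\<tau> g \<omega> = (if f \<omega> \<in> Some ` (X - U) then g (finite_part (f \<omega>)) else 0)" for g \<omega>
  \<comment> \<open>The level 0 is excluded because it also contains the default values; it is
    recovered below as a complement.\<close>
  have \<tau>_pre: "\<tau> s -` {c} \<inter> space M = pre f ((s -` {c} \<inter> X) - U)" if "c \<noteq> 0" for s c
    using that unfolding \<tau>_def by (auto split: if_splits)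
  have SI_\<tau>: "scfun (\<tau> s) \<and> SI (\<tau> s) = F.SI s" if s: "F.scfun s" for s
  proof -
    have s': "finite (s ` X)" "\<And>c. c \<in> s ` X \<Longrightarrow> s -` {c} \<inter> X \<in> sets ?\<Omega>" "s ` X \<subseteq> cplane \<II>"
      using s unfolding F.scfun_def simple_function_def sp by auto
    let ?C = "insert 0 (s ` X)"
    have sc: "s -` {c} \<inter> X \<in> sets ?\<Omega>" for c
    proof (cases "c \<in> s ` X")
      case False
      then have "s -` {c} \<inter> X = {}" by auto
      then show ?thesis by simp
    qed (rule s'(2))
    have im: "\<tau> s ` space M \<subseteq> ?C" unfolding \<tau>_def by auto
    have nz: "\<tau> s -` {c} \<inter> space M \<in> sets M" if "c \<noteq> 0" for c
      unfolding \<tau>_pre[OF that] by (rule pN[OF sc])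
    have z: "\<tau> s -` {0} \<inter> space M = space M - (\<Union>c\<in>s ` X - {0}. \<tau> s -` {c} \<inter> space M)"
      using im by auto
    have m: "\<tau> s -` {c} \<inter> space M \<in> sets M" for c
    proof (cases "c = 0")
      case True
      show ?thesis unfolding True z using s'(1) nz by (intro sets.compl_sets sets.finite_UN) auto
    qed (rule nz)
    have "finite (\<tau> s ` space M)" using im s'(1) by (rule finite_subset[OF _ finite.insertI])
    moreover have "?C \<subseteq> cplane \<II>" using s'(3) by simp
    ultimately have "scfun (\<tau> s)"
      using m order_trans[OF im] unfolding scfun_def simple_function_def by blast
    moreover have "SI (\<tau> s) = F.SI s"
    proof (rule blinfun_eqI)
      fix x
      have "SI (\<tau> s) x = (\<Sum>c\<in>?C. E (\<tau> s -` {c} \<inter> space M) (cmplx c x))"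
        using s'(1) im m by (intro SI_partition) auto
      \<comment> \<open>The level sets for \<open>c = 0\<close> may differ on the two sides, but
        there \<open>cmplx 0\<close> makes both terms vanish.\<close>
      also have "\<dots> = (\<Sum>c\<in>?C. F (s -` {c} \<inter> space ?\<Omega>) (cmplx c x))"
      proof (rule sum.cong[OF refl])
        fix c show "E (\<tau> s -` {c} \<inter> space M) (cmplx c x) = F (s -` {c} \<inter> space ?\<Omega>) (cmplx c x)"
          by (cases "c = 0") (simp_all add: \<tau>_pre F_def sp)
      qed
      also have "\<dots> = F.SI s x"
        using s'(1) sc by (intro F.SI_partition[symmetric]) (auto simp: sp)
      finally show "SI (\<tau> s) x = F.SI s x" .
    qed
    ultimately show ?thesis ..
  qed
  have BI_\<tau>: "BI (\<tau> g) = F.BI g" if g: "F.bcfun g" for g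
  proof -
    obtain s where s: "\<And>j. F.scfun (s j)" "uniform_limit X s g sequentially"
      using F.simple_approx[OF g] unfolding sp by blast
    have "uniform_limit (space M) (\<lambda>j. \<tau> (s j)) (\<tau> g) sequentially"
    proof (rule uniform_limitI)
      fix e :: real assume e: "e > 0"
      show "\<forall>\<^sub>F j in sequentially. \<forall>\<omega>\<in>space M. dist (\<tau> (s j) \<omega>) (\<tau> g \<omega>) < e"
        using uniform_limitD[OF s(2) e]
        by (rule eventually_mono) (use e in \<open>auto simp: \<tau>_def\<close>)
    qed
    then have "(\<lambda>j. SI (\<tau> (s j))) \<longlonglongrightarrow> BI (\<tau> g)"
      using SI_\<tau>[OF s(1)] by (intro SI_tendsto_BI) auto
    moreover have "(\<lambda>j. F.SI (s j)) \<longlonglongrightarrow> F.BI g"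
      using s by (intro F.SI_tendsto_BI) (auto simp: sp)
    ultimately show ?thesis using SI_\<tau>[OF s(1)] by (auto intro: LIMSEQ_unique)
  qed
  have id: "F.aefin Some" by (rule aefin_Some_spectrum[OF F.spectral_calculus_axioms])
  define A where "A j = X \<inter> {z. norm z \<le> real j}" for j
  have As: "A j \<in> sets ?\<Omega>" for j
    unfolding sets_\<Omega> A_def by (intro imageI) simp
  have bA: "F.bdd_on Some (A j)" for j unfolding F.bdd_on_def using As by (auto simp: A_def)
  have incA: "incseq A" unfolding incseq_def A_def by (auto intro: order_trans)
  have UA: "(\<Union>j. A j) = X" unfolding A_def using real_arch_simple by blast
  have A: "bounding_sequence ?\<Omega> F Some A"
    unfolding F.bounding_sequence_iff F.exhausting_def using As bA incA UA FX by auto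
  \<comment> \<open>The pulled back sequence bounds \<open>f\<close>, with the same projections and
    truncations as \<open>A\<close> has for the identity. By \<open>mem_SPI\<close> the two graphs
    then satisfy the same equations.\<close>
  define A' where "A' j = pre f (A j - U)" for j
  have A's: "A' j \<in> sets M" for j unfolding A'_def by (rule pN[OF As])
  have "bdd_on f (A' j)" for j
    unfolding bdd_on_def using A's by (auto simp: A'_def A_def intro!: exI[of _ "real j"])
  moreover have "incseq A'" using incA unfolding incseq_def A'_def by blast
  moreover have "(\<Union>j. A' j) = pre f (X - U)" unfolding A'_def UA[symmetric] by auto
  ultimately have A': "bounding_sequence M E f A'"
    unfolding bounding_sequence_iff exhausting_def using A's FX by (auto simp: F_def)
  have trunc: "F.trunc Some (A j) = trunc f (A' j)" for j
  proof -
    have "F.trunc Some (A j) = BI (\<tau> (\<lambda>\<omega>. if \<omega> \<in> A j then finite_part (Some \<omega>) else 0))"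
      unfolding F.trunc_def by (rule BI_\<tau>[symmetric, OF F.bcfun_trunc[OF id bA]])
    also have "\<dots> = trunc f (A' j)"
      unfolding trunc_def
    proof (rule BI_cong)
      fix \<omega> assume "\<omega> \<in> space M"
      then show "\<tau> (\<lambda>\<omega>. if \<omega> \<in> A j then finite_part (Some \<omega>) else 0) \<omega> =
          (if \<omega> \<in> A' j then finite_part (f \<omega>) else 0)"
        unfolding \<tau>_def A'_def by (auto simp: A_def)
    qed
    finally show ?thesis .
  qed
  have "F (A j) = E (A' j)" for j unfolding F_def A'_def ..
  then have "SPI f = F.SPI Some"
    using mem_SPI[OF f A'] F.mem_SPI[OF id A] trunc by auto
  then show ?thesis
    unfolding is_spectral_measure_of_def using F_spectral F_assoc by blast
qed


section \<open>Location of the values of \<open>f\<close> and the spectral measure of its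
  integral\<close>

lemma upper_half_plane_of_ae:
  assumes f: "aefin f" and ae: "E_ae M E (\<lambda>\<omega>. f \<omega> \<in> insert None (Some ` cplane_up \<II>))"
  shows "E (pre f (cplane_up \<II>)) = id_blinfun"
proof -
  obtain N where N: "N \<in> sets M" "E N = 0" "{\<omega>\<in>space M. f \<omega> \<notin> insert None (Some ` cplane_up \<II>)} \<subseteq> N"
    using ae unfolding E_ae_def by blast
  have U: "pre f (cplane_up \<II>) \<in> sets M" by (rule aefin_sets[OF f cplane_up_borel[OF \<II>]])
  have sub: "space M - pre f (cplane_up \<II>) \<subseteq> N \<union> {\<omega>\<in>space M. f \<omega> = None}" using N(3) by blast
  have null: "E (N \<union> {\<omega>\<in>space M. f \<omega> = None}) = 0"
    by (rule E_null_Un[OF N(1) aefinD(3)[OF f] N(2) aefinD(4)[OF f]])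
  have "E (space M - pre f (cplane_up \<II>)) = 0"
    by (rule E_null_mono[OF sets.compl_sets[OF U] sets.Un[OF N(1) aefinD(3)[OF f]] sub null])
  then show ?thesis by (simp add: E_compl[OF U])
qed

text \<open>\<open>F\<close> lives where the imaginary part is nonnegative, so
  \<open>u \<bullet> J x \<ge> 0\<close> on the graph. Read through \<open>E\<close> with the same
  \<open>J\<close>, this says that \<open>f\<close> is not below the real axis.\<close>

lemma upper_half_plane_of_spectral_measure:
  assumes f: "aefin f" and F: "is_spectral_measure_of \<II> J (SPI f) F"
  shows "E (pre f (cplane_up \<II>)) = id_blinfun"
proof (rule upper_half_plane_of_ae[OF f])
  let ?\<Omega> = "spectrum_space \<II> (SPI f)"
  interpret F: spectral_calculus ?\<Omega> F J \<II>
    by unfold_locales (use F J \<II> in \<open>auto simp: is_spectral_measure_of_def\<close>)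
  have "u \<bullet> J x \<ge> 0" if xu: "(x, u) \<in> SPI f" for x u
  proof (rule F.inner_J_nonneg[OF aefin_Some_spectrum[OF F.spectral_calculus_axioms]])
    have "SPI f = F.SPI Some" using F unfolding is_spectral_measure_of_def by (elim conjE)
    then show "(x, u) \<in> F.SPI Some" by (rule subst) (rule xu)
    show "F.Imf Some \<omega> \<ge> 0" if "\<omega> \<in> space ?\<Omega>" for \<omega>
      using that cplane_up_iff[OF \<II>] by (auto simp: spectrum_space_def space_restrict_space)
  qed
  then have null: "E {\<omega>\<in>space M. f \<omega> \<noteq> None \<and> Imf f \<omega> < 0} = 0" by (rule Im_nonneg_of_SPI[OF f])
  have "{\<omega>\<in>space M. f \<omega> \<noteq> None \<and> Imf f \<omega> < 0} =
      {\<omega>\<in>space M. f \<omega> \<noteq> None} \<inter> {\<omega>\<in>space M. Imf f \<omega> < 0}" by auto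
  moreover have "{\<omega>\<in>space M. Imf f \<omega> < 0} \<in> sets M"
    using parts_measurable(2)[OF f] by (simp add: borel_measurable_iff_less)
  ultimately have "{\<omega>\<in>space M. f \<omega> \<noteq> None \<and> Imf f \<omega> < 0} \<in> sets M"
    using aefinD(5)[OF f] by auto
  moreover have "{\<omega>\<in>space M. f \<omega> \<notin> insert None (Some ` cplane_up \<II>)} \<subseteq>
      {\<omega>\<in>space M. f \<omega> \<noteq> None \<and> Imf f \<omega> < 0}"
  proof
    fix \<omega> assume "\<omega> \<in> {\<omega>\<in>space M. f \<omega> \<notin> insert None (Some ` cplane_up \<II>)}"
    then have w: "\<omega> \<in> space M" "f \<omega> \<notin> Some ` cplane_up \<II>" "f \<omega> \<noteq> None" by auto
    then obtain z where z: "f \<omega> = Some z" by auto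
    then have "z \<in> cplane \<II>" "z \<notin> cplane_up \<II>" using w aefinD(2)[OF f w(1)] by auto
    then show "\<omega> \<in> {\<omega>\<in>space M. f \<omega> \<noteq> None \<and> Imf f \<omega> < 0}"
      using w(1) z cplane_up_iff[OF \<II>, of z] by simp
  qed
  ultimately show "E_ae M E (\<lambda>\<omega>. f \<omega> \<in> insert None (Some ` cplane_up \<II>))"
    using null unfolding E_ae_def by blast
qed

text \<open>Uniqueness is applied to \<open>E\<close> with the integrand \<open>f\<close> and to
  \<open>F\<close> with the identity, both of which represent the same graph.\<close>

lemma spectral_measure_of_SPI:
  assumes f: "aefin f" and up: "E (pre f (cplane_up \<II>)) = id_blinfun"
    and J': "imaginary_op J'" and F: "is_spectral_measure_of \<II> J' (SPI f) F"
    and B: "B \<in> sets borel" "B \<subseteq> cplane_up \<II>"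
  shows "F (B \<inter> S_spectrum (SPI f)) = E (pre f B)"
proof -
  let ?\<Omega> = "spectrum_space \<II> (SPI f)"
  have sp: "space ?\<Omega> = S_spectrum (SPI f) \<inter> cplane_up \<II>"
    unfolding spectrum_space_def by (simp add: space_restrict_space)
  interpret F: spectral_calculus ?\<Omega> F J' \<II>
    by unfold_locales (use F J' \<II> in \<open>auto simp: is_spectral_measure_of_def\<close>)
  have "F (F.pre Some (cplane_up \<II>)) = F (space ?\<Omega>)"
    by (rule arg_cong[where f = F]) (auto simp: sp)
  then have upF: "F (F.pre Some (cplane_up \<II>)) = id_blinfun" by (rule trans) (rule F.E_space)
  have eq: "SPI f = F.SPI Some" using F unfolding is_spectral_measure_of_def by (elim conjE)
  have "E (pre f B) = F (F.pre Some B)"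
    by (rule spectral_measure_unique[OF spectral_calculus_axioms F.spectral_calculus_axioms f
          aefin_Some_spectrum[OF F.spectral_calculus_axioms] eq up upF B(1)])
  also have "F.pre Some B = B \<inter> S_spectrum (SPI f)" using B(2) by (auto simp: sp)
  finally show ?thesis ..
qed

end

text \<open>Item (ix) has two halves. A spectral measure taken with the given \<open>J\<close>
  already forces \<open>f\<close> into the closed upper half plane almost everywhere. If
  \<open>f\<close> is known to lie there, a spectral measure exists, and the formula holds for every
  imaginary operator that may accompany it.\<close>

theorem corollary10p0p7:
  fixes T :: "('h::{real_inner,complete_space}, 'n::{finite,linorder}) opgraph"
    and \<II> :: "'n clifford"
    and J A B :: "('h, 'n) bop"
    and E :: "'n clifford set \<Rightarrow> ('h, 'n) bop"
    and f g :: "'n clifford \<Rightarrow> 'n xclifford"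
  defines "\<Omega> \<equiv> spectrum_space \<II> T"
  defines "\<I> \<equiv> spectral_integral \<II> J \<Omega> E"
  assumes T: "right_linear T" "normal_op T"
    and \<II>: "\<II> \<in> imag_sphere"
    and J: "imaginary_op J"
    and A: "A \<in> bounded_ops" "self_adjoint (gr A)"
    and B: "B \<in> bounded_ops" "positive_op (gr B)"
    and commute: "A o\<^sub>L B = B o\<^sub>L A" "A o\<^sub>L J = J o\<^sub>L A" "B o\<^sub>L J = J o\<^sub>L B"
    and Z: "bounded_transform T = gr (A + (J o\<^sub>L B))"
    and E: "is_spectral_measure_of \<II> J T E"
    and f: "xmeasurable \<II> \<Omega> f" "E_ae \<Omega> E (\<lambda>\<omega>. f \<omega> \<noteq> None)"
    and g: "xmeasurable \<II> \<Omega> g" "E_ae \<Omega> E (\<lambda>\<omega>. g \<omega> \<noteq> None)"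
  shows
    "\<comment> \<open>(i)\<close> \<I> (\<lambda>\<omega>. xconj (f \<omega>)) = op_adjoint (\<I> f) \<and>
     \<comment> \<open>(ii)\<close> \<I> (\<lambda>\<omega>. xmult (f \<omega>) (g \<omega>)) = closure (op_comp (\<I> f) (\<I> g)) \<and>
     \<comment> \<open>(iii)\<close> (\<forall>c\<in>cplane \<II>. \<I> (\<lambda>\<omega>. xplus (xmult (f \<omega>) (Some c)) (g \<omega>)) =
        closure (op_plus (op_comp (\<I> f) (gr (cRe c *\<^sub>R id_blinfun + cIm \<II> c *\<^sub>R J))) (\<I> g))) \<and>
     \<comment> \<open>(iv)\<close> (right_linear (\<I> f) \<and> closed (\<I> f) \<and> normal_op (\<I> f)) \<and>
     \<comment> \<open>(v)\<close> Domain (op_comp (\<I> f) (\<I> g)) =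
        Domain (\<I> (\<lambda>\<omega>. xmult (f \<omega>) (g \<omega>))) \<inter> Domain (\<I> g) \<and>
     \<comment> \<open>(vi)\<close> (\<forall>(x, u)\<in>\<I> f. \<forall>y.
        cintegrable \<II> \<Omega> (\<lambda>M. cinner (E M (Pi_plus J \<II> x)) y) f \<and>
        cintegrable \<II> \<Omega> (\<lambda>M. cinner (E M (Pi_minus J \<II> x)) y) (\<lambda>\<omega>. xconj (f \<omega>)) \<and>
        cinner u y = cintegral \<II> \<Omega> (\<lambda>M. cinner (E M (Pi_plus J \<II> x)) y) f
          + cintegral \<II> \<Omega> (\<lambda>M. cinner (E M (Pi_minus J \<II> x)) y) (\<lambda>\<omega>. xconj (f \<omega>))) \<and>
     \<comment> \<open>(vii)\<close> (E_ae \<Omega> E (\<lambda>\<omega>. \<exists>r\<ge>0. f \<omega> = Some (r *\<^sub>R ebasis {})) \<longrightarrow> positive_op (\<I> f)) \<and>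
     \<comment> \<open>(viii)\<close> (right_linear (converse (\<I> f)) \<longleftrightarrow> E_ae \<Omega> E (\<lambda>\<omega>. f \<omega> \<noteq> Some 0)) \<and>
        (E_ae \<Omega> E (\<lambda>\<omega>. f \<omega> \<noteq> Some 0) \<longrightarrow> converse (\<I> f) = \<I> (\<lambda>\<omega>. xinverse (f \<omega>))) \<and>
     \<comment> \<open>(ix)\<close> (\<forall>F. is_spectral_measure_of \<II> J (\<I> f) F \<longrightarrow>
          (\<forall>M\<in>sets borel. M \<subseteq> cplane_up \<II> \<longrightarrow>
            F (M \<inter> S_spectrum (\<I> f)) =
            E {\<omega>\<in>space \<Omega>. f \<omega> \<in> Some ` M \<inter> f ` space \<Omega>})) \<and>
        (E_ae \<Omega> E (\<lambda>\<omega>. f \<omega> \<in> insert None (Some ` cplane_up \<II>)) \<longrightarrow>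
          (\<exists>F. is_spectral_measure_of \<II> J (\<I> f) F) \<and>
          (\<forall>J' F. imaginary_op J' \<and> is_spectral_measure_of \<II> J' (\<I> f) F \<longrightarrow>
            (\<forall>M\<in>sets borel. M \<subseteq> cplane_up \<II> \<longrightarrow>
              F (M \<inter> S_spectrum (\<I> f)) =
              E {\<omega>\<in>space \<Omega>. f \<omega> \<in> Some ` M \<inter> f ` space \<Omega>})))"
proof -
  have E': "spectral_measure \<Omega> E" "associated J \<Omega> E"
    using E unfolding is_spectral_measure_of_def \<Omega>_def by auto
  interpret spectral_calculus \<Omega> E J \<II>
    by unfold_locales (use E' J \<II> in auto)
  have f': "aefin f" and g': "aefin g" using f g by (auto intro: aefin_xmeasurable)
  have up: "E_ae \<Omega> E (\<lambda>\<omega>. f \<omega> \<noteq> Some 0) \<longleftrightarrow> E {\<omega>\<in>space \<Omega>. f \<omega> = Some 0} = 0"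
    using E_ae_iff[of "\<lambda>\<omega>. f \<omega> \<noteq> Some 0"] aefin_zero_set[OF f'] by simp
  have pre_eq: "{\<omega>\<in>space \<Omega>. f \<omega> \<in> Some ` M \<inter> f ` space \<Omega>} = pre f M" for M by auto
  have same_J: "E (pre f (cplane_up \<II>)) = id_blinfun"
    if F: "is_spectral_measure_of \<II> J (SPI f) F" for F
    by (rule upper_half_plane_of_spectral_measure[OF f' F])
  have upper: "E (pre f (cplane_up \<II>)) = id_blinfun"
    if "E_ae \<Omega> E (\<lambda>\<omega>. f \<omega> \<in> insert None (Some ` cplane_up \<II>))"
    by (rule upper_half_plane_of_ae[OF f' that])
  have c: "cRe c *\<^sub>R id_blinfun + cIm \<II> c *\<^sub>R J = cmplx c" for c
    by (simp add: cmplx_def)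
  show ?thesis
    unfolding \<I>_def c pre_eq up
  proof (intro conjI, goal_cases)
    case 1
    show ?case by (rule op_adjoint_SPI[OF f', symmetric])
  next
    case 2
    show ?case by (rule closure_comp_SPI[OF f' g'])
  next
    case 3
    show ?case by (intro ballI closure_plus_SPI[OF f' g'])
  next
    case 4
    show ?case by (rule right_linear_SPI[OF f'])
  next
    case 5
    show ?case by (rule closed_SPI[OF f'])
  next
    case 6
    show ?case by (rule normal_SPI[OF f'])
  next
    case 7
    show ?case by (rule Domain_comp_SPI[OF f' g'])
  next
    case 8
    show ?case
    proof safe
      fix x u y assume "(x, u) \<in> SPI f"
      note vi = SPI_cintegral[OF f' this, of y]
      show "cintegrable \<II> \<Omega> (\<lambda>M. cinner (E M (Pi_plus J \<II> x)) y) f" by (rule vi(1))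
      show "cintegrable \<II> \<Omega> (\<lambda>M. cinner (E M (Pi_minus J \<II> x)) y) (\<lambda>\<omega>. xconj (f \<omega>))" by (rule vi(2))
      show "cinner u y = cintegral \<II> \<Omega> (\<lambda>M. cinner (E M (Pi_plus J \<II> x)) y) f
          + cintegral \<II> \<Omega> (\<lambda>M. cinner (E M (Pi_minus J \<II> x)) y) (\<lambda>\<omega>. xconj (f \<omega>))" by (rule vi(3))
    qed
  next
    case 9
    show ?case by (intro impI positive_SPI[OF f'])
  next
    case 10
    show ?case by (rule right_linear_converse_SPI[OF f'])
  next
    case 11
    show ?case by (intro impI converse_SPI[OF f'])
  next
    case 12
    show ?case using spectral_measure_of_SPI[OF f' same_J J] by blast
  next
    case 13
    show ?case
      using spectral_measure_exists[OF f' upper] spectral_measure_of_SPI[OF f' upper] by blast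
  qed
qed

end
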